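(* Let $(V,B)$ be a Steiner system of type $S(t,n,v)$, where $t<n\le v$, let $C=C_{(n,v)}\setminus B$, and let $X_C\subset\mathbb P^n$ be the Complement of the Steiner configuration of points with respect to a collection $\mathcal H=\{H_1,\dots,H_v\}$ of distinct hyperplanes of $\mathbb P^n$ any $n$ of which meet in a point. If $t=n-1$, then $$\beta_{i,j}(I_{X_C})=\begin{cases}|B| & \text{if } (i,j)=(0,v-n),\\ (-1)^{i}\,\Delta^n h_{X_C}(v-n+1+i) & \text{if } j=v-n+1+i,\\ 0&\text{otherwise.}\end{cases}$$
   Context: A Steiner system $(V,B)$ of type $S(t,n,v)$ consists of a set $V=\{1,\dots,v\}$ and a collection $B$ of $n$-subsets of $V$ (blocks) such that every $t$-subset of $V$ is contained in a unique block; then $|B|=\binom vt/\binom nt$. $C_{(n,v)}$ denotes the set of all $n$-subsets of $V$. Let $H_j$ be defined by the linear form $\ell_j$ over the field $k$. For an $n$-subset $\sigma$ of $V$ put $P_\sigma=\bigcap_{i\in\sigma}H_i$, a point with ideal $I_{P_\sigma}=(\ell_i:i\in\sigma)\subseteq R=k[x_0,\dots,x_n]$. Then $X_C=\{P_\sigma:\sigma\in C\}$ and $I_{X_C}=\bigcap_{\sigma\in C}I_{P_\sigma}$. The function $h_{X_C}$ is given by $h_{X_C}(i)=H_{X_C}(i)-H_{X_C}(i-1)$, where $H_{X_C}(i)=\dim_k(R/I_{X_C})_i$ (zero for $i<0$); $\Delta g(i)=g(i)-g(i-1)$ and $\Delta^n$ is its $n$-fold iterate. The graded Betti numbers $\beta_{i,j}(I)$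 are defined by the minimal graded free resolution $\cdots\to\bigoplus_jR(-j)^{\beta_{1,j}(I)}\to\bigoplus_jR(-j)^{\beta_{0,j}(I)}\to R\to R/I\to0$.
   Formalization: The sign is (-1)^(i+1) instead of the printed (-1)^i (four points cut out by two conics have β_{1,4}=1, not -1), and it is also assumed that no n+1 of the hyperplanes share a point (the formula fails for four concurrent lines in the plane). *)

theory Defs
  imports "HOL-Library.Poly_Mapping" "HOL-Library.Cardinality" "Jordan_Normal_Form.Matrix"
begin

(* The polynomial ring k[x_0,...,x_n] is the type ('i,'k) mpoly with CARD('i) = n + 1:
   'i indexes the variables, and a monomial is an exponent vector 'i \<Rightarrow>\<^sub>0 nat. *)

type_synonym ('i, 'k) mpoly = "('i \<Rightarrow>\<^sub>0 nat) \<Rightarrow>\<^sub>0 'k"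

definition mdeg :: "('i::finite \<Rightarrow>\<^sub>0 nat) \<Rightarrow> nat" where
  "mdeg m = (\<Sum>i\<in>UNIV. Poly_Mapping.lookup m i)"

(* Degrees are integers; for d < 0 only the zero polynomial is homogeneous of degree d. *)
definition homogeneous :: "int \<Rightarrow> ('i::finite, 'k::field) mpoly \<Rightarrow> bool" where
  "homogeneous d p \<longleftrightarrow> (\<forall>m\<in>Poly_Mapping.keys p. int (mdeg m) = d)"

definition graded_part :: "int \<Rightarrow> ('i::finite, 'k::field) mpoly set" where
  "graded_part d = {p. homogeneous d p}"

definition poly_eval :: "('i::finite, 'k::field) mpoly \<Rightarrow> ('i \<Rightarrow> 'k) \<Rightarrow> 'k" where
  "poly_eval p x = (\<Sum>m\<in>Poly_Mapping.keys p.
     Poly_Mapping.lookup p m * (\<Prod>i\<in>UNIV. x i ^ Poly_Mapping.lookup m i))"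

definition const_poly :: "'k \<Rightarrow> ('i::finite, 'k::field) mpoly" where
  "const_poly c = Poly_Mapping.single 0 c"

(* The ring acts on itself by multiplication, so its span operator generates ideals. *)
definition ideal_gen :: "('i::finite, 'k::field) mpoly set \<Rightarrow> ('i, 'k) mpoly set" where
  "ideal_gen S = Modules.module.span (*) S"


subsection \<open>Steiner systems\<close>

definition n_subsets :: "nat \<Rightarrow> nat \<Rightarrow> nat set set" where
  "n_subsets n v = {s. s \<subseteq> {1..v} \<and> card s = n}"

definition steiner_system :: "nat \<Rightarrow> nat \<Rightarrow> nat \<Rightarrow> nat set set \<Rightarrow> bool" where
  "steiner_system t n v B \<longleftrightarrow>
     B \<subseteq> n_subsets n v \<and> (\<forall>T\<in>n_subsets t v. \<exists>!b. b \<in> B \<and> T \<subseteq> b)"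


subsection \<open>Hyperplanes in projective space and configurations of points\<close>

definition proj_space :: "('i::finite \<Rightarrow> 'k::field) set set" where
  "proj_space = (UNIV - {\<lambda>_. 0}) //
     {(x, y). x \<noteq> (\<lambda>_. 0) \<and> (\<exists>c. c \<noteq> 0 \<and> y = (\<lambda>i. c * x i))}"

definition linear_form :: "('i::finite, 'k::field) mpoly \<Rightarrow> bool" where
  "linear_form p \<longleftrightarrow> p \<noteq> 0 \<and> homogeneous 1 p"

definition hyperplane :: "('i::finite, 'k::field) mpoly \<Rightarrow> ('i \<Rightarrow> 'k) set set" where
  "hyperplane p = {P \<in> proj_space. \<forall>x\<in>P. poly_eval p x = 0}"

(* The second condition says that distinct n-subsets determine distinct points.  It is not
   implied by the first: in the plane any two distinct lines meet in a point, also when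
   all the lines are concurrent. *)
definition meet_properly :: "nat \<Rightarrow> nat \<Rightarrow> (nat \<Rightarrow> ('i::finite, 'k::field) mpoly) \<Rightarrow> bool" where
  "meet_properly n v l \<longleftrightarrow>
     (\<forall>s\<in>n_subsets n v. \<exists>P. (\<Inter>j\<in>s. hyperplane (l j)) = {P}) \<and>
     (\<forall>s\<in>n_subsets (n + 1) v. (\<Inter>j\<in>s. hyperplane (l j)) = {})"

(* Ideal of the set of points P_s, s in C, where P_s is cut out by the forms l j, j in s,
   and has ideal (l j : j in s).  It is the whole ring for C = {}. *)
definition config_ideal ::
  "(nat \<Rightarrow> ('i::finite, 'k::field) mpoly) \<Rightarrow> nat set set \<Rightarrow> ('i, 'k) mpoly set" where
  "config_ideal l C = (\<Inter>s\<in>C. ideal_gen (l ` s))"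


subsection \<open>Hilbert function\<close>

(* The residue classes of the elements of S form a k-basis of (R/I)_d. *)
definition quotient_basis ::
  "('i::finite, 'k::field) mpoly set \<Rightarrow> int \<Rightarrow> ('i, 'k) mpoly set \<Rightarrow> bool" where
  "quotient_basis I d S \<longleftrightarrow>
     finite S \<and> S \<subseteq> graded_part d \<and>
     (\<forall>c. (\<Sum>b\<in>S. const_poly (c b) * b) \<in> I \<longrightarrow> (\<forall>b\<in>S. c b = 0)) \<and>
     (\<forall>f\<in>graded_part d. \<exists>c. f - (\<Sum>b\<in>S. const_poly (c b) * b) \<in> I)"

definition hilbert_fun :: "('i::finite, 'k::field) mpoly set \<Rightarrow> int \<Rightarrow> nat" where
  "hilbert_fun I d = (THE m. \<exists>S. quotient_basis I d S \<and> card S = m)"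

definition backward_diff :: "(int \<Rightarrow> int) \<Rightarrow> int \<Rightarrow> int" where
  "backward_diff g i = g i - g (i - 1)"

definition h_fun :: "('i::finite, 'k::field) mpoly set \<Rightarrow> int \<Rightarrow> int" where
  "h_fun I = backward_diff (\<lambda>i. int (hilbert_fun I i))"


subsection \<open>Minimal graded free resolutions and graded Betti numbers\<close>

(* A complex ... \<rightarrow> G 2 \<rightarrow> G 1 \<rightarrow> G 0 = R of graded free modules of finite rank.  A list of
   degrees [a_1,...,a_r] stands for R(-a_1) \<oplus> ... \<oplus> R(-a_r), and the matrix D i represents
   the map from G (i + 1) to G i.  Such a map is graded of degree 0 iff its (p,q) entry is
   homogeneous of degree (q-th degree of the source) - (p-th degree of the target). *)
definition graded_free_resolution ::
  "('i::finite, 'k::field) mpoly set \<Rightarrow> (nat \<Rightarrow> int list) \<Rightarrow> (nat \<Rightarrow> ('i, 'k) mpoly mat) \<Rightarrow> bool" where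
  "graded_free_resolution I G D \<longleftrightarrow>
     G 0 = [0] \<and>
     (\<forall>i. D i \<in> carrier_mat (length (G i)) (length (G (Suc i)))) \<and>
     (\<forall>i. \<forall>p<length (G i). \<forall>q<length (G (Suc i)).
        homogeneous (G (Suc i) ! q - G i ! p) (D i $$ (p, q))) \<and>
     {(D 0 *\<^sub>v w) $ 0 | w. w \<in> carrier_vec (length (G 1))} = I \<and>
     (\<forall>i. {D (Suc i) *\<^sub>v w | w. w \<in> carrier_vec (length (G (Suc (Suc i))))} =
          {u \<in> carrier_vec (length (G (Suc i))). D i *\<^sub>v u = 0\<^sub>v (length (G i))})"

(* Minimality: no entry of D (i + 1) has a nonzero constant term, i.e. the image lies in
   (x_0,...,x_n) G (i + 1).  For D 0 this is automatic if I is proper and homogeneous; leaving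
   D 0 out makes the Betti numbers those of the module I also in the case I = R. *)
definition minimal_graded_free_resolution ::
  "('i::finite, 'k::field) mpoly set \<Rightarrow> (nat \<Rightarrow> int list) \<Rightarrow> (nat \<Rightarrow> ('i, 'k) mpoly mat) \<Rightarrow> bool" where
  "minimal_graded_free_resolution I G D \<longleftrightarrow>
     graded_free_resolution I G D \<and>
     (\<forall>i. \<forall>p<length (G (Suc i)). \<forall>q<length (G (Suc (Suc i))).
        Poly_Mapping.lookup (D (Suc i) $$ (p, q)) 0 = 0)"

(* The shift by one comes from indexing by I rather than by R/I: the 0-th module of the
   resolution of I is G 1. *)
definition graded_betti :: "('i::finite, 'k::field) mpoly set \<Rightarrow> nat \<Rightarrow> int \<Rightarrow> nat" where
  "graded_betti I i j =
     (THE b. \<exists>G D. minimal_graded_free_resolution I G D \<and> b = count_list (G (Suc i)) j)"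

end

theory Submission
  imports Defs "HOL-Library.Function_Algebras" "HOL-Library.Countable" "HOL-Computational_Algebra.Polynomial"
begin

text \<open>Put \<open>r = v - n\<close>. For an \<open>n\<close>-set \<open>s\<close> let \<open>F\<^sub>s\<close> be the product of the forms \<open>l a\<close> with \<open>a \<notin> s\<close>; it vanishes at
  every point \<open>P\<^sub>u\<close> with \<open>u \<noteq> s\<close> and not at \<open>P\<^sub>s\<close>. Counting dimensions, the \<open>F\<^sub>s\<close> form a basis in degree \<open>r\<close>, so
  that \<open>I\<close> has the basis \<open>F\<^sub>b\<close>, \<open>b \<in> B\<close>, there. Restricting to the lines cut out by \<open>n - 1\<close> of the
  hyperplanes shows that these \<open>F\<^sub>b\<close> have no linear syzygies, because two blocks share no
  \<open>(n - 1)\<close>-subset; this also gives that \<open>I\<close> vanishes below degree \<open>r\<close>.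

  From degree \<open>r\<close> on, \<open>R/I\<close> agrees with the product of the homogeneous coordinate rings of the points,
  made periodic, whose Koszul homology vanishes. Shifting dimensions along a minimal resolution, the
  \<open>i\<close>-th module has no generator in degree above \<open>r + 1 + i\<close>. Together with the lower bounds, all generators
  lie in degree \<open>r + 1 + i\<close>, apart from \<open>|B|\<close> generators of degree \<open>r\<close> for \<open>i = 0\<close>. No two terms
  of the resolution share a degree, so the Betti numbers are the coefficients, up to sign, of the
  numerator of the Hilbert series.\<close>

text \<open>\<open>graded_betti\<close> is a definite description, so a minimal resolution must be
  shown to exist and any two must agree in their degrees. Both rest on the same bounds: Koszul
  vanishing gives finite generation at every step, hence a resolution, and the degrees in an
  arbitrary minimal resolution are squeezed until the Hilbert function determines them.

  The constant in the upper bound: making a Koszul primitive vanish at the points takes a chain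
  whose coefficients lie two degrees below those of the cycle, and arbitrary values at the points
  are attained from degree r on; hence the p-th homology vanishes in internal degrees from r + 2 + p
  on. The lower bound gains one degree per step by minimality, so to meet the upper one it must
  already hold at the first syzygies: they have to begin in degree r + 2. Excluding linear syzygies
  between the products for the blocks is where the uniqueness of blocks enters.

  The field is arbitrary: polynomials cannot be identified with functions, and signs must also
  cancel in characteristic 2.\<close>

abbreviation lk :: "('a \<Rightarrow>\<^sub>0 'b::zero) \<Rightarrow> 'a \<Rightarrow> 'b" where "lk \<equiv> Poly_Mapping.lookup"
abbreviation unitm :: "'i \<Rightarrow> ('i \<Rightarrow>\<^sub>0 nat)" where "unitm a \<equiv> Poly_Mapping.single a (Suc 0)"

section \<open>Coefficients of products with constants and variables\<close>

definition var :: "'i::finite \<Rightarrow> ('i, 'k::field) mpoly" where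
  "var a = Poly_Mapping.single (unitm a) 1"

lemma mdeg_0 [simp]: "mdeg 0 = 0"
  by (simp add: mdeg_def)

lemma mdeg_add: "mdeg (a + b) = mdeg a + mdeg b"
  by (simp add: mdeg_def lookup_add sum.distrib)

lemma mdeg_unit [simp]: "mdeg (unitm a) = 1"
  by (simp add: mdeg_def lookup_single when_def)

lemma mdeg_eq_0_iff: "mdeg m = 0 \<longleftrightarrow> m = 0"
  by (auto simp: mdeg_def poly_mapping_eq_iff fun_eq_iff)

lemma minus_add_unit: "lk m a > 0 \<Longrightarrow> m - unitm a + unitm a = m"
  by (rule poly_mapping_eqI) (auto simp: lookup_add lookup_minus lookup_single when_def)

lemma poly_mapping_sum_monomials:
  "(\<Sum>k\<in>Poly_Mapping.keys p. Poly_Mapping.single k (lk p k)) = p"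
  by (rule poly_mapping_eqI) (auto simp: lookup_sum lookup_single when_def in_keys_iff)

lemma lookup_single_mult:
  fixes f :: "('i \<Rightarrow>\<^sub>0 nat) \<Rightarrow>\<^sub>0 'k::comm_ring_1"
  shows "lk (Poly_Mapping.single s c * f) m = (\<Sum>k\<in>Poly_Mapping.keys f. c * lk f k when s + k = m)"
proof -
  have "Poly_Mapping.single s c * f = Poly_Mapping.single s c * (\<Sum>k\<in>Poly_Mapping.keys f. Poly_Mapping.single k (lk f k))"
    by (simp add: poly_mapping_sum_monomials)
  also have "\<dots> = (\<Sum>k\<in>Poly_Mapping.keys f. Poly_Mapping.single (s + k) (c * lk f k))"
    by (simp add: sum_distrib_left mult_single)
  finally show ?thesis by (simp add: lookup_sum lookup_single)
qed

lemma lookup_const_mult [simp]: "lk (const_poly c * f) m = c * lk f m"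
  unfolding const_poly_def lookup_single_mult
  by (cases "m \<in> Poly_Mapping.keys f") (auto simp: when_def in_keys_iff)

lemma lookup_var_mult: "lk (var a * f) m = (if lk m a > 0 then lk f (m - unitm a) else 0)"
proof (cases "lk m a > 0")
  case True
  have eq: "unitm a + k = m \<longleftrightarrow> k = m - unitm a" for k
    using minus_add_unit[OF True] by (metis add.commute add_diff_cancel_right')
  show ?thesis using True unfolding var_def lookup_single_mult eq
    by (cases "m - unitm a \<in> Poly_Mapping.keys f") (auto simp: when_def in_keys_iff)
next
  case False
  have "unitm a + k \<noteq> m" for k using False by (auto simp: lookup_add)
  thus ?thesis using False unfolding var_def lookup_single_mult by (auto simp: when_def)
qed

lemma const_poly_0 [simp]: "const_poly 0 = 0"
  and const_poly_1 [simp]: "const_poly 1 = 1"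
  and const_poly_add: "const_poly (a + b) = const_poly a + const_poly b"
  and const_poly_minus: "const_poly (- a) = - const_poly a"
  and const_poly_mult: "const_poly (a * b) = const_poly a * const_poly b"
  by (auto simp: const_poly_def single_add single_uminus mult_single)

lemma const_poly_sum: "const_poly (sum f A) = (\<Sum>x\<in>A. const_poly (f x))"
  by (induction A rule: infinite_finite_induct) (auto simp: const_poly_add)

lemma const_poly_prod: "const_poly (prod f A) = (\<Prod>x\<in>A. const_poly (f x))"
  by (induction A rule: infinite_finite_induct) (auto simp: const_poly_mult)

lemma const_poly_power: "const_poly (c ^ k) = const_poly c ^ k"
  by (induction k) (auto simp: const_poly_mult)

subsection \<open>Homogeneous polynomials\<close>

lemma homogeneous_iff: "homogeneous d p \<longleftrightarrow> (\<forall>m. lk p m \<noteq> 0 \<longrightarrow> int (mdeg m) = d)"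
  by (auto simp: homogeneous_def in_keys_iff)

lemma homogeneous_0 [simp]: "homogeneous d 0"
  by (simp add: homogeneous_iff)

lemma homogeneous_add: "homogeneous d p \<Longrightarrow> homogeneous d q \<Longrightarrow> homogeneous d (p + q)"
  by (auto simp: homogeneous_iff lookup_add) (metis add_0)

lemma homogeneous_uminus: "homogeneous d p \<Longrightarrow> homogeneous d (- p)"
  by (auto simp: homogeneous_iff)

lemma homogeneous_diff: "homogeneous d p \<Longrightarrow> homogeneous d q \<Longrightarrow> homogeneous d (p - q)"
  using homogeneous_add[of d p "- q"] homogeneous_uminus by auto

lemma homogeneous_sum: "(\<And>x. x \<in> A \<Longrightarrow> homogeneous d (f x)) \<Longrightarrow> homogeneous d (sum f A)"
  by (induction A rule: infinite_finite_induct) (auto intro: homogeneous_add)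

lemma homogeneous_mult:
  assumes "homogeneous d p" "homogeneous e q"
  shows "homogeneous (d + e) (p * q)"
  unfolding homogeneous_def
proof
  fix m assume "m \<in> Poly_Mapping.keys (p * q)"
  then obtain a b where "m = a + b" "a \<in> Poly_Mapping.keys p" "b \<in> Poly_Mapping.keys q"
    using keys_mult[of p q] by blast
  thus "int (mdeg m) = d + e" using assms by (auto simp: homogeneous_def mdeg_add)
qed

lemma homogeneous_const [simp]: "homogeneous 0 (const_poly c)"
  by (auto simp: homogeneous_iff const_poly_def lookup_single when_def)

lemma homogeneous_const_mult: "homogeneous d p \<Longrightarrow> homogeneous d (const_poly c * p)"
  using homogeneous_mult[OF homogeneous_const] by fastforce

lemma homogeneous_var [simp]: "homogeneous 1 (var a)"
  by (auto simp: homogeneous_iff var_def lookup_single when_def)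

lemma homogeneous_1 [simp]: "homogeneous 0 1"
  using homogeneous_const[of 1] by simp

lemma homogeneous_power: "homogeneous d p \<Longrightarrow> homogeneous (int k * d) (p ^ k)"
  by (induction k) (auto simp: algebra_simps dest: homogeneous_mult)

lemma homogeneous_prod:
  "(\<And>x. x \<in> A \<Longrightarrow> homogeneous (d x) (f x)) \<Longrightarrow> homogeneous (\<Sum>x\<in>A. d x) (prod f A)"
  by (induction A rule: infinite_finite_induct) (auto intro: homogeneous_mult)

lemma homogeneous_neg: "homogeneous d p \<Longrightarrow> d < 0 \<Longrightarrow> p = 0"
  by (rule poly_mapping_eqI) (auto simp: homogeneous_iff)

lemma homogeneous_lookup_0: "homogeneous d p \<Longrightarrow> d \<noteq> 0 \<Longrightarrow> lk p 0 = 0"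
  by (auto simp: homogeneous_iff)

lemma homogeneous_deg_0: "homogeneous 0 p \<Longrightarrow> p = const_poly (lk p 0)"
  by (rule poly_mapping_eqI) (auto simp: homogeneous_iff const_poly_def lookup_single when_def mdeg_eq_0_iff)

section \<open>Homogeneous components\<close>

definition hom_part :: "int \<Rightarrow> ('i::finite, 'k::field) mpoly \<Rightarrow> ('i, 'k) mpoly" where
  "hom_part d p = Abs_poly_mapping (\<lambda>m. lk p m when int (mdeg m) = d)"

lemma lookup_hom_part: "lk (hom_part d p) m = (lk p m when int (mdeg m) = d)"
proof -
  have "finite {m. (lk p m when int (mdeg m) = d) \<noteq> 0}"
    by (rule finite_subset[of _ "Poly_Mapping.keys p"]) (auto simp: in_keys_iff)
  thus ?thesis by (simp add: hom_part_def)
qed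

lemma homogeneous_hom_part [simp]: "homogeneous d (hom_part d p)"
  by (auto simp: homogeneous_iff lookup_hom_part)

lemma hom_part_homogeneous: "homogeneous d p \<Longrightarrow> hom_part e p = (p when e = d)"
  by (rule poly_mapping_eqI) (auto simp: lookup_hom_part homogeneous_iff when_def)

lemma hom_part_add: "hom_part d (p + q) = hom_part d p + hom_part d q"
  by (rule poly_mapping_eqI) (auto simp: lookup_hom_part lookup_add when_def)

lemma hom_part_0 [simp]: "hom_part d 0 = 0"
  by (rule poly_mapping_eqI) (auto simp: lookup_hom_part)

lemma hom_part_sum: "hom_part d (sum f A) = (\<Sum>x\<in>A. hom_part d (f x))"
  by (induction A rule: infinite_finite_induct) (auto simp: hom_part_add)

lemma sum_hom_part:
  assumes "finite E" "\<And>m. m \<in> Poly_Mapping.keys p \<Longrightarrow> int (mdeg m) \<in> E"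
  shows "(\<Sum>d\<in>E. hom_part d p) = p"
proof (rule poly_mapping_eqI)
  fix m
  have "lk (\<Sum>d\<in>E. hom_part d p) m = (if int (mdeg m) \<in> E then lk p m else 0)"
    using assms(1) by (simp add: lookup_sum lookup_hom_part when_def)
  thus "lk (\<Sum>d\<in>E. hom_part d p) m = lk p m"
    using assms(2)[of m] by (auto simp: in_keys_iff)
qed

lemma hom_part_mult:
  assumes "homogeneous d p"
  shows "hom_part e (p * q) = p * hom_part (e - d) q"
proof -
  \<comment> \<open>The index \<open>e - d\<close> is put into E even where q has no such component,
    so that it is a summand in the last step.\<close>
  define E where "E = insert (e - d) ((\<lambda>m. int (mdeg m)) ` Poly_Mapping.keys q)"
  have E: "finite E" "(\<Sum>c\<in>E. hom_part c q) = q"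
    by (auto simp: E_def intro!: sum_hom_part)
  have h: "homogeneous (d + c) (p * hom_part c q)" for c
    by (intro homogeneous_mult assms) auto
  have "hom_part e (p * q) = hom_part e (\<Sum>c\<in>E. p * hom_part c q)"
    by (subst (1) E(2)[symmetric]) (simp add: sum_distrib_left)
  also have "\<dots> = (\<Sum>c\<in>E. p * hom_part c q when e = d + c)"
    by (simp add: hom_part_sum hom_part_homogeneous[OF h])
  also have "\<dots> = (\<Sum>c\<in>E. if c = e - d then p * hom_part c q else 0)"
    by (intro sum.cong) (auto simp: when_def)
  finally show ?thesis using E(1) by (simp add: E_def)
qed

lemma homogeneous_lin: "homogeneous 1 p \<Longrightarrow> p = (\<Sum>a\<in>UNIV. const_poly (lk p (unitm a)) * var a)"
proof (rule poly_mapping_eqI)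
  fix m assume p: "homogeneous 1 p"
  have r: "lk (\<Sum>a\<in>UNIV. const_poly (lk p (unitm a)) * var a) m
     = (\<Sum>a\<in>UNIV. lk p (unitm a) when unitm a = m)"
    by (simp add: lookup_sum var_def lookup_single mult_when)
  show "lk p m = lk (\<Sum>a\<in>UNIV. const_poly (lk p (unitm a)) * var a) m"
  proof (cases "\<exists>b. m = unitm b")
    case True
    then obtain b where b: "m = unitm b" by blast
    have "unitm a = m \<longleftrightarrow> a = b" for a unfolding b
      by (metis lookup_single_eq lookup_single_not_eq nat.simps(3))
    thus ?thesis unfolding r by (simp add: when_def b)
  next
    case False
    have "mdeg m \<noteq> 1"
    proof
      assume d: "mdeg m = 1"
      then obtain b where b: "lk m b > 0" by (metis mdeg_def sum.neutral neq0_conv zero_neq_one)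
      have "mdeg (m - unitm b) = 0" using arg_cong[OF minus_add_unit[OF b], of mdeg] d
        by (simp add: mdeg_add)
      hence "m = unitm b" using minus_add_unit[OF b] by (simp add: mdeg_eq_0_iff)
      thus False using False by blast
    qed
    hence "lk p m = 0" using p by (auto simp: homogeneous_iff)
    moreover have "(\<Sum>a\<in>UNIV. lk p (unitm a) when unitm a = m) = 0"
      using False by (intro sum.neutral) (auto simp: when_def)
    ultimately show ?thesis unfolding r by simp
  qed
qed

subsection \<open>Evaluation\<close>

text \<open>Coefficients pass through h so that one substitution serves three targets: k itself,
  polynomials in one variable (restriction to a line), and R (reduction modulo the ideal of a
  point).\<close>

definition peval :: "('k \<Rightarrow> 'r) \<Rightarrow> ('i \<Rightarrow> 'r) \<Rightarrow> ('i::finite, 'k::field) mpoly \<Rightarrow> 'r::comm_ring_1" where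
  "peval h y p = (\<Sum>m\<in>Poly_Mapping.keys p. h (lk p m) * (\<Prod>i\<in>UNIV. y i ^ lk m i))"

locale coeff_hom =
  fixes h :: "'k::field \<Rightarrow> 'r::comm_ring_1"
  assumes h_add: "h (a + b) = h a + h b" and h_mult: "h (a * b) = h a * h b" and h_1: "h 1 = 1"
begin

lemma h_0: "h 0 = 0"
  using h_add[of 0 0] by simp

lemma peval_superset:
  assumes "finite K" "Poly_Mapping.keys p \<subseteq> K"
  shows "peval h y p = (\<Sum>m\<in>K. h (lk p m) * (\<Prod>i\<in>UNIV. y i ^ lk m i))"
  unfolding peval_def using assms
  by (intro sum.mono_neutral_left) (auto simp: in_keys_iff h_0)

lemma peval_add: "peval h y (p + q) = peval h y p + peval h y q"
proof -
  let ?K = "Poly_Mapping.keys p \<union> Poly_Mapping.keys q"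
  have "Poly_Mapping.keys (p + q) \<subseteq> ?K" by (rule keys_add)
  thus ?thesis
    by (simp add: peval_superset[of ?K] lookup_add h_add algebra_simps sum.distrib)
qed

lemma peval_0 [simp]: "peval h y 0 = 0"
  by (simp add: peval_def)

lemma peval_sum: "peval h y (sum f A) = (\<Sum>x\<in>A. peval h y (f x))"
  by (induction A rule: infinite_finite_induct) (auto simp: peval_add)

lemma peval_single: "peval h y (Poly_Mapping.single m c) = h c * (\<Prod>i\<in>UNIV. y i ^ lk m i)"
  by (subst peval_superset[of "{m}"]) (auto simp: h_0)

lemma peval_mult: "peval h y (p * q) = peval h y p * peval h y q"
proof -
  have "p * q = (\<Sum>a\<in>Poly_Mapping.keys p. Poly_Mapping.single a (lk p a)) * (\<Sum>b\<in>Poly_Mapping.keys q. Poly_Mapping.single b (lk q b))"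
    by (simp add: poly_mapping_sum_monomials)
  also have "\<dots> = (\<Sum>a\<in>Poly_Mapping.keys p. \<Sum>b\<in>Poly_Mapping.keys q. Poly_Mapping.single (a + b) (lk p a * lk q b))"
    by (simp add: sum_product mult_single)
  finally have "peval h y (p * q) = (\<Sum>a\<in>Poly_Mapping.keys p. \<Sum>b\<in>Poly_Mapping.keys q.
      (h (lk p a) * (\<Prod>i\<in>UNIV. y i ^ lk a i)) * (h (lk q b) * (\<Prod>i\<in>UNIV. y i ^ lk b i)))"
    by (simp add: peval_sum peval_single lookup_add power_add h_mult prod.distrib algebra_simps)
  thus ?thesis by (simp add: sum_product peval_def)
qed

lemma peval_const [simp]: "peval h y (const_poly c) = h c"
  by (simp add: const_poly_def peval_single)

lemma peval_1 [simp]: "peval h y 1 = 1"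
  using peval_const[of y 1] by (simp add: h_1)

lemma peval_var [simp]: "peval h y (var a) = y a"
proof -
  have "(\<Prod>i\<in>UNIV. y i ^ lk (unitm a) i) = (\<Prod>i\<in>UNIV. if i = a then y i else 1)"
    by (intro prod.cong) (auto simp: lookup_single when_def)
  thus ?thesis by (simp add: var_def peval_single h_1)
qed

lemma peval_diff: "peval h y (p - q) = peval h y p - peval h y q"
  using peval_add[of y "p - q" q] by (simp add: algebra_simps)

lemma peval_prod: "peval h y (prod f A) = (\<Prod>x\<in>A. peval h y (f x))"
  by (induction A rule: infinite_finite_induct) (auto simp: peval_mult)

lemma peval_power: "peval h y (p ^ k) = peval h y p ^ k"
  by (induction k) (auto simp: peval_mult)

end

text \<open>Monomials are reached by splitting off one variable at a time. This lets a congruence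
  between a polynomial and its image under a substitution be checked on generators.\<close>

lemma mpoly_induct [case_names const var add mult]:
  assumes "\<And>c. P (const_poly c)" "\<And>a. P (var a)"
    and add: "\<And>p q. P p \<Longrightarrow> P q \<Longrightarrow> P (p + q)" and mult: "\<And>p q. P p \<Longrightarrow> P q \<Longrightarrow> P (p * q)"
  shows "P p"
proof -
  have mon: "P (Poly_Mapping.single m c)" for m c
  proof (induction "mdeg m" arbitrary: m)
    case 0
    thus ?case using assms(1)[of c] by (simp add: mdeg_eq_0_iff const_poly_def)
  next
    case (Suc d)
    then obtain b where b: "lk m b > 0" by (metis mdeg_def sum.neutral neq0_conv Zero_not_Suc)
    have m: "m - unitm b + unitm b = m" by (rule minus_add_unit[OF b])
    have "P (Poly_Mapping.single (m - unitm b) c)"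
      using arg_cong[OF m, of mdeg] Suc by (simp add: mdeg_add)
    from mult[OF this assms(2)[of b]] show ?case by (simp add: var_def mult_single m[simplified])
  qed
  have "P (\<Sum>m\<in>K. Poly_Mapping.single m (lk p m))" if "finite K" for K
    using that by induction (use assms(1)[of 0] in \<open>auto intro: add mon\<close>)
  from this[OF finite_keys[of p]] show ?thesis by (simp add: poly_mapping_sum_monomials)
qed

interpretation ev: coeff_hom "\<lambda>c. c"
  by unfold_locales auto

lemma poly_eval_peval: "poly_eval p x = peval (\<lambda>c. c) x p"
  by (simp add: poly_eval_def peval_def)

lemmas poly_eval_simps = poly_eval_peval ev.peval_add ev.peval_diff ev.peval_mult ev.peval_sum
  ev.peval_prod ev.peval_power

text \<open>The factor c may lie in any commutative ring because it is both a scalar rescaling a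
  point and a variable replacing all others.\<close>

lemma homogeneous_power_prod:
  assumes "homogeneous d p" "m \<in> Poly_Mapping.keys p"
  shows "(\<Prod>i\<in>UNIV. (g i * c) ^ lk m i) = (\<Prod>i\<in>UNIV. g i ^ lk m i) * (c::'r::comm_ring_1) ^ nat d"
proof -
  have "nat d = mdeg m" using assms by (auto simp: homogeneous_def)
  thus ?thesis by (simp add: power_mult_distrib prod.distrib mdeg_def power_sum)
qed

lemma poly_eval_scale:
  assumes "homogeneous d p"
  shows "poly_eval p (\<lambda>i. c * x i) = c ^ nat d * poly_eval p x"
proof -
  have "poly_eval p (\<lambda>i. x i * c) = (\<Sum>m\<in>Poly_Mapping.keys p. lk p m * (\<Prod>i\<in>UNIV. x i ^ lk m i)  * c ^ nat d)"
    unfolding poly_eval_def by (intro sum.cong) (auto simp: homogeneous_power_prod[OF assms])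
  thus ?thesis by (simp add: poly_eval_def sum_distrib_left algebra_simps)
qed

subsection \<open>The Koszul complex\<close>

text \<open>With \<open>V\<close> the space spanned by the variables, an element of \<open>\<Lambda>\<^sup>p V \<otimes> M\<close> is represented by the function
  sending a set of \<open>p\<close> variables to its coefficient; \<open>koszul_d c\<close> is the Koszul differential of the
  sequence \<open>c\<close>, and \<open>koszul_wedge a\<close> is exterior multiplication by the basis vector of \<open>a\<close>.\<close>

definition koszul_sign :: "'i::finite \<Rightarrow> 'i set \<Rightarrow> 'r::comm_ring_1" where
  "koszul_sign a S = (- 1) ^ card {b \<in> S. to_nat b < to_nat a}"

definition koszul_d :: "('i::finite \<Rightarrow> 'r::comm_ring_1) \<Rightarrow> ('i set \<Rightarrow> 'r) \<Rightarrow> 'i set \<Rightarrow> 'r" where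
  "koszul_d c f S = (\<Sum>a\<in>-S. koszul_sign a S * c a * f (insert a S))"

definition koszul_wedge :: "'i::finite \<Rightarrow> ('i set \<Rightarrow> 'r::comm_ring_1) \<Rightarrow> 'i set \<Rightarrow> 'r" where
  "koszul_wedge a f S = (if a \<in> S then koszul_sign a (S - {a}) * f (S - {a}) else 0)"

lemma koszul_sign_sq [simp]: "koszul_sign a S * koszul_sign a S = 1"
  by (simp add: koszul_sign_def flip: power_add mult_2)

lemma koszul_sign_sq_left [simp]: "koszul_sign a S * (koszul_sign a S * x) = x"
  by (metis mult.assoc mult_1 koszul_sign_sq)

lemma koszul_sign_insert:
  assumes "a \<notin> S"
  shows "koszul_sign b (insert a S) = (if to_nat a < to_nat b then - koszul_sign b S else koszul_sign b S)"
proof (cases "to_nat a < to_nat b")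
  case True
  hence "{x \<in> insert a S. to_nat x < to_nat b} = insert a {x \<in> S. to_nat x < to_nat b}" by auto
  thus ?thesis using True assms by (simp add: koszul_sign_def)
next
  case False
  hence "{x \<in> insert a S. to_nat x < to_nat b} = {x \<in> S. to_nat x < to_nat b}" by auto
  thus ?thesis using False by (simp add: koszul_sign_def)
qed

text \<open>Basis vectors anticommute: of two distinct indices exactly one precedes the other in the
  order that \<open>to_nat\<close> puts on the index type, so exactly one of the two signs
  flips.\<close>

lemma koszul_sign_swap:
  assumes "a \<notin> S" "b \<notin> S" "a \<noteq> b"
  shows "koszul_sign a S * koszul_sign b (insert a S) = - (koszul_sign b S * koszul_sign a (insert b S) :: 'r::comm_ring_1)"
proof -
  have "to_nat a \<noteq> to_nat b" using assms(3) by simp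
  thus ?thesis using assms by (auto simp: koszul_sign_insert mult.commute)
qed

text \<open>Splitting the pairs along an order avoids concluding that a sum equal to its negative is
  zero, which fails in characteristic 2; the diagonal is assumed to vanish for the same
  reason.\<close>

lemma sum_antisym:
  fixes g :: "'i::finite \<Rightarrow> 'i \<Rightarrow> 'r::comm_ring_1"
  assumes "\<And>a b. a \<noteq> b \<Longrightarrow> g a b = - g b a" "\<And>a. g a a = 0"
  shows "(\<Sum>a\<in>UNIV. \<Sum>b\<in>UNIV. g a b) = 0"
proof -
  let ?l = "\<lambda>a b. if to_nat a < to_nat b then g a b else 0"
  have "g a b = ?l a b - ?l b a" for a b
    using assms(1)[of a b] assms(2) by (cases "to_nat a" "to_nat b" rule: linorder_cases) auto
  hence "(\<Sum>a\<in>UNIV. \<Sum>b\<in>UNIV. g a b) = (\<Sum>a\<in>UNIV. \<Sum>b\<in>UNIV. ?l a b) - (\<Sum>a\<in>UNIV. \<Sum>b\<in>UNIV. ?l b a)"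
    unfolding sum_subtractf[symmetric] by (intro sum.cong refl)
  also have "(\<Sum>a\<in>UNIV. \<Sum>b\<in>UNIV. ?l b a) = (\<Sum>b\<in>UNIV. \<Sum>a\<in>UNIV. ?l b a)" by (rule sum.swap)
  finally show ?thesis by simp
qed

lemma koszul_d_koszul_d:
  fixes c :: "'i::finite \<Rightarrow> 'r::comm_ring_1"
  shows "koszul_d c (koszul_d c f) S = 0"
proof -
  \<comment> \<open>Extension by zero to all pairs gives a square index range, where antisymmetry
    cancels the terms.\<close>
  define g where "g a b = (if a \<notin> S \<and> b \<notin> S \<and> a \<noteq> b
      then koszul_sign a S * koszul_sign b (insert a S) * (c a * c b * f (insert a (insert b S))) else 0)" for a b
  have "koszul_d c (koszul_d c f) S = (\<Sum>a\<in>-S. \<Sum>b\<in>- insert a S. g a b)"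
    unfolding koszul_d_def
  proof (intro sum.cong refl)
    fix a assume a: "a \<in> -S"
    show "koszul_sign a S * c a * (\<Sum>b\<in>-insert a S. koszul_sign b (insert a S) * c b * f (insert b (insert a S)))
      = (\<Sum>b\<in>-insert a S. g a b)"
      unfolding sum_distrib_left
    proof (intro sum.cong refl)
      fix b assume b: "b \<in> - insert a S"
      hence "a \<noteq> b" by auto
      thus "koszul_sign a S * c a * (koszul_sign b (insert a S) * c b * f (insert b (insert a S))) = g a b"
        using a b by (simp add: g_def insert_commute mult_ac)
    qed
  qed
  also have "\<dots> = (\<Sum>a\<in>-S. \<Sum>b\<in>UNIV. g a b)"
    by (intro sum.cong refl sum.mono_neutral_left) (auto simp: g_def)
  also have "\<dots> = (\<Sum>a\<in>UNIV. \<Sum>b\<in>UNIV. g a b)"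
    by (intro sum.mono_neutral_left) (auto simp: g_def)
  also have "\<dots> = 0"
  proof (rule sum_antisym)
    fix a b :: 'i assume "a \<noteq> b"
    thus "g a b = - g b a"
      using koszul_sign_swap[of a S b, where 'r='r] by (auto simp: g_def insert_commute mult.commute)
  qed (simp add: g_def)
  finally show ?thesis .
qed

text \<open>The homotopy formula: \<open>koszul_wedge a\<close> contracts the complex up to the
  factor \<open>c a\<close>. Exactness at a point, where some coordinate is invertible, and in every
  nonzero multidegree of the polynomial ring both come from it.\<close>

lemma koszul_d_koszul_wedge:
  fixes c :: "'i::finite \<Rightarrow> 'r::comm_ring_1"
  shows "koszul_d c (koszul_wedge a f) S = c a * f S - koszul_wedge a (koszul_d c f) S"
proof (cases "a \<in> S")
  case False
  have "koszul_d c (koszul_wedge a f) S = (\<Sum>b\<in>-S. if b = a then c a * f S else 0)"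
    unfolding koszul_d_def using False
    by (intro sum.cong refl) (auto simp: koszul_wedge_def algebra_simps)
  thus ?thesis using False by (simp add: koszul_wedge_def)
next
  case True
  define S' where "S' = S - {a}"
  have S: "S = insert a S'" "a \<notin> S'" using True by (auto simp: S'_def)
  have "koszul_d c (koszul_wedge a f) S = (\<Sum>b\<in>-S. - (koszul_sign a S' * koszul_sign b S' * c b * f (insert b S')))"
    unfolding koszul_d_def
  proof (intro sum.cong refl)
    fix b assume "b \<in> -S"
    hence b: "b \<notin> S'" "b \<noteq> a" by (auto simp: S)
    have e: "insert b S - {a} = insert b S'" using b S by auto
    have "koszul_sign b S * (koszul_sign a (insert b S')::'r) = - (koszul_sign a S' * koszul_sign b S')"
      using b S(2) koszul_sign_swap[of b S' a, where 'r='r] by (auto simp: S(1) koszul_sign_insert algebra_simps)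
    hence "koszul_sign b S * (koszul_sign a (insert b S')::'r) * (c b * f (insert b S'))
      = - (koszul_sign a S' * koszul_sign b S') * (c b * f (insert b S'))" by simp
    thus "koszul_sign b S * c b * koszul_wedge a f (insert b S) = - (koszul_sign a S' * koszul_sign b S' * c b * f (insert b S'))"
      using True by (simp add: koszul_wedge_def e mult_ac)
  qed
  also have "\<dots> = - koszul_sign a S' * (\<Sum>b\<in>-S. koszul_sign b S' * c b * f (insert b S'))"
    by (simp add: sum_negf sum_distrib_left algebra_simps)
  also have "(\<Sum>b\<in>-S. koszul_sign b S' * c b * f (insert b S')) = koszul_d c f S' - koszul_sign a S' * c a * f S"
  proof -
    have "-S' = insert a (-S)" "a \<notin> -S" using S by auto
    thus ?thesis unfolding koszul_d_def by (simp add: S(1))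
  qed
  finally have "koszul_d c (koszul_wedge a f) S = - koszul_sign a S' * (koszul_d c f S' - koszul_sign a S' * c a * f S)" .
  moreover have "koszul_wedge a (koszul_d c f) S = koszul_sign a S' * koszul_d c f S'" using True by (simp add: koszul_wedge_def S'_def)
  ultimately show ?thesis by (simp add: algebra_simps)
qed

lemma koszul_d_0 [simp]: "koszul_d c (\<lambda>S. 0) T = 0"
  by (simp add: koszul_d_def)

lemma koszul_d_add: "koszul_d c (\<lambda>S. f S + g S) T = koszul_d c f T + koszul_d c g T"
  by (simp add: koszul_d_def algebra_simps sum.distrib)

lemma koszul_d_diff: "koszul_d c (\<lambda>S. f S - g S) T = koszul_d c f T - koszul_d c g T"
  by (simp add: koszul_d_def algebra_simps sum_subtractf)

lemma koszul_d_mult: "koszul_d c (\<lambda>S. r * f S) T = r * koszul_d c f T"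
  by (simp add: koszul_d_def algebra_simps sum_distrib_left)

lemma koszul_d_sum: "koszul_d c (\<lambda>S. \<Sum>x\<in>A. f x S) T = (\<Sum>x\<in>A. koszul_d c (f x) T)"
  by (induction A rule: infinite_finite_induct) (auto simp: koszul_d_add)

lemma koszul_d_empty: "koszul_d c f {} = (\<Sum>a\<in>UNIV. c a * f {a})"
  by (simp add: koszul_d_def koszul_sign_def)

lemma koszul_d_exact_unit:
  fixes c :: "'i::finite \<Rightarrow> 'k::field"
  assumes "c a \<noteq> 0" "\<And>S. koszul_d c f S = 0"
  shows "koszul_d c (\<lambda>S. koszul_wedge a f S / c a) S = f S"
proof -
  have "koszul_d c (\<lambda>S. inverse (c a) * koszul_wedge a f S) S = f S"
    unfolding koszul_d_mult koszul_d_koszul_wedge using assms by (simp add: koszul_wedge_def)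
  thus ?thesis by (simp add: field_simps)
qed

subsection \<open>Acyclicity of the Koszul complex of the polynomial ring\<close>

text \<open>The multidegree of the exterior basis element indexed by S, which \<open>slice\<close>
  subtracts from the total multidegree.\<close>

definition indicator_exp :: "'i::finite set \<Rightarrow> ('i \<Rightarrow>\<^sub>0 nat)" where
  "indicator_exp S = (\<Sum>a\<in>S. unitm a)"

lemma lookup_indicator_exp: "lk (indicator_exp S) a = (if a \<in> S then 1 else 0)"
  by (simp add: indicator_exp_def lookup_sum lookup_single when_def)

text \<open>The component of multidegree \<open>\<mu>\<close>. On it the multiplications by the variables become
  multiplications by 0 or 1, so the complex is contractible unless \<open>\<mu> = 0\<close>.\<close>

definition slice :: "('i::finite set \<Rightarrow> ('i, 'k::field) mpoly) \<Rightarrow> ('i \<Rightarrow>\<^sub>0 nat) \<Rightarrow> 'i set \<Rightarrow> 'k" where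
  "slice f \<mu> S = (if \<forall>a\<in>S. lk \<mu> a > 0 then lk (f S) (\<mu> - indicator_exp S) else 0)"

lemma slice_add_indicator_exp: "slice f (m + indicator_exp S) S = lk (f S) m"
  by (auto simp: slice_def lookup_add lookup_indicator_exp)

text \<open>Removing a from the exterior index while multiplying by \<open>var a\<close> keeps the
  total multidegree, so the differential acts on each slice separately.\<close>

lemma slice_koszul_d:
  fixes f :: "'i::finite set \<Rightarrow> ('i, 'k::field) mpoly"
  shows "slice (koszul_d var f) \<mu> S = koszul_d (\<lambda>a. if lk \<mu> a > 0 then 1 else 0) (slice f \<mu>) S"
proof (cases "\<forall>a\<in>S. lk \<mu> a > 0")
  case True
  have sgc: "lk (koszul_sign a S * p) m = koszul_sign a S * lk p m" for a m and p :: "('i, 'k) mpoly"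
  proof -
    have "(koszul_sign a S :: ('i, 'k) mpoly) = const_poly (koszul_sign a S)"
      unfolding koszul_sign_def const_poly_power const_poly_minus const_poly_1 ..
    thus ?thesis by simp
  qed
  have "slice (koszul_d var f) \<mu> S = (\<Sum>a\<in>-S. koszul_sign a S * lk (var a * f (insert a S)) (\<mu> - indicator_exp S))"
    using True by (simp add: slice_def koszul_d_def lookup_sum mult.assoc sgc)
  also have "\<dots> = (\<Sum>a\<in>-S. koszul_sign a S * (if lk \<mu> a > 0 then 1 else 0) * slice f \<mu> (insert a S))"
  proof (intro sum.cong refl)
    fix a assume a: "a \<in> -S"
    have "\<mu> - indicator_exp S - unitm a = \<mu> - indicator_exp (insert a S)"
      using a by (intro poly_mapping_eqI) (auto simp: lookup_minus lookup_indicator_exp lookup_single when_def)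
    thus "koszul_sign a S * lk (var a * f (insert a S)) (\<mu> - indicator_exp S)
       = koszul_sign a S * (if lk \<mu> a > 0 then 1 else 0) * slice f \<mu> (insert a S)"
      using a True by (auto simp: lookup_var_mult lookup_minus lookup_indicator_exp slice_def)
  qed
  finally show ?thesis by (simp add: koszul_d_def)
next
  case False
  hence "slice f \<mu> (insert a S) = 0" for a by (auto simp: slice_def)
  thus ?thesis using False by (auto simp: slice_def[of "koszul_d var f"] koszul_d_def[of _ "slice f \<mu>"])
qed

text \<open>The Koszul complex resolves k: its only homology is the constants in exterior degree 0,
  excluded by \<open>unit\<close>. The contraction uses a different variable in each multidegree,
  and the slices must be put together again into polynomials.\<close>

lemma koszul_exact:
  fixes f :: "'i::finite set \<Rightarrow> ('i, 'k::field) mpoly"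
  assumes hom: "\<And>S. homogeneous (e - int (card S)) (f S)"
    and supp: "\<And>S. card S \<noteq> p \<Longrightarrow> f S = 0"
    and cyc: "\<And>S. koszul_d var f S = 0" and unit: "lk (f {}) 0 = 0"
  obtains w where "\<And>S. homogeneous (e - int (card S)) (w S)"
    "\<And>S. card S \<noteq> Suc p \<Longrightarrow> w S = 0" "\<And>S. koszul_d var w S = f S"
proof -
  \<comment> \<open>Any variable occurring in the multidegree will do; at multidegree 0 the choice
    is arbitrary, which is harmless because that slice of f vanishes.\<close>
  define pick :: "('i \<Rightarrow>\<^sub>0 nat) \<Rightarrow> 'i" where "pick \<mu> = (SOME a. lk \<mu> a > 0)" for \<mu>
  define h where "h S m = koszul_wedge (pick (m + indicator_exp S)) (slice f (m + indicator_exp S)) S" for S m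
  define w where "w S = Abs_poly_mapping (h S)" for S
  have hE: "\<exists>a\<in>S. m + unitm a \<in> Poly_Mapping.keys (f (S - {a}))" if h: "h S m \<noteq> 0" for S m
  proof -
    let ?a = "pick (m + indicator_exp S)"
    have a: "?a \<in> S" "slice f (m + indicator_exp S) (S - {?a}) \<noteq> 0"
      using h by (auto simp: h_def koszul_wedge_def split: if_splits)
    have "m + indicator_exp S - indicator_exp (S - {?a}) = m + unitm ?a"
      using a(1) by (intro poly_mapping_eqI) (auto simp: lookup_minus lookup_add lookup_indicator_exp lookup_single when_def)
    with a show ?thesis
      by (intro bexI[of _ ?a]) (auto simp: slice_def in_keys_iff split: if_splits)
  qed
  \<comment> \<open>Needed for \<open>Abs_poly_mapping\<close>: each monomial of \<open>w S\<close>
    arises from a monomial of f by dividing by one variable.\<close>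
  have "finite {m. h S m \<noteq> 0}" for S
  proof (rule finite_subset)
    show "{m. h S m \<noteq> 0} \<subseteq> (\<Union>a\<in>S. (\<lambda>m. m - unitm a) ` Poly_Mapping.keys (f (S - {a})))"
    proof
      fix m assume "m \<in> {m. h S m \<noteq> 0}"
      then obtain a where "a \<in> S" "m + unitm a \<in> Poly_Mapping.keys (f (S - {a}))" using hE by blast
      moreover have "m = m + unitm a - unitm a" by simp
      ultimately show "m \<in> (\<Union>a\<in>S. (\<lambda>m. m - unitm a) ` Poly_Mapping.keys (f (S - {a})))" by blast
    qed
  qed auto
  hence lw: "lk (w S) m = h S m" for S m by (simp add: w_def)
  have sl0: "slice f 0 S = 0" for S
  proof (cases "S = {}")
    case True thus ?thesis using unit by (simp add: slice_def indicator_exp_def)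
  qed (auto simp: slice_def)
  have slw: "slice w \<mu> S = koszul_wedge (pick \<mu>) (slice f \<mu>) S" for \<mu> S
  proof (cases "\<forall>a\<in>S. lk \<mu> a > 0")
    case True
    have m: "\<mu> - indicator_exp S + indicator_exp S = \<mu>"
      using True by (intro poly_mapping_eqI) (auto simp: lookup_minus lookup_add lookup_indicator_exp)
    have "slice w \<mu> S = lk (w S) (\<mu> - indicator_exp S)" using True by (simp add: slice_def[of w])
    also have "\<dots> = koszul_wedge (pick \<mu>) (slice f \<mu>) S" unfolding lw h_def m ..
    finally show ?thesis .
  next
    case False
    then obtain b where b: "b \<in> S" "lk \<mu> b = 0" by auto
    show ?thesis
    proof (cases "\<mu> = 0")
      case True thus ?thesis using False by (simp add: slice_def[of w] koszul_wedge_def sl0)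
    next
      case False
      then obtain a where "lk \<mu> a > 0" by (metis lookup_zero neq0_conv poly_mapping_eqI)
      hence "lk \<mu> (pick \<mu>) > 0" unfolding pick_def by (rule someI)
      hence "pick \<mu> \<noteq> b" using b by auto
      hence "b \<in> S - {pick \<mu>}" using b by simp
      hence "slice f \<mu> (S - {pick \<mu>}) = 0" using b(2) by (metis (no_types, lifting) slice_def less_irrefl)
      thus ?thesis using b by (auto simp: slice_def[of w] koszul_wedge_def)
    qed
  qed
  show thesis
  proof
    fix S
    show "homogeneous (e - int (card S)) (w S)"
      unfolding homogeneous_iff
    proof (intro allI impI)
      fix m assume "lk (w S) m \<noteq> 0"
      then obtain a where a: "a \<in> S" "m + unitm a \<in> Poly_Mapping.keys (f (S - {a}))"
        using hE lw by metis
      have "card S > 0" using a by (auto simp: card_gt_0_iff)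
      moreover have "int (mdeg (m + unitm a)) = e - int (card (S - {a}))"
        using hom[of "S - {a}"] a by (auto simp: homogeneous_def)
      ultimately show "int (mdeg m) = e - int (card S)" using a by (simp add: mdeg_add)
    qed
    show "w S = 0" if "card S \<noteq> Suc p"
    proof (rule poly_mapping_eqI)
      fix m
      have "h S m = 0"
      proof (rule ccontr)
        assume "h S m \<noteq> 0"
        then obtain a where a: "a \<in> S" "m + unitm a \<in> Poly_Mapping.keys (f (S - {a}))" using hE by blast
        have "card S > 0" using a by (auto simp: card_gt_0_iff)
        moreover have "card (S - {a}) = p" using a(2) supp[of "S - {a}"] by fastforce
        ultimately show False using that a by simp
      qed
      thus "lk (w S) m = lk 0 m" by (simp add: lw)
    qed
    show "koszul_d var w S = f S"
    proof (rule poly_mapping_eqI)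
      fix m
      let ?\<mu> = "m + indicator_exp S"
      let ?c = "\<lambda>a. if lk ?\<mu> a > 0 then 1 else 0 :: 'k"
      have c0: "koszul_d ?c (slice f ?\<mu>) T = 0" for T
        using cyc by (simp flip: slice_koszul_d) (simp add: slice_def)
      have "lk (koszul_d var w S) m = koszul_d ?c (koszul_wedge (pick ?\<mu>) (slice f ?\<mu>)) S"
        unfolding slice_add_indicator_exp[symmetric, of "koszul_d var w"] slice_koszul_d
        by (rule arg_cong[where f = "\<lambda>g. koszul_d ?c g S"]) (rule ext, rule slw)
      also have "\<dots> = ?c (pick ?\<mu>) * slice f ?\<mu> S"
        using c0 by (simp add: koszul_d_koszul_wedge koszul_wedge_def)
      also have "\<dots> = slice f ?\<mu> S"
      proof (cases "?\<mu> = 0")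
        case True thus ?thesis by (metis sl0 mult_zero_right)
      next
        case False
        then obtain a where "lk ?\<mu> a > 0" by (metis lookup_zero neq0_conv poly_mapping_eqI)
        hence "lk ?\<mu> (pick ?\<mu>) > 0" unfolding pick_def by (rule someI)
        thus ?thesis by simp
      qed
      also have "\<dots> = lk (f S) m" by (rule slice_add_indicator_exp)
      finally show "lk (koszul_d var w S) m = lk (f S) m" .
    qed
  qed
qed

subsection \<open>Graded free modules and their syzygies\<close>

text \<open>The elements of \<open>\<Oplus>\<^sub>p R(-a\<^sub>p)\<close> are functions on \<open>nat\<close> vanishing from \<open>length a\<close> on, and graded
  submodules are families of sets indexed by the degree.\<close>

definition free_piece :: "int list \<Rightarrow> int \<Rightarrow> (nat \<Rightarrow> ('i::finite, 'k::field) mpoly) set" where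
  "free_piece a d = {u. (\<forall>p<length a. homogeneous (d - a ! p) (u p)) \<and> (\<forall>p\<ge>length a. u p = 0)}"

definition mat_app :: "(nat \<Rightarrow> nat \<Rightarrow> 'r) \<Rightarrow> nat \<Rightarrow> nat \<Rightarrow> (nat \<Rightarrow> 'r) \<Rightarrow> nat \<Rightarrow> 'r::comm_ring_1" where
  "mat_app A m k u = (\<lambda>p. if p < m then \<Sum>q<k. A p q * u q else 0)"

definition graded_mat :: "int list \<Rightarrow> int list \<Rightarrow> (nat \<Rightarrow> nat \<Rightarrow> ('i::finite, 'k::field) mpoly) \<Rightarrow> bool" where
  "graded_mat a a' A \<longleftrightarrow> (\<forall>p<length a. \<forall>q<length a'. homogeneous (a' ! q - a ! p) (A p q))"

text \<open>The free module with degrees \<open>a'\<close> covers the submodule \<open>K\<close> of the one with degrees \<open>a\<close>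
  minimally, with syzygy module \<open>K'\<close>.\<close>

definition min_cover :: "int list \<Rightarrow> int list \<Rightarrow> (nat \<Rightarrow> nat \<Rightarrow> ('i::finite, 'k::field) mpoly) \<Rightarrow>
    (int \<Rightarrow> (nat \<Rightarrow> ('i, 'k) mpoly) set) \<Rightarrow> (int \<Rightarrow> (nat \<Rightarrow> ('i, 'k) mpoly) set) \<Rightarrow> bool" where
  "min_cover a a' A K K' \<longleftrightarrow> graded_mat a a' A \<and>
     (\<forall>d. K d = mat_app A (length a) (length a') ` free_piece a' d) \<and>
     (\<forall>d. K' d = {u \<in> free_piece a' d. mat_app A (length a) (length a') u = 0}) \<and>
     (\<forall>d. \<forall>u\<in>K' d. \<forall>q. lk (u q) 0 = 0)"

text \<open>The vanishing of the \<open>p\<close>-th Koszul homology of the graded module \<open>K\<close> in internal degree \<open>j\<close>.\<close>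

definition koszul_vanishes :: "(int \<Rightarrow> (nat \<Rightarrow> ('i::finite, 'k::field) mpoly) set) \<Rightarrow> nat \<Rightarrow> int \<Rightarrow> bool" where
  "koszul_vanishes K p j \<longleftrightarrow> (\<forall>z. (\<forall>S. card S = p \<longrightarrow> z S \<in> K (j - int p)) \<and> (\<forall>S. card S \<noteq> p \<longrightarrow> z S = 0) \<and>
      (\<forall>q S. koszul_d var (\<lambda>S. z S q) S = 0) \<longrightarrow>
      (\<exists>w. (\<forall>S. card S = Suc p \<longrightarrow> w S \<in> K (j - int (Suc p))) \<and> (\<forall>S. card S \<noteq> Suc p \<longrightarrow> w S = 0) \<and>
        (\<forall>q S. koszul_d var (\<lambda>S. w S q) S = z S q)))"

lemma free_piece_0 [simp]: "0 \<in> free_piece a d"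
  by (simp add: free_piece_def)

lemma free_piece_add: "u \<in> free_piece a d \<Longrightarrow> v \<in> free_piece a d \<Longrightarrow> u + v \<in> free_piece a d"
  by (simp add: free_piece_def homogeneous_add)

lemma free_piece_diff: "u \<in> free_piece a d \<Longrightarrow> v \<in> free_piece a d \<Longrightarrow> u - v \<in> free_piece a d"
  by (simp add: free_piece_def homogeneous_diff)

lemma free_piece_mult: "homogeneous e r \<Longrightarrow> u \<in> free_piece a d \<Longrightarrow> (\<lambda>q. r * u q) \<in> free_piece a (e + d)"
  by (auto simp: free_piece_def add_diff_eq[symmetric] intro: homogeneous_mult)

lemma free_piece_sum: "(\<And>x. x \<in> X \<Longrightarrow> f x \<in> free_piece a d) \<Longrightarrow> sum f X \<in> free_piece a d"
  by (induction X rule: infinite_finite_induct) (auto intro: free_piece_add)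

lemma sum_fun_apply: "sum f X q = (\<Sum>x\<in>X. f x q)"
  by (induction X rule: infinite_finite_induct) auto

lemma free_piece_homogeneous: "u \<in> free_piece a d \<Longrightarrow> q < length a \<Longrightarrow> homogeneous (d - a ! q) (u q)"
  by (simp add: free_piece_def)

lemma free_piece_outside: "u \<in> free_piece a d \<Longrightarrow> \<not> q < length a \<Longrightarrow> u q = 0"
  by (simp add: free_piece_def)

lemma mat_app_0 [simp]: "mat_app A m k 0 = 0"
  by (auto simp: mat_app_def)

lemma mat_app_add: "mat_app A m k (u + v) = mat_app A m k u + mat_app A m k v"
  by (auto simp: mat_app_def algebra_simps sum.distrib)

lemma mat_app_diff: "mat_app A m k (u - v) = mat_app A m k u - mat_app A m k v"
  by (auto simp: mat_app_def algebra_simps sum_subtractf)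

lemma mat_app_mult: "mat_app A m k (\<lambda>q. r * u q) = (\<lambda>q. r * mat_app A m k u q)"
  by (auto simp: mat_app_def algebra_simps sum_distrib_left)

lemma mat_app_sum: "mat_app A m k (sum f X) = (\<Sum>x\<in>X. mat_app A m k (f x))"
  by (induction X rule: infinite_finite_induct)
    (simp_all only: sum.infinite sum.empty sum.insert mat_app_0 mat_app_add not_False_eq_True)

lemma mat_app_free_piece:
  assumes "graded_mat a a' A" "u \<in> free_piece a' d"
  shows "mat_app A (length a) (length a') u \<in> free_piece a d"
proof -
  have "homogeneous (d - a ! p) (A p q * u q)" if "p < length a" "q < length a'" for p q
    using homogeneous_mult[of "a' ! q - a ! p" "A p q" "d - a' ! q" "u q"] assms that
    by (simp add: graded_mat_def free_piece_def)
  thus ?thesis by (auto simp: mat_app_def free_piece_def intro!: homogeneous_sum)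
qed

section \<open>Homogeneous components in graded free modules\<close>

definition vec_part :: "int list \<Rightarrow> int \<Rightarrow> (nat \<Rightarrow> ('i::finite, 'k::field) mpoly) \<Rightarrow> nat \<Rightarrow> ('i, 'k) mpoly" where
  "vec_part a d u = (\<lambda>q. if q < length a then hom_part (d - a ! q) (u q) else 0)"

lemma vec_part_free_piece: "vec_part a d u \<in> free_piece a d"
  by (simp add: vec_part_def free_piece_def)

lemma vec_part_free_piece_eq:
  assumes "u \<in> free_piece a e"
  shows "vec_part a d u = (if d = e then u else 0)"
proof
  fix q
  show "vec_part a d u q = (if d = e then u else 0) q"
    using hom_part_homogeneous[OF free_piece_homogeneous[OF assms], of q "d - a ! q"] free_piece_outside[OF assms, of q]
    by (auto simp: vec_part_def)
qed

lemma mat_app_vec_part: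
  assumes "graded_mat a a' A"
  shows "mat_app A (length a) (length a') (vec_part a' d u) = vec_part a d (mat_app A (length a) (length a') u)"
proof
  fix p
  have "A p q * hom_part (d - a' ! q) (u q) = hom_part (d - a ! p) (A p q * u q)"
    if "p < length a" "q < length a'" for q
    using assms that hom_part_mult[of "a' ! q - a ! p" "A p q" "d - a ! p" "u q"] by (simp add: graded_mat_def)
  thus "mat_app A (length a) (length a') (vec_part a' d u) p = vec_part a d (mat_app A (length a) (length a') u) p"
    by (auto simp: mat_app_def vec_part_def hom_part_sum)
qed

lemma sum_vec_part:
  assumes "\<And>q. length a \<le> q \<Longrightarrow> u q = 0"
  obtains E where "finite E" "u = (\<Sum>d\<in>E. vec_part a d u)"
proof -
  define E where "E = (\<Union>q<length a. (\<lambda>m. int (mdeg m) + a ! q) ` Poly_Mapping.keys (u q))"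
  have fin: "finite E" by (simp add: E_def)
  have "u q = (\<Sum>d\<in>E. vec_part a d u) q" for q
  proof (cases "q < length a")
    case True
    have "(\<Sum>d\<in>E. vec_part a d u) q = (\<Sum>d\<in>E. hom_part (d - a ! q) (u q))"
      using True by (simp add: sum_fun_apply vec_part_def)
    also have "\<dots> = (\<Sum>e\<in>(\<lambda>d. d - a ! q) ` E. hom_part e (u q))"
      by (subst sum.reindex) (auto simp: inj_on_def)
    also have "\<dots> = u q"
    proof (rule sum_hom_part)
      fix m assume "m \<in> Poly_Mapping.keys (u q)"
      hence "int (mdeg m) + a ! q \<in> E" using True by (auto simp: E_def)
      thus "int (mdeg m) \<in> (\<lambda>d. d - a ! q) ` E" by force
    qed (simp add: fin)
    finally show ?thesis ..
  qed (use assms in \<open>simp add: sum_fun_apply vec_part_def\<close>)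
  thus thesis using that[OF fin] by blast
qed

lemma koszul_sign_const: "(koszul_sign a S :: ('i::finite, 'k::field) mpoly) = const_poly (koszul_sign a S)"
  unfolding koszul_sign_def const_poly_power const_poly_minus const_poly_1 ..

lemma homogeneous_koszul_d:
  assumes "\<And>a. a \<notin> S \<Longrightarrow> homogeneous (d - 1) (f (insert a S))"
  shows "homogeneous d (koszul_d var f S)"
  unfolding koszul_d_def koszul_sign_const mult.assoc
proof (intro homogeneous_sum homogeneous_const_mult)
  fix a assume "a \<in> -S"
  thus "homogeneous d (var a * f (insert a S))"
    using homogeneous_mult[OF homogeneous_var assms[of a]] by auto
qed

lemma koszul_d_supp:
  assumes "\<And>S. card S \<noteq> Suc p \<Longrightarrow> f S = 0" "card S \<noteq> p"
  shows "koszul_d c f S = 0"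
  unfolding koszul_d_def
proof (intro sum.neutral ballI)
  fix a assume "a \<in> -S"
  hence "f (insert a S) = 0" using assms by auto
  thus "koszul_sign a S * c a * f (insert a S) = 0" by simp
qed

lemma free_piece_koszul_d:
  assumes "\<And>S. card S = Suc p \<Longrightarrow> u S \<in> free_piece a (d - 1)" "card S = p"
  shows "(\<lambda>q. koszul_d var (\<lambda>S. u S q) S) \<in> free_piece a d"
  unfolding free_piece_def
proof (intro CollectI conjI allI impI)
  fix q assume "q < length a"
  have "homogeneous (d - a ! q - 1) (u (insert b S) q)" if "b \<notin> S" for b
    using free_piece_homogeneous[OF assms(1) \<open>q < length a\<close>, of "insert b S"] that assms(2)
    by (simp add: algebra_simps)
  thus "homogeneous (d - a ! q) (koszul_d var (\<lambda>S. u S q) S)" by (rule homogeneous_koszul_d)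
next
  fix q assume q: "length a \<le> q"
  have "u (insert b S) q = 0" if "b \<notin> S" for b
    using free_piece_outside[OF assms(1), of "insert b S" q] that assms(2) q by auto
  thus "koszul_d var (\<lambda>S. u S q) S = 0" by (auto simp: koszul_d_def)
qed

lemma koszul_d_mat_app: "koszul_d c (\<lambda>S. mat_app A m k (w S) q) S = mat_app A m k (\<lambda>q'. koszul_d c (\<lambda>S. w S q') S) q"
  by (auto simp: mat_app_def koszul_d_sum koszul_d_mult)

lemma koszul_exact_free:
  fixes z :: "'i::finite set \<Rightarrow> nat \<Rightarrow> ('i, 'k::field) mpoly"
  assumes z: "\<And>S. card S = p \<Longrightarrow> z S \<in> free_piece a (j - int p)" "\<And>S. card S \<noteq> p \<Longrightarrow> z S = 0"
    and cyc: "\<And>q S. koszul_d var (\<lambda>S. z S q) S = 0" and unit: "\<And>q. lk (z {} q) 0 = 0"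
  obtains w where "\<And>S. card S = Suc p \<Longrightarrow> w S \<in> free_piece a (j - int (Suc p))"
    "\<And>S. card S \<noteq> Suc p \<Longrightarrow> w S = 0" "\<And>q S. koszul_d var (\<lambda>S. w S q) S = z S q"
proof -
  have "\<exists>w. (\<forall>S. homogeneous (j - a ! q - int (card S)) (w S)) \<and> (\<forall>S. card S \<noteq> Suc p \<longrightarrow> w S = 0) \<and>
      (\<forall>S. koszul_d var w S = z S q)" if q: "q < length a" for q
  proof (rule koszul_exact[of "j - a ! q" "\<lambda>S. z S q" p])
    show "homogeneous (j - a ! q - int (card S)) (z S q)" for S
    proof (cases "card S = p")
      case True
      thus ?thesis using free_piece_homogeneous[OF z(1) q, of S] by (simp add: algebra_simps)
    qed (simp add: z(2))
  qed (use z(2) cyc unit in auto)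
  then obtain w where w: "\<And>q S. q < length a \<Longrightarrow> homogeneous (j - a ! q - int (card S)) (w q S)"
      "\<And>q S. q < length a \<Longrightarrow> card S \<noteq> Suc p \<Longrightarrow> w q S = 0"
      "\<And>q S. q < length a \<Longrightarrow> koszul_d var (w q) S = z S q"
    by metis
  show thesis
  proof (rule that[of "\<lambda>S q. if q < length a then w q S else 0"])
    fix S :: "'i set" assume S: "card S = Suc p"
    show "(\<lambda>q. if q < length a then w q S else 0) \<in> free_piece a (j - int (Suc p))"
      using w(1)[of _ S] S by (simp add: free_piece_def algebra_simps)
  next
    fix q and S :: "'i set"
    have "z S q = 0" if "\<not> q < length a"
      using free_piece_outside[OF z(1) that, of S] z(2)[of S] by fastforce
    thus "koszul_d var (\<lambda>S. if q < length a then w q S else 0) S = z S q"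
      using w(3)[of q S] by (cases "q < length a") auto
  qed (auto simp: w(2))
qed

text \<open>Dimension shifting along \<open>0 \<rightarrow> K' \<rightarrow> F \<rightarrow> K \<rightarrow> 0\<close>. For \<open>p = 0\<close>, where the homology of \<open>F\<close> does not
  vanish, minimality makes \<open>K'\<close> lie in the image of the Koszul differential of \<open>F\<close>.\<close>

lemma koszul_vanishes_step:
  assumes mc: "min_cover a a' A K K'" and van: "koszul_vanishes K (Suc p) j"
  shows "koszul_vanishes K' p j"
  unfolding koszul_vanishes_def
proof (intro allI impI, elim conjE)
  fix z :: "'a set \<Rightarrow> nat \<Rightarrow> ('a, 'b) mpoly"
  assume z: "\<forall>S. card S = p \<longrightarrow> z S \<in> K' (j - int p)" "\<forall>S. card S \<noteq> p \<longrightarrow> z S = 0"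
    and cyc: "\<forall>q S. koszul_d var (\<lambda>S. z S q) S = 0"
  let ?mat_app = "mat_app A (length a) (length a')"
  have hm: "graded_mat a a' A" and K: "\<And>d. K d = ?mat_app ` free_piece a' d"
    and K': "\<And>d. K' d = {u \<in> free_piece a' d. ?mat_app u = 0}"
    and mn: "\<And>d u q. u \<in> K' d \<Longrightarrow> lk (u q) 0 = 0"
    using mc by (auto simp: min_cover_def)
  have z0: "?mat_app (z S) = 0" for S
    using z K' by (cases "card S = p") (auto simp del: zero_fun_apply)
  obtain w where w: "\<And>S. card S = Suc p \<Longrightarrow> w S \<in> free_piece a' (j - int (Suc p))"
    "\<And>S. card S \<noteq> Suc p \<Longrightarrow> w S = 0" "\<And>q S. koszul_d var (\<lambda>S. w S q) S = z S q"
  proof (rule koszul_exact_free[of p z a' j])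
    show "z S \<in> free_piece a' (j - int p)" if "card S = p" for S using z(1) that K' by blast
    show "lk (z {} q) 0 = 0" for q
      using z mn[of "z {}" "j - int p" q] by (cases "p = 0") auto
  qed (use z cyc in auto)
  \<comment> \<open>The primitive w lies in the free module only. Its image y in K is a cycle since
    z maps to 0; a chain bounding y, lifted to the free module as \<open>u'\<close>, corrects w by a
    boundary into \<open>K'\<close>.\<close>
  define y where "y S = ?mat_app (w S)" for S
  have "koszul_d var (\<lambda>S. y S q) S = 0" for q S
  proof -
    have "(\<lambda>q'. koszul_d var (\<lambda>S. w S q') S) = z S" using w(3) by auto
    thus ?thesis unfolding y_def koszul_d_mat_app by (simp add: z0)
  qed
  moreover have "y S \<in> K (j - int (Suc p))" if "card S = Suc p" for S
    using w(1)[OF that] by (auto simp: y_def K)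
  moreover have "y S = 0" if "card S \<noteq> Suc p" for S
    using w(2)[OF that] by (simp add: y_def)
  ultimately obtain u where u: "\<And>S. card S = Suc (Suc p) \<Longrightarrow> u S \<in> K (j - int (Suc (Suc p)))"
    "\<And>S. card S \<noteq> Suc (Suc p) \<Longrightarrow> u S = 0" "\<And>q S. koszul_d var (\<lambda>S. u S q) S = y S q"
    using van[unfolded koszul_vanishes_def, rule_format, of y] by blast
  have "\<exists>u'. (card S = Suc (Suc p) \<longrightarrow> u' \<in> free_piece a' (j - int (Suc (Suc p)))) \<and>
      (card S \<noteq> Suc (Suc p) \<longrightarrow> u' = 0) \<and> ?mat_app u' = u S" for S
    using u(1,2)[of S] unfolding K by (cases "card S = Suc (Suc p)") auto
  then obtain u' where u': "\<And>S. card S = Suc (Suc p) \<Longrightarrow> u' S \<in> free_piece a' (j - int (Suc (Suc p)))"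
    "\<And>S. card S \<noteq> Suc (Suc p) \<Longrightarrow> u' S = 0" "\<And>S. ?mat_app (u' S) = u S"
    by metis
  let ?k = "\<lambda>S q. koszul_d var (\<lambda>S. u' S q) S"
  have k0: "?k S = 0" if "card S \<noteq> Suc p" for S
  proof
    fix q
    show "?k S q = 0 q" using koszul_d_supp[of "Suc p" "\<lambda>S. u' S q" S] that u'(2) by auto
  qed
  show "\<exists>w. (\<forall>S. card S = Suc p \<longrightarrow> w S \<in> K' (j - int (Suc p))) \<and>
      (\<forall>S. card S \<noteq> Suc p \<longrightarrow> w S = 0) \<and> (\<forall>q S. koszul_d var (\<lambda>S. w S q) S = z S q)"
  proof (intro exI[of _ "\<lambda>S. w S - ?k S"] conjI allI impI)
    fix S :: "'a set" assume S: "card S = Suc p"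
    have "?k S \<in> free_piece a' (j - int (Suc p))"
      using u'(1) S by (intro free_piece_koszul_d[of "Suc p"]) (auto simp: algebra_simps)
    moreover have "?mat_app (?k S) = y S"
    proof
      fix q
      have "?mat_app (?k S) q = koszul_d var (\<lambda>S. ?mat_app (u' S) q) S" by (rule koszul_d_mat_app[symmetric])
      thus "?mat_app (?k S) q = y S q" by (simp add: u'(3) u(3))
    qed
    ultimately show "w S - ?k S \<in> K' (j - int (Suc p))"
      using w(1)[OF S] by (simp add: K' free_piece_diff mat_app_diff y_def del: of_nat_Suc)
  next
    fix S :: "'a set" assume S: "card S \<noteq> Suc p"
    show "w S - ?k S = 0" using k0[OF S] w(2)[OF S] by simp
  next
    fix q S
    show "koszul_d var (\<lambda>S. (w S - ?k S) q) S = z S q"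
      using koszul_d_koszul_d[of var "\<lambda>S. u' S q" S] by (simp add: koszul_d_diff w(3))
  qed
qed

lemma unit_vec_free_piece: "q < length a \<Longrightarrow> (\<lambda>q'. if q' = q then 1 else 0) \<in> free_piece a (a ! q)"
  by (auto simp: free_piece_def)

text \<open>The zeroth homology is K modulo the variables times K, so its vanishing in degree j
  means that no new generator is required there.\<close>

lemma koszul_vanishes_0D:
  assumes van: "koszul_vanishes K 0 j" and u: "u \<in> K j"
  obtains w where "\<And>b. w b \<in> K (j - 1)" "\<And>q. u q = (\<Sum>b\<in>UNIV. var b * w b q)"
proof -
  define z where "z S = (if S = {} then u else 0)" for S :: "'a set"
  have "koszul_d var (\<lambda>S. z S q) S = 0" for q S
    by (auto simp: koszul_d_def z_def intro!: sum.neutral)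
  moreover have "z S \<in> K (j - int 0)" if "card S = 0" for S
    using that u by (simp add: z_def)
  moreover have "z S = 0" if "card S \<noteq> 0" for S
    using that by (auto simp: z_def)
  ultimately obtain w where w1: "\<And>S. card S = Suc 0 \<Longrightarrow> w S \<in> K (j - int (Suc 0))"
    and w2: "\<And>q S. koszul_d var (\<lambda>S. w S q) S = z S q"
    using van[unfolded koszul_vanishes_def, rule_format, of z] by blast
  show thesis
  proof (rule that[of "\<lambda>b. w {b}"])
    show "w {b} \<in> K (j - 1)" for b using w1[of "{b}"] by simp
    show "u q = (\<Sum>b\<in>UNIV. var b * w {b} q)" for q
      using w2[of q "{}"] by (simp add: koszul_d_empty z_def)
  qed
qed

text \<open>Otherwise the image of a basis vector of degree j could be written with variables times
  elements of K, and the difference would be a syzygy with constant term 1 in that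
  coordinate.\<close>

lemma cover_degree_vanish:
  assumes mc: "min_cover a a' A K K'" and van: "koszul_vanishes K 0 j"
  shows "j \<notin> set a'"
proof
  let ?mat_app = "mat_app A (length a) (length a')"
  have K: "\<And>d. K d = ?mat_app ` free_piece a' d" and K': "\<And>d. K' d = {u \<in> free_piece a' d. ?mat_app u = 0}"
    and mn: "\<And>d u q. u \<in> K' d \<Longrightarrow> lk (u q) 0 = 0"
    using mc by (auto simp: min_cover_def)
  assume "j \<in> set a'"
  then obtain q where q: "q < length a'" "a' ! q = j" by (auto simp: in_set_conv_nth)
  define e :: "nat \<Rightarrow> ('a, 'b) mpoly" where "e = (\<lambda>q'. if q' = q then 1 else 0)"
  have e: "e \<in> free_piece a' j" using unit_vec_free_piece[OF q(1)] q(2) by (simp add: e_def)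
  hence "?mat_app e \<in> K j" by (simp add: K)
  then obtain w where w: "\<And>b. w b \<in> K (j - 1)" "\<And>q. ?mat_app e q = (\<Sum>b\<in>UNIV. var b * w b q)"
    using koszul_vanishes_0D[OF van] by metis
  have "\<forall>b. \<exists>u. u \<in> free_piece a' (j - 1) \<and> ?mat_app u = w b"
  proof
    fix b
    from w(1)[of b] show "\<exists>u. u \<in> free_piece a' (j - 1) \<and> ?mat_app u = w b"
      unfolding K by (auto simp only: image_iff)
  qed
  from choice[OF this] obtain u where u: "\<And>b. u b \<in> free_piece a' (j - 1)" "\<And>b. ?mat_app (u b) = w b"
    by blast
  define x where "x = e - (\<Sum>b\<in>UNIV. (\<lambda>q. var b * u b q))"
  have "?mat_app x = 0"
  proof
    fix p
    have "?mat_app x p = ?mat_app e p - (\<Sum>b\<in>UNIV. var b * w b p)"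
      by (simp add: x_def mat_app_diff mat_app_sum mat_app_mult u(2) sum_fun_apply)
    also have "\<dots> = 0" by (simp add: w(2))
    finally show "?mat_app x p = 0 p" by simp
  qed
  moreover have "x \<in> free_piece a' j"
    unfolding x_def
  proof (intro free_piece_diff e free_piece_sum)
    fix b show "(\<lambda>q. var b * u b q) \<in> free_piece a' j"
      using free_piece_mult[OF homogeneous_var u(1)[of b], of b] by simp
  qed
  ultimately have "lk (x q) 0 = 0" using mn[of x j q] by (simp add: K')
  moreover have "lk (x q) 0 = 1"
    by (simp add: x_def e_def lookup_minus sum_fun_apply lookup_sum lookup_var_mult)
  ultimately show False by simp
qed

text \<open>A basis vector mapping to 0 would itself be a syzygy with a unit coordinate.\<close>

lemma cover_degree_zero:
  assumes mc: "min_cover a a' A K K'" and "K d \<subseteq> {0}"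
  shows "d \<notin> set a'"
proof
  let ?mat_app = "mat_app A (length a) (length a')"
  have K: "\<And>d. K d = ?mat_app ` free_piece a' d" and K': "\<And>d. K' d = {u \<in> free_piece a' d. ?mat_app u = 0}"
    and mn: "\<And>d u q. u \<in> K' d \<Longrightarrow> lk (u q) 0 = 0"
    using mc by (auto simp: min_cover_def)
  assume "d \<in> set a'"
  then obtain q where q: "q < length a'" "a' ! q = d" by (auto simp: in_set_conv_nth)
  define e :: "nat \<Rightarrow> ('a, 'b) mpoly" where "e = (\<lambda>q'. if q' = q then 1 else 0)"
  have e: "e \<in> free_piece a' d" using unit_vec_free_piece[OF q(1)] q(2) by (simp add: e_def)
  hence "e \<in> K' d" using assms(2) by (auto simp: K K')
  from mn[OF this, of q] show False by (simp add: e_def)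
qed

text \<open>Below the least generator degree this is a matter of degrees; in that degree itself the
  coordinates are constants, and minimality kills them. This extra degree raises the lower bound by
  one at each step of the resolution.\<close>

lemma cover_syz_zero:
  assumes mc: "min_cover a a' A K K'" and L: "\<And>b. b \<in> set a' \<Longrightarrow> d \<le> b"
  shows "K' d \<subseteq> {0}"
proof
  fix u assume u: "u \<in> K' d"
  have uf: "u \<in> free_piece a' d" and mn: "\<And>q. lk (u q) 0 = 0"
    using mc u by (auto simp: min_cover_def)
  have "u q = 0" for q
  proof (cases "q < length a'")
    case True
    have h: "homogeneous (d - a' ! q) (u q)" by (rule free_piece_homogeneous[OF uf True])
    have "d \<le> a' ! q" using L True by auto
    then consider "d - a' ! q < 0" | "d - a' ! q = 0" by linarith
    thus ?thesis
    proof cases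
      case 1 thus ?thesis using h homogeneous_neg by blast
    next
      case 2 thus ?thesis using h homogeneous_deg_0[of "u q"] mn[of q] by simp
    qed
  qed (use free_piece_outside[OF uf] in auto)
  thus "u \<in> {0}" by auto
qed

text \<open>The graded pieces in degree at least \<open>r\<close> coincide with those of the direct sum, over the
  points, of the rings of Laurent polynomials in one variable, on which some variable acts
  invertibly.\<close>

lemma koszul_vanishes_points:
  fixes P :: "'s \<Rightarrow> 'i::finite \<Rightarrow> 'k::field" and r :: int
  assumes P: "\<And>s. s \<in> X \<Longrightarrow> P s \<noteq> (\<lambda>_. 0)" and r: "0 \<le> r"
    and surj: "\<And>d u. r \<le> d \<Longrightarrow> \<exists>f. homogeneous d f \<and> (\<forall>s\<in>X. poly_eval f (P s) = u s)"
    and K: "\<And>d. K d = {u \<in> free_piece [0] d. \<forall>s\<in>X. poly_eval (u 0) (P s) = 0}"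
    and j: "r + 2 + int p \<le> j"
  shows "koszul_vanishes K p j"
  unfolding koszul_vanishes_def
proof (intro allI impI, elim conjE)
  fix z :: "'i set \<Rightarrow> nat \<Rightarrow> ('i, 'k) mpoly"
  assume z: "\<forall>S. card S = p \<longrightarrow> z S \<in> K (j - int p)" "\<forall>S. card S \<noteq> p \<longrightarrow> z S = 0"
    and cyc: "\<forall>q S. koszul_d var (\<lambda>S. z S q) S = 0"
  have ev_koszul_d: "poly_eval (koszul_d var f S) y = koszul_d y (\<lambda>S. poly_eval (f S) y) S"
    for f S and y :: "'i \<Rightarrow> 'k"
    by (simp add: koszul_d_def poly_eval_simps koszul_sign_const)
  obtain w where w: "\<And>S. card S = Suc p \<Longrightarrow> w S \<in> free_piece [0] (j - int (Suc p))"
    "\<And>S. card S \<noteq> Suc p \<Longrightarrow> w S = 0" "\<And>q S. koszul_d var (\<lambda>S. w S q) S = z S q"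
  proof (rule koszul_exact_free[of p z "[0]" j])
    show "z S \<in> free_piece [0] (j - int p)" if "card S = p" for S using z(1) that K by blast
    show "lk (z {} q) 0 = 0" for q
    proof (cases "p = 0")
      case True
      hence "z {} \<in> free_piece [0] j" using z(1)[rule_format, of "{}"] K by simp
      hence "homogeneous j (z {} 0)" "q \<noteq> 0 \<longrightarrow> z {} q = 0" by (auto simp: free_piece_def)
      thus ?thesis using homogeneous_lookup_0[of j "z {} 0"] j r by (cases "q = 0") auto
    qed (use z(2) in auto)
  qed (use z cyc in auto)
  \<comment> \<open>The primitive w need not vanish at the points. Its values there form a cycle of
    the Koszul complex of the coordinates, bounded by t because some coordinate is nonzero;
    interpolating t gives the correction u.\<close>
  define g where "g s S = poly_eval (w S 0) (P s)" for s S
  have "\<exists>t. (\<forall>S. card S \<noteq> Suc (Suc p) \<longrightarrow> t S = 0) \<and> (\<forall>S. koszul_d (P s) t S = g s S)" if s: "s \<in> X" for s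
  proof -
    obtain b where b: "P s b \<noteq> 0" using P[OF s] by auto
    have "koszul_d (P s) (g s) S = 0" for S
    proof -
      have "koszul_d (P s) (g s) S = poly_eval (koszul_d var (\<lambda>S. w S 0) S) (P s)"
        by (simp add: ev_koszul_d g_def[abs_def])
      also have "\<dots> = 0"
        using z(1)[rule_format, of S] z(2)[rule_format, of S] s K
        by (cases "card S = p") (auto simp: w(3) poly_eval_simps)
      finally show ?thesis .
    qed
    hence "koszul_d (P s) (\<lambda>S. koszul_wedge b (g s) S / P s b) S = g s S" for S
      by (rule koszul_d_exact_unit[where c = "P s", OF b])
    moreover have "koszul_wedge b (g s) S / P s b = 0" if "card S \<noteq> Suc (Suc p)" for S
    proof (cases "b \<in> S")
      case True
      hence "card (S - {b}) \<noteq> Suc p" using that by (metis card_Suc_Diff1 finite)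
      hence "g s (S - {b}) = 0" by (simp add: g_def w(2) poly_eval_simps)
      thus ?thesis by (simp add: koszul_wedge_def)
    qed (simp add: koszul_wedge_def)
    ultimately show ?thesis by (intro exI[of _ "\<lambda>S. koszul_wedge b (g s) S / P s b"]) simp
  qed
  then obtain t where t: "\<And>s S. s \<in> X \<Longrightarrow> card S \<noteq> Suc (Suc p) \<Longrightarrow> t s S = 0"
    "\<And>s S. s \<in> X \<Longrightarrow> koszul_d (P s) (t s) S = g s S"
    by metis
  \<comment> \<open>The bound on j is decided here: the coefficients of u have degree
    \<open>j - p - 2\<close>, and interpolation asks for at least r.\<close>
  have "\<exists>u. (card S = Suc (Suc p) \<longrightarrow> homogeneous (j - int (Suc (Suc p))) u) \<and>
      (card S \<noteq> Suc (Suc p) \<longrightarrow> u = 0) \<and> (\<forall>s\<in>X. poly_eval u (P s) = t s S)" for S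
  proof (cases "card S = Suc (Suc p)")
    case True
    thus ?thesis using surj[of "j - int (Suc (Suc p))" "\<lambda>s. t s S"] j by auto
  qed (auto simp: t(1) poly_eval_simps)
  then obtain u where u: "\<And>S. card S = Suc (Suc p) \<Longrightarrow> homogeneous (j - int (Suc (Suc p))) (u S)"
    "\<And>S. card S \<noteq> Suc (Suc p) \<Longrightarrow> u S = 0" "\<And>s S. s \<in> X \<Longrightarrow> poly_eval (u S) (P s) = t s S"
    by metis
  let ?v = "\<lambda>S q::nat. if q = 0 then u S else 0"
  let ?k = "\<lambda>S q. koszul_d var (\<lambda>S. ?v S q) S"
  have k0: "?k S = 0" if "card S \<noteq> Suc p" for S
  proof
    fix q
    show "?k S q = 0 q" using koszul_d_supp[of "Suc p" "\<lambda>S. ?v S q" S] that u(2) by auto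
  qed
  show "\<exists>w. (\<forall>S. card S = Suc p \<longrightarrow> w S \<in> K (j - int (Suc p))) \<and>
      (\<forall>S. card S \<noteq> Suc p \<longrightarrow> w S = 0) \<and> (\<forall>q S. koszul_d var (\<lambda>S. w S q) S = z S q)"
  proof (intro exI[of _ "\<lambda>S. w S - ?k S"] conjI allI impI)
    fix S :: "'i set" assume S: "card S = Suc p"
    have "?k S \<in> free_piece [0] (j - int (Suc p))"
    proof (rule free_piece_koszul_d[of "Suc p"])
      fix T :: "'i set" assume "card T = Suc (Suc p)"
      thus "?v T \<in> free_piece [0] (j - int (Suc p) - 1)"
        using u(1)[of T] by (simp add: free_piece_def algebra_simps)
    qed (rule S)
    moreover have "poly_eval (?k S 0) (P s) = g s S" if s: "s \<in> X" for s
      by (simp add: ev_koszul_d u(3)[OF s] t(2)[OF s])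
    ultimately show "w S - ?k S \<in> K (j - int (Suc p))"
      using w(1)[OF S] by (simp add: K free_piece_diff g_def poly_eval_simps del: of_nat_Suc)
  next
    fix S :: "'i set" assume S: "card S \<noteq> Suc p"
    show "w S - ?k S = 0" using k0[OF S] w(2)[OF S] by simp
  next
    fix q S
    show "koszul_d var (\<lambda>S. (w S - ?k S) q) S = z S q"
      using koszul_d_koszul_d[of var "\<lambda>S. ?v S q" S] by (simp add: koszul_d_diff w(3))
  qed
qed

subsection \<open>Dimensions\<close>

context vector_space
begin

lemma finite_independent_subset:
  assumes "independent B" "B \<subseteq> span W" "finite W"
  shows "finite B"
  using independent_span_bound[OF assms(3,1,2)] by simp

text \<open>The conditions on S are those of \<open>quotient_basis\<close>; S together with a basis
  of U is a basis of W.\<close>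

lemma dim_quotient:
  assumes W: "subspace W" "W \<subseteq> span F" "finite F" and U: "subspace U" "U \<subseteq> W"
    and S: "finite S" "S \<subseteq> W" "\<And>c. (\<Sum>b\<in>S. scale (c b) b) \<in> U \<Longrightarrow> \<forall>b\<in>S. c b = 0"
    and sp: "\<And>w. w \<in> W \<Longrightarrow> \<exists>c. w - (\<Sum>b\<in>S. scale (c b) b) \<in> U"
  shows "card S + dim U = dim W"
proof -
  obtain C where C: "C \<subseteq> U" "independent C" "U \<subseteq> span C" "card C = dim U"
    by (rule basis_exists)
  have finC: "finite C"
    using finite_independent_subset[OF C(2) _ W(3)] C(1) U(2) W(2) by blast
  have disj: "S \<inter> C = {}"
  proof (rule ccontr)
    assume "S \<inter> C \<noteq> {}"
    then obtain b where b: "b \<in> S" "b \<in> C" by blast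
    have "(\<Sum>x\<in>S. scale (if x = b then 1 else 0) x) = b"
      using S(1) b(1) by (simp add: if_distrib[of "\<lambda>c. scale c _"] cong: if_cong)
    hence "(\<Sum>x\<in>S. scale (if x = b then 1 else 0) x) \<in> U" using b C(1) by auto
    from S(3)[OF this] b(1) show False by auto
  qed
  have "independent (S \<union> C)"
  proof (rule independent_if_scalars_zero)
    fix f x assume "(\<Sum>x\<in>S \<union> C. scale (f x) x) = 0" and x: "x \<in> S \<union> C"
    hence s: "(\<Sum>x\<in>S. scale (f x) x) + (\<Sum>x\<in>C. scale (f x) x) = 0"
      using S(1) finC disj by (simp add: sum.union_disjoint)
    moreover have "(\<Sum>x\<in>C. scale (f x) x) \<in> U"
      using C(1) U(1) by (intro subspace_sum subspace_scale) auto
    ultimately have "(\<Sum>x\<in>S. scale (f x) x) \<in> U"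
      using subspace_neg[OF U(1)] by (metis eq_neg_iff_add_eq_0)
    hence f: "\<forall>b\<in>S. f b = 0" by (rule S(3))
    hence "(\<Sum>x\<in>C. scale (f x) x) = 0" using s by simp
    with independentD[OF C(2) finC subset_refl] f x show "f x = 0" by blast
  qed (use S finC in auto)
  moreover have "S \<union> C \<subseteq> W" using S C U by auto
  moreover have "W \<subseteq> span (S \<union> C)"
  proof
    fix w assume "w \<in> W"
    then obtain c where c: "w - (\<Sum>b\<in>S. scale (c b) b) \<in> U" using sp by blast
    have "(\<Sum>b\<in>S. scale (c b) b) \<in> span (S \<union> C)"
      by (intro span_sum span_scale span_base) auto
    moreover have "w - (\<Sum>b\<in>S. scale (c b) b) \<in> span (S \<union> C)"
      using c C(3) span_mono[of C "S \<union> C"] by auto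
    ultimately show "w \<in> span (S \<union> C)" using span_add by fastforce
  qed
  ultimately have "card (S \<union> C) = dim W" by (metis basis_card_eq_dim)
  thus ?thesis using S(1) finC disj C(4) by (simp add: card_Un_disjoint)
qed

lemma quotient_basis_exists:
  assumes W: "subspace W" "W \<subseteq> span F" "finite F" and U: "subspace U" "U \<subseteq> W"
  obtains S where "finite S" "S \<subseteq> W" "\<And>c. (\<Sum>b\<in>S. scale (c b) b) \<in> U \<Longrightarrow> \<forall>b\<in>S. c b = 0"
    "\<And>w. w \<in> W \<Longrightarrow> \<exists>c. w - (\<Sum>b\<in>S. scale (c b) b) \<in> U"
proof -
  obtain C where C: "C \<subseteq> U" "independent C" "U \<subseteq> span C" "card C = dim U"
    by (rule basis_exists)
  obtain B where B: "C \<subseteq> B" "B \<subseteq> W" "independent B" "W \<subseteq> span B"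
    using maximal_independent_subset_extend[of C W] C U by blast
  have finB: "finite B"
    using finite_independent_subset[OF B(3) _ W(3)] B(2) W(2) by blast
  hence finC: "finite C" using B(1) finite_subset by blast
  show thesis
  proof (rule that[of "B - C"])
    fix c assume "(\<Sum>b\<in>B - C. scale (c b) b) \<in> U"
    then obtain e where e: "(\<Sum>b\<in>B - C. scale (c b) b) = (\<Sum>b\<in>C. scale (e b) b)"
      using C(3) span_finite[OF finC] by auto
    have "(\<Sum>b\<in>B. scale (if b \<in> C then - e b else c b) b)
      = (\<Sum>b\<in>B - C. scale (if b \<in> C then - e b else c b) b) + (\<Sum>b\<in>C. scale (if b \<in> C then - e b else c b) b)"
      by (rule sum.subset_diff[OF B(1) finB])
    also have "\<dots> = 0" by (simp add: e sum_negf)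
    finally have "\<forall>b\<in>B. (if b \<in> C then - e b else c b) = 0"
      by (intro ballI independentD[OF B(3) finB subset_refl])
    thus "\<forall>b\<in>B - C. c b = 0" by auto
  next
    fix w assume "w \<in> W"
    then obtain c where c: "w = (\<Sum>b\<in>B. scale (c b) b)"
      using B(4) span_finite[OF finB] by auto
    have "w - (\<Sum>b\<in>B - C. scale (c b) b) = (\<Sum>b\<in>C. scale (c b) b)"
      using sum.subset_diff[OF B(1) finB, of "\<lambda>b. scale (c b) b"] by (simp add: c)
    also have "\<dots> \<in> U" using C(1) U(1) by (intro subspace_sum subspace_scale) auto
    finally show "\<exists>c. w - (\<Sum>b\<in>B - C. scale (c b) b) \<in> U" by blast
  qed (use finB B in auto)
qed

end

text \<open>A basis of S modulo the kernel maps bijectively to a basis of the image. The statement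
  is relative to S, as the space of all polynomials has infinite dimension.\<close>

lemma (in vector_space_pair) rank_nullity:
  assumes f: "Vector_Spaces.linear s1 s2 f" and S: "vs1.subspace S" "S \<subseteq> vs1.span W" "finite W"
  shows "vs1.dim S = vs2.dim (f ` S) + vs1.dim {x \<in> S. f x = 0}"
proof -
  interpret f: Vector_Spaces.linear s1 s2 f by (rule f)
  let ?N = "{x \<in> S. f x = 0}"
  have "vs1.subspace (S \<inter> {x. f x = 0})"
    using S(1) f.subspace_kernel by (rule vs1.subspace_inter)
  moreover have "S \<inter> {x. f x = 0} = ?N" by auto
  ultimately have N: "vs1.subspace ?N" by simp
  obtain B where B: "finite B" "B \<subseteq> S" "\<And>c. (\<Sum>b\<in>B. s1 (c b) b) \<in> ?N \<Longrightarrow> \<forall>b\<in>B. c b = 0"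
    "\<And>w. w \<in> S \<Longrightarrow> \<exists>c. w - (\<Sum>b\<in>B. s1 (c b) b) \<in> ?N"
    by (rule vs1.quotient_basis_exists[OF S N]) auto
  have dim: "card B + vs1.dim ?N = vs1.dim S"
    by (rule vs1.dim_quotient[OF S N]) (use B in auto)
  have comb: "(\<Sum>b\<in>B. s1 (c b) b) \<in> S" for c
    using B(2) S(1) by (intro vs1.subspace_sum vs1.subspace_scale) auto
  have fcomb: "f (\<Sum>b\<in>B. s1 (c b) b) = (\<Sum>b\<in>B. s2 (c b) (f b))" for c
    by (simp add: f.sum f.scale)
  have inj: "inj_on f B"
  proof (rule inj_onI, rule ccontr)
    fix x y assume xy: "x \<in> B" "y \<in> B" "f x = f y" "x \<noteq> y"
    let ?c = "\<lambda>b. if b = x then 1 else if b = y then - 1 else 0"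
    have "(\<Sum>b\<in>B. s2 (?c b) (f b)) = (\<Sum>b\<in>{x, y}. s2 (?c b) (f b))"
      using xy B(1) by (intro sum.mono_neutral_right) auto
    also have "\<dots> = 0" using xy by simp
    finally have "f (\<Sum>b\<in>B. s1 (?c b) b) = 0" unfolding fcomb .
    hence "(\<Sum>b\<in>B. s1 (?c b) b) \<in> ?N" using comb[of ?c] by blast
    from B(3)[OF this] xy(1) show False by auto
  qed
  have "vs2.independent (f ` B)"
  proof (rule vs2.independent_if_scalars_zero)
    fix c y assume "(\<Sum>x\<in>f ` B. s2 (c x) x) = 0" and y: "y \<in> f ` B"
    hence "f (\<Sum>b\<in>B. s1 (c (f b)) b) = 0"
      unfolding fcomb by (simp add: sum.reindex[OF inj])
    hence "(\<Sum>b\<in>B. s1 (c (f b)) b) \<in> ?N" using comb[of "\<lambda>b. c (f b)"] by blast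
    from B(3)[OF this] y show "c y = 0" by auto
  qed (use B in auto)
  moreover have "f ` S \<subseteq> vs2.span (f ` B)"
  proof
    fix y assume "y \<in> f ` S"
    then obtain w where w: "w \<in> S" "y = f w" by blast
    then obtain c where "w - (\<Sum>b\<in>B. s1 (c b) b) \<in> ?N" using B(4) by blast
    hence "y = (\<Sum>b\<in>B. s2 (c b) (f b))" using w by (simp add: f.diff fcomb)
    thus "y \<in> vs2.span (f ` B)"
      by (simp add: vs2.span_sum vs2.span_scale vs2.span_base)
  qed
  moreover have "f ` B \<subseteq> f ` S" using B by auto
  ultimately have "card (f ` B) = vs2.dim (f ` S)" by (metis vs2.basis_card_eq_dim)
  thus ?thesis using dim by (simp add: card_image[OF inj])
qed

section \<open>Dimensions of the graded pieces of free modules\<close>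

definition monomials_of_degree :: "int \<Rightarrow> ('i::finite \<Rightarrow>\<^sub>0 nat) set" where
  "monomials_of_degree e = {m. int (mdeg m) = e}"

lemma card_monomials_of_degree:
  assumes "CARD('i::finite) = n + 1"
  shows "finite (monomials_of_degree e :: ('i \<Rightarrow>\<^sub>0 nat) set)"
    and "card (monomials_of_degree e :: ('i \<Rightarrow>\<^sub>0 nat) set) = (if e < 0 then 0 else (nat e + n) choose n)"
proof -
  obtain h :: "nat \<Rightarrow> 'i" where h: "bij_betw h {0..<CARD('i)} UNIV"
    using ex_bij_betw_nat_finite[OF finite_class.finite_UNIV] by blast
  let ?L = "{l :: nat list. length l = CARD('i) \<and> sum_list l = nat e}"
  define g :: "('i \<Rightarrow>\<^sub>0 nat) \<Rightarrow> nat list" where "g m = map (\<lambda>t. lk m (h t)) [0..<CARD('i)]" for m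
  \<comment> \<open>In spite of its label, this fact concerns degrees: it turns monomials into lists
    with prescribed sum, which are counted by a binomial coefficient.\<close>
  have koszul_sign: "sum_list (g m) = mdeg m" for m
  proof -
    have "sum_list (g m) = (\<Sum>t\<in>{0..<CARD('i)}. lk m (h t))"
      unfolding g_def by (simp add: interv_sum_list_conv_sum_set_nat)
    also have "\<dots> = mdeg m" unfolding mdeg_def by (rule sum.reindex_bij_betw[OF h])
    finally show ?thesis .
  qed
  have inj: "inj_on g A" for A
  proof (rule inj_onI, rule poly_mapping_eqI)
    fix m m' i assume e: "g m = g m'"
    obtain t where t: "t < CARD('i)" "h t = i"
      using h by (metis UNIV_I atLeastLessThan_iff bij_betw_def imageE)
    from arg_cong[OF e, of "\<lambda>l. l ! t"] t show "lk m i = lk m' i" by (simp add: g_def)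
  qed
  have fin: "finite ?L"
    by (rule finite_subset[OF _ finite_lists_length_eq[of "{..nat e}" "CARD('i)"]])
      (auto dest: member_le_sum_list)
  have img: "g ` monomials_of_degree e = ?L" if "e \<ge> 0"
  proof
    show "g ` monomials_of_degree e \<subseteq> ?L" using that by (auto simp: monomials_of_degree_def koszul_sign) (simp add: g_def)
    show "?L \<subseteq> g ` monomials_of_degree e"
    proof
      fix l assume l: "l \<in> ?L"
      define m where "m = Abs_poly_mapping (\<lambda>i. l ! (inv_into {0..<CARD('i)} h i))"
      have lm: "lk m i = l ! (inv_into {0..<CARD('i)} h i)" for i
        unfolding m_def by (subst lookup_Abs_poly_mapping) auto
      have "g m = l"
      proof (rule nth_equalityI)
        show "length (g m) = length l" using l by (simp add: g_def)
        fix t assume "t < length (g m)"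
        hence "t < CARD('i)" by (simp add: g_def)
        thus "g m ! t = l ! t"
          using bij_betw_inv_into_left[OF h, of t] by (simp add: g_def lm)
      qed
      moreover have "m \<in> monomials_of_degree e" using koszul_sign[of m] calculation l that by (simp add: monomials_of_degree_def)
      ultimately show "l \<in> g ` monomials_of_degree e" by blast
    qed
  qed
  have neg: "monomials_of_degree e = {}" if "e < 0" using that by (auto simp: monomials_of_degree_def)
  show "finite (monomials_of_degree e :: ('i \<Rightarrow>\<^sub>0 nat) set)"
  proof (cases "e < 0")
    case False
    hence "finite (g ` monomials_of_degree e)" using img fin by simp
    thus ?thesis by (rule finite_imageD[OF _ inj])
  qed (simp add: neg)
  show "card (monomials_of_degree e :: ('i \<Rightarrow>\<^sub>0 nat) set) = (if e < 0 then 0 else (nat e + n) choose n)"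
  proof (cases "e < 0")
    case False
    hence "card (monomials_of_degree e :: ('i \<Rightarrow>\<^sub>0 nat) set) = card ?L"
      using img card_image[OF inj[of "monomials_of_degree e"]] by simp
    also have "\<dots> = (nat e + n) choose nat e"
      by (simp add: card_length_sum_list assms)
    also have "\<dots> = (nat e + n) choose n" by (subst binomial_symmetric) simp_all
    finally show ?thesis using False by simp
  qed (simp add: neg)
qed

lemma finite_monomials_of_degree [simp]: "finite (monomials_of_degree e)"
  by (rule card_monomials_of_degree(1)[of "CARD('a) - 1"]) (simp add: Suc_leI)

text \<open>Dimensions are counted over k, while generation and syzygies are over R, so the same
  functions carry two scalar actions, this one and \<open>poly_scale\<close>.\<close>

definition const_scale :: "'k \<Rightarrow> (nat \<Rightarrow> ('i::finite, 'k::field) mpoly) \<Rightarrow> nat \<Rightarrow> ('i, 'k) mpoly" where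
  "const_scale c u = (\<lambda>q. const_poly c * u q)"

interpretation fv: vector_space "const_scale :: 'k \<Rightarrow> _ \<Rightarrow> nat \<Rightarrow> ('i::finite, 'k::field) mpoly"
  by unfold_locales
    (auto simp: const_scale_def algebra_simps const_poly_add const_poly_mult)

interpretation pv: vector_space "\<lambda>c (p :: ('i::finite, 'k::field) mpoly). const_poly c * p"
  by unfold_locales (auto simp: algebra_simps const_poly_add const_poly_mult)

lemma subspace_free_piece: "fv.subspace (free_piece a d)"
  by (auto simp: fv.subspace_def free_piece_add) (auto simp: const_scale_def free_piece_def homogeneous_const_mult)

definition monvec :: "nat \<times> ('i::finite \<Rightarrow>\<^sub>0 nat) \<Rightarrow> nat \<Rightarrow> ('i, 'k::field) mpoly" where
  "monvec x = (\<lambda>p. if p = fst x then Poly_Mapping.single (snd x) 1 else 0)"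

definition monset :: "int list \<Rightarrow> int \<Rightarrow> (nat \<times> ('i::finite \<Rightarrow>\<^sub>0 nat)) set" where
  "monset a d = (SIGMA q:{..<length a}. monomials_of_degree (d - a ! q))"

lemma finite_monset [simp]: "finite (monset a d)"
  by (simp add: monset_def)

lemma lookup_monvec: "lk (monvec x q) m = (if x = (q, m) then 1 else 0)"
  by (auto simp: monvec_def lookup_single when_def prod_eq_iff)

lemma inj_monvec: "inj monvec"
proof (rule injI)
  fix x y :: "nat \<times> ('a \<Rightarrow>\<^sub>0 nat)" assume "monvec x = (monvec y :: nat \<Rightarrow> ('a, 'b) mpoly)"
  hence "lk (monvec x (fst x) :: ('a, 'b) mpoly) (snd x) = lk (monvec y (fst x) :: ('a, 'b) mpoly) (snd x)" by simp
  thus "x = y" unfolding lookup_monvec by (simp split: if_splits)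
qed

lemma independent_monvec:
  assumes "finite X"
  shows "fv.independent (monvec ` X :: (nat \<Rightarrow> ('i::finite, 'k::field) mpoly) set)"
proof (rule fv.independent_if_scalars_zero)
  fix f :: "(nat \<Rightarrow> ('i, 'k) mpoly) \<Rightarrow> 'k" and y :: "nat \<Rightarrow> ('i, 'k) mpoly"
  assume 0: "(\<Sum>x\<in>monvec ` X. const_scale (f x) x) = 0" and "y \<in> monvec ` X"
  then obtain x where x: "x \<in> X" "y = monvec x" by blast
  have "lk ((\<Sum>x\<in>monvec ` X. const_scale (f x) x) (fst x)) (snd x) = (\<Sum>z\<in>X. if z = x then f (monvec z) else 0)"
    unfolding sum_fun_apply lookup_sum sum.reindex[OF inj_on_subset[OF inj_monvec subset_UNIV]]
    by (intro sum.cong) (auto simp: const_scale_def lookup_monvec)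
  thus "f y = 0" using assms x unfolding 0 by simp
qed (use assms in simp)

lemma free_piece_eq_span: "free_piece a d = fv.span (monvec ` monset a d)"
proof
  show "fv.span (monvec ` monset a d) \<subseteq> free_piece a d"
  proof (rule fv.span_minimal[OF _ subspace_free_piece])
    show "monvec ` monset a d \<subseteq> free_piece a d"
      by (auto simp: monvec_def monset_def monomials_of_degree_def free_piece_def homogeneous_iff lookup_single when_def split: if_splits)
  qed
  show "free_piece a d \<subseteq> fv.span (monvec ` monset a d)"
  proof
    fix u assume u: "u \<in> free_piece a d"
    have "u = (\<Sum>q<length a. \<Sum>m\<in>Poly_Mapping.keys (u q). const_scale (lk (u q) m) (monvec (q, m)))" (is "u = ?r")
    proof (rule ext, rule poly_mapping_eqI)
      fix p m
      have "lk (?r p) m = (\<Sum>q<length a. \<Sum>m'\<in>Poly_Mapping.keys (u q). if q = p \<and> m' = m then lk (u q) m' else 0)"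
        unfolding sum_fun_apply lookup_sum
        by (intro sum.cong refl) (auto simp: const_scale_def lookup_monvec)
      also have "\<dots> = (\<Sum>q<length a. if q = p then lk (u q) m else 0)"
        by (intro sum.cong refl) (auto simp: in_keys_iff)
      also have "\<dots> = lk (u p) m" using free_piece_outside[OF u, of p] by simp
      finally show "lk (u p) m = lk (?r p) m" ..
    qed
    moreover have "?r \<in> fv.span (monvec ` monset a d)"
    proof (intro fv.span_sum fv.span_scale fv.span_base imageI)
      fix q m assume "q \<in> {..<length a}" "m \<in> Poly_Mapping.keys (u q)"
      thus "(q, m) \<in> monset a d"
        using free_piece_homogeneous[OF u, of q] by (auto simp: monset_def monomials_of_degree_def homogeneous_def)
    qed
    ultimately show "u \<in> fv.span (monvec ` monset a d)" by simp
  qed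
qed

text \<open>The dimension of the degree e part of R in n + 1 variables; the case
  \<open>e < 0\<close> is explicit because \<open>nat\<close> would send e to 0 and give 1.\<close>

definition piece_dim :: "nat \<Rightarrow> int \<Rightarrow> int" where
  "piece_dim n e = (if e < 0 then 0 else int ((nat e + n) choose n))"

lemma dim_free_piece:
  assumes "CARD('i::finite) = n + 1"
  shows "int (fv.dim (free_piece a d :: (nat \<Rightarrow> ('i, 'k::field) mpoly) set)) = (\<Sum>b\<leftarrow>a. piece_dim n (d - b))"
proof -
  have "fv.dim (free_piece a d :: (nat \<Rightarrow> ('i, 'k) mpoly) set) = card (monvec ` monset a d :: (nat \<Rightarrow> ('i, 'k) mpoly) set)"
    unfolding free_piece_eq_span by (intro fv.dim_span_eq_card_independent independent_monvec) simp
  also have "\<dots> = card (monset a d :: (nat \<times> ('i \<Rightarrow>\<^sub>0 nat)) set)"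
    by (rule card_image[OF inj_on_subset[OF inj_monvec subset_UNIV]])
  also have "\<dots> = (\<Sum>q<length a. card (monomials_of_degree (d - a ! q) :: ('i \<Rightarrow>\<^sub>0 nat) set))"
    unfolding monset_def by (subst card_SigmaI) auto
  also have "int \<dots> = (\<Sum>q<length a. piece_dim n (d - a ! q))"
    unfolding of_nat_sum by (intro sum.cong refl) (simp add: card_monomials_of_degree(2)[OF assms] piece_dim_def)
  finally have "int (fv.dim (free_piece a d :: (nat \<Rightarrow> ('i, 'k) mpoly) set)) = (\<Sum>q<length a. piece_dim n (d - a ! q))" .
  thus ?thesis by (simp add: sum_list_sum_nth atLeast0LessThan)
qed

text \<open>Identifies R with the free module on one generator of degree 0, so that ideals become
  submodules of a \<open>free_piece\<close> family.\<close>

definition embed :: "('i::finite, 'k::field) mpoly \<Rightarrow> nat \<Rightarrow> ('i, 'k) mpoly" where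
  "embed f = (\<lambda>p. if p = 0 then f else 0)"

lemma embed_graded: "embed ` {f \<in> graded_part d. P f} = {u \<in> free_piece [0] d. P (u 0)}"
proof -
  have "u = embed (u 0)" if "u \<in> free_piece [0] d" for u :: "nat \<Rightarrow> ('a, 'b) mpoly"
    using that by (auto simp: free_piece_def embed_def)
  hence "u \<in> embed ` {f \<in> graded_part d. P f}" if "u \<in> free_piece [0] d" "P (u 0)" for u :: "nat \<Rightarrow> ('a, 'b) mpoly"
    using that by (intro image_eqI[of _ _ "u 0"]) (auto simp: graded_part_def free_piece_def)
  thus ?thesis by (auto simp: graded_part_def free_piece_def embed_def)
qed

interpretation pf: vector_space_pair "\<lambda>c (p :: ('i::finite, 'k::field) mpoly). const_poly c * p"
  "const_scale :: 'k \<Rightarrow> _ \<Rightarrow> nat \<Rightarrow> ('i, 'k) mpoly" ..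

interpretation ff: vector_space_pair "const_scale :: 'k \<Rightarrow> _ \<Rightarrow> nat \<Rightarrow> ('i::finite, 'k::field) mpoly"
  "const_scale :: 'k \<Rightarrow> _ \<Rightarrow> nat \<Rightarrow> ('i, 'k) mpoly" ..

lemma subspace_graded: "pv.subspace (graded_part d)"
  by (auto simp: pv.subspace_def graded_part_def homogeneous_add homogeneous_const_mult)

lemma graded_span: "graded_part d \<subseteq> pv.span ((\<lambda>m. Poly_Mapping.single m 1) ` monomials_of_degree d)"
proof
  fix p :: "('a, 'b) mpoly" assume p: "p \<in> graded_part d"
  have "p = (\<Sum>m\<in>Poly_Mapping.keys p. const_poly (lk p m) * Poly_Mapping.single m 1)"
    by (simp add: const_poly_def mult_single poly_mapping_sum_monomials)
  also have "\<dots> \<in> pv.span ((\<lambda>m. Poly_Mapping.single m 1) ` monomials_of_degree d)"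
    using p by (intro pv.span_sum pv.span_scale pv.span_base)
      (auto simp: graded_part_def homogeneous_def monomials_of_degree_def)
  finally show "p \<in> pv.span ((\<lambda>m. Poly_Mapping.single m 1) ` monomials_of_degree d)" .
qed

lemma linear_embed: "Vector_Spaces.linear (\<lambda>c p. const_poly c * p) const_scale embed"
  by (auto simp: Vector_Spaces.linear_iff embed_def const_scale_def pv.vector_space_axioms fv.vector_space_axioms
      vector_space_pair_def)

text \<open>\<open>hilbert_fun\<close> is a definite description, so a quotient basis must exist and
  all must have equal size; both are read off from the finite-dimensional part of degree d.\<close>

lemma hilbert_fun_dim:
  fixes I :: "('i::finite, 'k::field) mpoly set"
  assumes I: "pv.subspace I"
  shows "hilbert_fun I d + fv.dim {u \<in> free_piece [0] d. u 0 \<in> I} = fv.dim (free_piece [0] d :: (nat \<Rightarrow> ('i, 'k) mpoly) set)"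
proof -
  let ?W = "graded_part d :: ('i, 'k) mpoly set" and ?U = "{f \<in> graded_part d. f \<in> I}"
  have fin: "finite ((\<lambda>m. Poly_Mapping.single m 1 :: ('i, 'k) mpoly) ` monomials_of_degree d)" by simp
  have "pv.subspace (?W \<inter> I)" by (intro pv.subspace_inter subspace_graded I)
  hence U: "pv.subspace ?U" "?U \<subseteq> ?W" by (auto simp: Int_def)
  have q: "quotient_basis I d S \<longleftrightarrow> finite S \<and> S \<subseteq> ?W \<and>
     (\<forall>c. (\<Sum>b\<in>S. const_poly (c b) * b) \<in> ?U \<longrightarrow> (\<forall>b\<in>S. c b = 0)) \<and>
     (\<forall>w\<in>?W. \<exists>c. w - (\<Sum>b\<in>S. const_poly (c b) * b) \<in> ?U)" for S
  proof -
    have "(\<Sum>b\<in>S. const_poly (c b) * b) \<in> ?W" if "S \<subseteq> ?W" for c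
      using that subspace_graded by (intro pv.subspace_sum pv.subspace_scale) auto
    hence 1: "(\<Sum>b\<in>S. const_poly (c b) * b) \<in> ?U \<longleftrightarrow> (\<Sum>b\<in>S. const_poly (c b) * b) \<in> I"
      and "w \<in> ?W \<Longrightarrow> w - (\<Sum>b\<in>S. const_poly (c b) * b) \<in> ?W" if "S \<subseteq> ?W" for c w
      using that pv.subspace_diff[OF subspace_graded] by blast+
    hence 2: "w - (\<Sum>b\<in>S. const_poly (c b) * b) \<in> ?U \<longleftrightarrow> w - (\<Sum>b\<in>S. const_poly (c b) * b) \<in> I"
      if "S \<subseteq> ?W" "w \<in> ?W" for c w
      using that by blast
    show ?thesis unfolding quotient_basis_def
      by (cases "S \<subseteq> ?W") (simp_all only: 1 2 simp_thms cong: ball_cong)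
  qed
  obtain S where S: "quotient_basis I d S"
  proof (rule pv.quotient_basis_exists[OF subspace_graded graded_span fin U])
    fix S assume S: "finite S" "S \<subseteq> ?W" and 1: "\<And>c. (\<Sum>b\<in>S. const_poly (c b) * b) \<in> ?U \<Longrightarrow> \<forall>b\<in>S. c b = 0"
      and 2: "\<And>w. w \<in> ?W \<Longrightarrow> \<exists>c. w - (\<Sum>b\<in>S. const_poly (c b) * b) \<in> ?U"
    have "quotient_basis I d S"
      unfolding q
    proof (intro conjI allI impI)
      show "\<forall>b\<in>S. c b = 0" if "(\<Sum>b\<in>S. const_poly (c b) * b) \<in> ?U" for c
        using that by (rule 1)
      show "\<forall>w\<in>?W. \<exists>c. w - (\<Sum>b\<in>S. const_poly (c b) * b) \<in> ?U"
        using 2 by (rule ballI)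
    qed (fact S)+
    thus thesis by (rule that)
  qed
  have card: "card S + pv.dim ?U = pv.dim ?W" if "quotient_basis I d S" for S
  proof -
    have t: "finite S" "S \<subseteq> ?W" "\<forall>c. (\<Sum>b\<in>S. const_poly (c b) * b) \<in> ?U \<longrightarrow> (\<forall>b\<in>S. c b = 0)"
      "\<forall>w\<in>?W. \<exists>c. w - (\<Sum>b\<in>S. const_poly (c b) * b) \<in> ?U"
      using that unfolding q by - (elim conjE, assumption)+
    show ?thesis
      by (rule pv.dim_quotient[OF subspace_graded graded_span fin U t(1,2) t(3)[THEN spec, THEN mp] t(4)[THEN bspec]])
  qed
  have "hilbert_fun I d = card S"
    unfolding hilbert_fun_def
  proof (rule the_equality)
    fix m assume "\<exists>S. quotient_basis I d S \<and> card S = m"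
    thus "m = card S" using card card[OF S] by fastforce
  qed (use S in blast)
  have embed: "fv.dim (embed ` V) = pv.dim V" if "pv.subspace V" "V \<subseteq> ?W" for V
  proof -
    have "{x \<in> V. embed x = 0} = {0}" using pv.subspace_0[OF that(1)] by (auto simp: embed_def fun_eq_iff)
    moreover have "pv.dim {0 :: ('i, 'k) mpoly} = 0"
      by (metis card.empty pv.dim_span_eq_card_independent pv.independent_empty pv.span_empty)
    ultimately show ?thesis
      using pf.rank_nullity[OF linear_embed that(1) order_trans[OF that(2) graded_span] fin] by simp
  qed
  have "embed ` ?W = free_piece [0] d" using embed_graded[where P = "\<lambda>f. True" and d = d] by simp
  thus ?thesis
    using card[OF S] \<open>hilbert_fun I d = card S\<close> embed[OF U] embed[OF subspace_graded subset_refl]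
      embed_graded[where P = "\<lambda>f. f \<in> I" and d = d] by simp
qed

subsection \<open>Existence of minimal resolutions\<close>

definition poly_scale :: "('i::finite, 'k::field) mpoly \<Rightarrow> (nat \<Rightarrow> ('i, 'k) mpoly) \<Rightarrow> nat \<Rightarrow> ('i, 'k) mpoly" where
  "poly_scale r u = (\<lambda>q. r * u q)"

interpretation fm: Modules.module "poly_scale :: ('i::finite, 'k::field) mpoly \<Rightarrow> _"
  by unfold_locales (auto simp: poly_scale_def algebra_simps)

lemma const_scale_poly_scale: "const_scale c = poly_scale (const_poly c)"
  by (auto simp: const_scale_def poly_scale_def)

definition graded_sub :: "int list \<Rightarrow> (int \<Rightarrow> (nat \<Rightarrow> ('i::finite, 'k::field) mpoly) set) \<Rightarrow> bool" where
  "graded_sub a K \<longleftrightarrow> (\<forall>d. K d \<subseteq> free_piece a d \<and> 0 \<in> K d \<and> (\<forall>u\<in>K d. \<forall>v\<in>K d. u + v \<in> K d) \<and>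
     (\<forall>e r. \<forall>u\<in>K d. homogeneous e r \<longrightarrow> poly_scale r u \<in> K (e + d)))"

lemma graded_sub_0: "graded_sub a K \<Longrightarrow> 0 \<in> K d"
  and graded_sub_add: "graded_sub a K \<Longrightarrow> u \<in> K d \<Longrightarrow> v \<in> K d \<Longrightarrow> u + v \<in> K d"
  and graded_sub_mult: "graded_sub a K \<Longrightarrow> u \<in> K d \<Longrightarrow> homogeneous e r \<Longrightarrow> poly_scale r u \<in> K (e + d)"
  unfolding graded_sub_def by blast+

lemma graded_sub_sum:
  assumes "graded_sub a K" "\<And>x. x \<in> X \<Longrightarrow> f x \<in> K d"
  shows "sum f X \<in> K d"
  using assms(2)
proof (induction X rule: infinite_finite_induct)
  case (insert x F)
  have "f x + sum f F \<in> K d" by (rule graded_sub_add[OF assms(1)]) (use insert in auto)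
  thus ?case unfolding sum.insert[OF insert(1,2)] .
next
  case empty
  show ?case unfolding sum.empty by (rule graded_sub_0[OF assms(1)])
next
  case (infinite F)
  show ?case unfolding sum.infinite[OF infinite(1)] by (rule graded_sub_0[OF assms(1)])
qed

lemma graded_sub_syz: "graded_sub a' (\<lambda>d. {u \<in> free_piece a' d. mat_app A m k u = 0})"
proof -
  have "poly_scale r u \<in> free_piece a' (e + d) \<and> mat_app A m k (poly_scale r u) = 0"
    if "u \<in> free_piece a' d" "mat_app A m k u = 0" "homogeneous e r" for r u e d
    using that free_piece_mult[of e r u a' d] mat_app_mult[of A m k r u] by (auto simp: poly_scale_def)
  moreover have "mat_app A m k (u + v) = 0" if "mat_app A m k u = 0" "mat_app A m k v = 0" for u v
    using that mat_app_add[of A m k u v] by simp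
  ultimately show ?thesis
    unfolding graded_sub_def using mat_app_0[of A m k] by (auto intro: free_piece_add)
qed

lemma free_piece_dim_finite: "\<exists>F. finite F \<and> free_piece a d \<subseteq> fv.span F"
  by (rule exI[of _ "monvec ` monset a d"]) (simp add: free_piece_eq_span)

text \<open>From degree N on every element is a combination of variables times elements one degree
  lower, so bases of the finitely many pieces from L to N generate everything.\<close>

lemma graded_sub_generators:
  fixes K :: "int \<Rightarrow> (nat \<Rightarrow> ('i::finite, 'k::field) mpoly) set"
  assumes gs: "graded_sub a K" and low: "\<And>d. d < L \<Longrightarrow> K d \<subseteq> {0}"
    and van: "\<And>j. N \<le> j \<Longrightarrow> koszul_vanishes K 0 j"
  obtains G where "finite G" "G \<subseteq> (\<Union>d. K d)" "\<And>d. K d \<subseteq> fm.span G"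
proof -
  have "\<exists>S. finite S \<and> S \<subseteq> K d \<and> K d \<subseteq> fv.span S" for d
  proof -
    obtain F :: "(nat \<Rightarrow> ('i, 'k) mpoly) set" where F: "finite F" "free_piece a d \<subseteq> fv.span F" using free_piece_dim_finite by blast
    obtain S where S: "S \<subseteq> K d" "fv.independent S" "K d \<subseteq> fv.span S"
      using fv.basis_exists by metis
    have "K d \<subseteq> free_piece a d" using gs by (simp add: graded_sub_def)
    hence "finite S" using fv.finite_independent_subset[OF S(2) _ F(1)] S(1) F(2) by blast
    thus ?thesis using S by blast
  qed
  then obtain S where S: "\<And>d. finite (S d)" "\<And>d. S d \<subseteq> K d" "\<And>d. K d \<subseteq> fv.span (S d)"
    by metis
  define G where "G = (\<Union>d\<in>{L..N}. S d)"
  have "fv.subspace (fm.span G)"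
    by (rule fv.subspaceI) (simp_all add: fm.span_zero fm.span_add fm.span_scale const_scale_poly_scale del: zero_fun_apply)
  hence mid: "K d \<subseteq> fm.span G" if "d \<in> {L..N}" for d
    using S(3)[of d] fv.span_minimal[of "S d" "fm.span G"] that fm.span_superset[of G]
    unfolding G_def by blast
  have "K d \<subseteq> fm.span G" for d
  proof (induction "nat (d - L)" arbitrary: d rule: less_induct)
    case less
    consider "d < L" | "d \<in> {L..N}" | "L \<le> d" "N \<le> d" by fastforce
    thus ?case
    proof cases
      case 1 thus ?thesis using low[of d] fm.span_zero[of G] by blast
    next
      case 2 thus ?thesis by (rule mid)
    next
      case 3
      have lower: "K (d - 1) \<subseteq> fm.span G"
      proof (cases "d = L")
        case True
        thus ?thesis using low[of "d - 1"] fm.span_zero[of G] by force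
      next
        case False
        show ?thesis by (rule less) (use 3 False in auto)
      qed
      show ?thesis
      proof
        fix u assume "u \<in> K d"
        then obtain w where w: "\<And>b. w b \<in> K (d - 1)" "\<And>q. u q = (\<Sum>b\<in>UNIV. var b * w b q)"
          using koszul_vanishes_0D[OF van[OF 3(2)]] by metis
        have "u = (\<Sum>b\<in>UNIV. poly_scale (var b) (w b))"
          by (rule ext) (simp add: w(2) sum_fun_apply poly_scale_def)
        also have "\<dots> \<in> fm.span G"
          using w(1) lower by (intro fm.span_sum fm.span_scale) blast
        finally show "u \<in> fm.span G" .
      qed
    qed
  qed
  moreover have "finite G" "G \<subseteq> (\<Union>d. K d)" using S by (auto simp: G_def)
  ultimately show thesis by (intro that)
qed

lemma min_cover_exists:
  fixes K :: "int \<Rightarrow> (nat \<Rightarrow> ('i::finite, 'k::field) mpoly) set"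
  assumes gs: "graded_sub a K" and low: "\<And>d. d < L \<Longrightarrow> K d \<subseteq> {0}"
    and van: "\<And>j. N \<le> j \<Longrightarrow> koszul_vanishes K 0 j"
  obtains a' A where "min_cover a a' A K (\<lambda>d. {u \<in> free_piece a' d. mat_app A (length a) (length a') u = 0})"
proof -
  \<comment> \<open>Generating sets of least cardinality have no relation with a unit coefficient.\<close>
  define P where "P G \<longleftrightarrow> finite G \<and> G \<subseteq> (\<Union>d. K d) \<and> (\<forall>d. K d \<subseteq> fm.span G)" for G
  obtain G0 where "P G0" using graded_sub_generators[OF gs low van] unfolding P_def by metis
  then obtain G where PG: "P G" and mn: "\<And>G'. P G' \<Longrightarrow> card G \<le> card G'"
    using ex_has_least_nat[of P G0 card] by blast
  have G: "finite G" "G \<subseteq> (\<Union>d. K d)" "\<And>d. K d \<subseteq> fm.span G" using PG by (auto simp: P_def)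
  obtain gs where gsd: "set gs = G" "distinct gs" using G finite_distinct_list by blast
  have "\<forall>g\<in>G. \<exists>d. g \<in> K d" using G by blast
  from bchoice[OF this] obtain dg where dg: "\<And>g. g \<in> G \<Longrightarrow> g \<in> K (dg g)" by blast
  define a' where "a' = map dg gs"
  define A where "A p q = (gs ! q) p" for p q
  define k where "k = length gs"
  have len: "length a' = k" by (simp add: a'_def k_def)
  have Kh: "K d \<subseteq> free_piece a d" for d using gs by (simp add: graded_sub_def)
  have gK: "gs ! q \<in> K (a' ! q)" if "q < k" for q
  proof -
    have "gs ! q \<in> G" using that gsd(1) nth_mem[of q gs] by (simp add: k_def)
    thus ?thesis using that dg by (simp add: k_def a'_def)
  qed
  have gh: "gs ! q \<in> free_piece a (a' ! q)" if "q < k" for q using gK[OF that] Kh by blast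
  have mat_app: "mat_app A (length a) k u = (\<Sum>q<k. poly_scale (u q) (gs ! q))" for u
  proof
    fix p
    have "(gs ! q) p = 0" if "\<not> p < length a" "q < k" for q
      using free_piece_outside[OF gh] that by blast
    thus "mat_app A (length a) k u p = (\<Sum>q<k. poly_scale (u q) (gs ! q)) p"
      by (auto simp: mat_app_def sum_fun_apply poly_scale_def A_def mult.commute)
  qed
  have hm: "graded_mat a a' A"
    using gh by (auto simp: graded_mat_def A_def len free_piece_def)
  have im: "K d = mat_app A (length a) k ` free_piece a' d" for d
  proof
    show "mat_app A (length a) k ` free_piece a' d \<subseteq> K d"
    proof
      fix y assume "y \<in> mat_app A (length a) k ` free_piece a' d"
      then obtain u where u: "u \<in> free_piece a' d" "y = (\<Sum>q<k. poly_scale (u q) (gs ! q))"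
        by (auto simp: mat_app)
      have "poly_scale (u q) (gs ! q) \<in> K (d - a' ! q + a' ! q)" if "q < k" for q
        using gs gK[OF that] free_piece_homogeneous[OF u(1), of q] that len unfolding graded_sub_def by blast
      thus "y \<in> K d" unfolding u(2) by (intro graded_sub_sum[OF gs]) auto
    qed
    show "K d \<subseteq> mat_app A (length a) k ` free_piece a' d"
    proof
      fix y assume y: "y \<in> K d"
      have "finite G" "y \<in> fm.span G" using G y by auto
      then obtain c where c: "y = (\<Sum>g\<in>G. poly_scale (c g) g)" using fm.span_finite by blast
      have bij: "bij_betw ((!) gs) {..<k} G"
        using bij_betw_nth[OF gsd(2)] gsd(1) by (simp add: k_def)
      have "mat_app A (length a) k (\<lambda>q. c (gs ! q)) = y"
        unfolding mat_app c by (rule sum.reindex_bij_betw[OF bij])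
      \<comment> \<open>The coefficients c need not be homogeneous; their parts of the fitting
        degrees already produce y.\<close>
      hence "mat_app A (length a) k (vec_part a' d (\<lambda>q. c (gs ! q))) = y"
        using mat_app_vec_part[OF hm, of d "\<lambda>q. c (gs ! q)"] vec_part_free_piece_eq[of y a d d] y Kh len by auto
      thus "y \<in> mat_app A (length a) k ` free_piece a' d" using vec_part_free_piece by blast
    qed
  qed
  have minimal: "lk (u q) 0 = 0" if u: "u \<in> free_piece a' d" "mat_app A (length a) k u = 0" for u d q
  proof (rule ccontr)
    assume nz: "lk (u q) 0 \<noteq> 0"
    hence q: "q < k" using free_piece_outside[OF u(1), of q] by (cases "q < k") (auto simp: len)
    let ?c = "lk (u q) 0"
    have h: "homogeneous (d - a' ! q) (u q)" using free_piece_homogeneous[OF u(1)] q len by simp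
    \<comment> \<open>A nonzero constant term forces degree 0, so the coefficient is a unit of k and
      the q-th generator is a combination of the others.\<close>
    hence "d - a' ! q = 0" using homogeneous_lookup_0 nz by blast
    hence uq: "u q = const_poly ?c" using h homogeneous_deg_0 by metis
    let ?g = "gs ! q"
    have "(\<Sum>q<k. poly_scale (u q) (gs ! q)) = 0" using u(2) by (simp only: mat_app)
    hence "poly_scale (u q) ?g + (\<Sum>q'\<in>{..<k} - {q}. poly_scale (u q') (gs ! q')) = 0"
      using q by (simp add: sum.remove[of _ q])
    hence "poly_scale (u q) ?g = - (\<Sum>q'\<in>{..<k} - {q}. poly_scale (u q') (gs ! q'))"
      by (simp only: eq_neg_iff_add_eq_0)
    also have "\<dots> \<in> fm.span (G - {?g})"
      using q gsd by (intro fm.span_neg fm.span_sum fm.span_scale fm.span_base)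
        (auto simp: k_def nth_eq_iff_index_eq)
    finally have "poly_scale (const_poly (inverse ?c)) (poly_scale (u q) ?g) \<in> fm.span (G - {?g})"
      by (rule fm.span_scale)
    moreover have "poly_scale (const_poly (inverse ?c)) (poly_scale (u q) ?g) = ?g"
    proof -
      have "poly_scale (const_poly (inverse ?c)) (poly_scale (const_poly ?c) ?g) = const_scale (inverse ?c * ?c) ?g"
        by (simp add: const_scale_poly_scale const_poly_mult)
      thus ?thesis using nz uq by (metis fv.scale_one left_inverse)
    qed
    ultimately have "?g \<in> fm.span (G - {?g})" by simp
    hence "G \<subseteq> fm.span (G - {?g})" using fm.span_superset[of "G - {?g}"] by blast
    hence "fm.span G \<subseteq> fm.span (G - {?g})" by (rule fm.span_minimal) (rule fm.subspace_span)
    hence "P (G - {?g})" using G unfolding P_def by blast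
    from mn[OF this] show False
      using q gsd G by (metis card_Diff1_less k_def leD nth_mem)
  qed
  show thesis
    by (rule that[of a' A]) (use hm im minimal in \<open>auto simp: min_cover_def len\<close>)
qed

section \<open>Resolutions as chains of minimal covers\<close>

definition cover_resolution :: "(nat \<Rightarrow> int list) \<Rightarrow> (nat \<Rightarrow> nat \<Rightarrow> nat \<Rightarrow> ('i::finite, 'k::field) mpoly) \<Rightarrow>
    (nat \<Rightarrow> int \<Rightarrow> (nat \<Rightarrow> ('i, 'k) mpoly) set) \<Rightarrow> bool" where
  "cover_resolution a A K \<longleftrightarrow> (\<forall>i. min_cover (a i) (a (Suc i)) (A i) (K i) (K (Suc i)))"

text \<open>Each syzygy step trades one homological degree of the Koszul complex at the same
  internal degree, so the bound on j grows by one with i.\<close>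

lemma cover_resolution_koszul_vanishes:
  assumes "cover_resolution a A K" and "\<And>p j. r + 2 + int p \<le> j \<Longrightarrow> koszul_vanishes (K 0) p j" and "r + 2 + int p + int i \<le> j"
  shows "koszul_vanishes (K i) p j"
  using assms(3)
proof (induction i arbitrary: p)
  case 0
  thus ?case using assms(2) by simp
next
  case (Suc i)
  have "min_cover (a i) (a (Suc i)) (A i) (K i) (K (Suc i))" using assms(1) by (simp add: cover_resolution_def)
  thus ?case by (rule koszul_vanishes_step) (rule Suc.IH, use Suc.prems in simp)
qed

lemma cover_resolution_exists:
  fixes K0 :: "int \<Rightarrow> (nat \<Rightarrow> ('i::finite, 'k::field) mpoly) set"
  assumes gs: "graded_sub a0 K0" and low: "\<And>d. d < 0 \<Longrightarrow> K0 d \<subseteq> {0}"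
    and van: "\<And>p j. r + 2 + int p \<le> j \<Longrightarrow> koszul_vanishes K0 p j"
  obtains a A K where "a 0 = a0" "K 0 = K0" "cover_resolution a A K"
proof -
  \<comment> \<open>The invariant carries what \<open>min_cover_exists\<close> asks for at the next
    step: vanishing in negative degrees, and of the zeroth Koszul homology from some degree on. All
    p are carried, since each step consumes one.\<close>
  let ?P = "\<lambda>i (a, K :: int \<Rightarrow> (nat \<Rightarrow> ('i, 'k) mpoly) set). graded_sub a K \<and> (\<forall>d<0. K d \<subseteq> {0}) \<and>
    (\<forall>p j. r + 2 + int p + int i \<le> j \<longrightarrow> koszul_vanishes K p j) \<and> (i = 0 \<longrightarrow> a = a0 \<and> K = K0)"
  let ?Q = "\<lambda>(i::nat) (a, K) (a', K'). \<exists>A. min_cover a a' A K K'"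
  have "\<exists>f. \<forall>i. ?P i (f i) \<and> ?Q i (f i) (f (Suc i))"
  proof (rule dependent_nat_choice)
    show "\<exists>x. ?P 0 x" using gs low van by (intro exI[of _ "(a0, K0)"]) auto
  next
    fix x i assume that: "?P i x"
    obtain a K where x: "x = (a, K)" by fastforce
    have g: "graded_sub a K" and l: "\<And>d. d < 0 \<Longrightarrow> K d \<subseteq> {0}"
      and v: "\<And>p j. r + 2 + int p + int i \<le> j \<Longrightarrow> koszul_vanishes K p j"
      using that by (auto simp: x)
    obtain a' A where mc: "min_cover a a' A K (\<lambda>d. {u \<in> free_piece a' d. mat_app A (length a) (length a') u = 0})"
      (is "min_cover a a' A K ?K")
      by (rule min_cover_exists[OF g, of 0 "r + 2 + int i"]) (use l v in auto)
    have "?K d \<subseteq> {0}" if "d < 0" for d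
    proof (rule cover_syz_zero[OF mc])
      fix b assume "b \<in> set a'"
      hence "\<not> b < 0" using cover_degree_zero[OF mc l] by blast
      thus "d \<le> b" using that by simp
    qed
    moreover have "koszul_vanishes ?K p j" if "r + 2 + int p + int (Suc i) \<le> j" for p j
      by (rule koszul_vanishes_step[OF mc]) (rule v, use that in simp)
    ultimately have "?P (Suc i) (a', ?K) \<and> ?Q i x (a', ?K)"
      using mc graded_sub_syz by (auto simp: x)
    thus "\<exists>y. ?P (Suc i) y \<and> ?Q i x y" by (rule exI)
  qed
  then obtain f where f: "\<forall>i. ?P i (f i) \<and> ?Q i (f i) (f (Suc i))"
    by (rule exE)
  define a where "a i = fst (f i)" for i
  define K where "K i = snd (f i)" for i
  have fi: "f i = (a i, K i)" for i by (simp add: a_def K_def)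
  have "\<forall>i. \<exists>A. min_cover (a i) (a (Suc i)) A (K i) (K (Suc i))" using f by (simp add: fi)
  from choice[OF this] obtain A where "cover_resolution a A K" unfolding cover_resolution_def by blast
  moreover have "a 0 = a0" "K 0 = K0" using f[THEN spec, of 0] by (auto simp: fi)
  ultimately show thesis using that by blast
qed

subsection \<open>Euler characteristic\<close>

lemma linear_mat_app: "Vector_Spaces.linear const_scale const_scale (mat_app A m k)"
  using fv.vector_space_axioms
  by (auto simp: Vector_Spaces.linear_iff vector_space_pair_def mat_app_add const_scale_def mat_app_mult simp del: plus_fun_apply)

lemma min_cover_dim:
  fixes A :: "nat \<Rightarrow> nat \<Rightarrow> ('i::finite, 'k::field) mpoly"
  assumes "min_cover a a' A K K'"
  shows "fv.dim (free_piece a' d :: (nat \<Rightarrow> ('i, 'k) mpoly) set) = fv.dim (K d) + fv.dim (K' d)"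
proof -
  obtain F :: "(nat \<Rightarrow> ('i, 'k) mpoly) set" where F: "finite F" "free_piece a' d \<subseteq> fv.span F" using free_piece_dim_finite by blast
  show ?thesis
    using ff.rank_nullity[OF linear_mat_app subspace_free_piece F(2,1), of A "length a" "length a'"] assms
    by (simp add: min_cover_def)
qed

text \<open>The sequence of modules runs over all natural numbers, so the sum stops at m with a
  remainder; for fixed d the remainder disappears once the syzygies start above d.\<close>

lemma cover_resolution_euler:
  fixes K :: "nat \<Rightarrow> int \<Rightarrow> (nat \<Rightarrow> ('i::finite, 'k::field) mpoly) set"
  assumes "cover_resolution a A K"
  shows "int (fv.dim (K 0 d)) = (\<Sum>i<m. (- 1) ^ i * int (fv.dim (free_piece (a (Suc i)) d :: (nat \<Rightarrow> ('i, 'k) mpoly) set)))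
    + (- 1) ^ m * int (fv.dim (K m d))"
proof (induction m)
  case (Suc m)
  have "min_cover (a m) (a (Suc m)) (A m) (K m) (K (Suc m))" using assms by (simp add: cover_resolution_def)
  from min_cover_dim[OF this, of d] have "int (fv.dim (K m d)) = int (fv.dim (free_piece (a (Suc m)) d :: (nat \<Rightarrow> ('i, 'k) mpoly) set)) - int (fv.dim (K (Suc m) d))"
    by simp
  with Suc.IH show ?case by (simp add: algebra_simps)
qed simp

subsection \<open>Star configurations\<close>

lemma peval_lin:
  assumes "coeff_hom h" "homogeneous 1 p"
  shows "peval h y p = (\<Sum>a\<in>UNIV. h (lk p (unitm a)) * y a)"
proof -
  interpret coeff_hom h by (rule assms(1))
  show ?thesis
    by (subst homogeneous_lin[OF assms(2)]) (simp only: peval_sum peval_mult peval_const peval_var)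
qed

lemma poly_eval_lin: "homogeneous 1 p \<Longrightarrow> poly_eval p x = (\<Sum>a\<in>UNIV. lk p (unitm a) * x a)"
  unfolding poly_eval_peval by (rule peval_lin[OF ev.coeff_hom_axioms])

text \<open>Duality for finitely many linear functionals, by induction on the family: a form that
  does not follow from the others is nonzero at some common zero y of them, and subtracting the
  right multiple of it makes g vanish at y as well.\<close>

lemma linear_forms_annihilator:
  fixes l :: "nat \<Rightarrow> ('i::finite, 'k::field) mpoly"
  assumes "finite s" "\<And>a. a \<in> s \<Longrightarrow> homogeneous 1 (l a)" "homogeneous 1 g"
    and "\<And>x. (\<And>a. a \<in> s \<Longrightarrow> poly_eval (l a) x = 0) \<Longrightarrow> poly_eval g x = 0"
  shows "\<exists>\<mu>. g = (\<Sum>a\<in>s. const_poly (\<mu> a) * l a)"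
  using assms
proof (induction s arbitrary: g rule: finite_induct)
  case empty
  have "lk g (unitm b) = 0" for b
  proof -
    have "poly_eval g (\<lambda>a. if a = b then 1 else 0) = lk g (unitm b)"
      by (simp add: poly_eval_lin[OF empty(2)] if_distrib cong: if_cong)
    thus ?thesis using empty(3) by simp
  qed
  hence "g = 0" using homogeneous_lin[OF empty(2)] by simp
  thus ?case by simp
next
  case (insert c s)
  have hc: "homogeneous 1 (l c)" using insert.prems(1) by simp
  have hs: "\<And>a. a \<in> s \<Longrightarrow> homogeneous 1 (l a)" using insert.prems(1) by simp
  show ?case
  proof (cases "\<forall>x. (\<forall>a\<in>s. poly_eval (l a) x = 0) \<longrightarrow> poly_eval (l c) x = 0")
    case True
    have "\<exists>\<mu>. g = (\<Sum>a\<in>s. const_poly (\<mu> a) * l a)"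
      by (rule insert.IH[OF hs insert.prems(2)]) (use True insert.prems(3) in auto)
    then obtain \<mu> where "g = (\<Sum>a\<in>s. const_poly (\<mu> a) * l a)" by blast
    hence "g = (\<Sum>a\<in>insert c s. const_poly (if a = c then 0 else \<mu> a) * l a)"
      using insert.hyps by (auto intro!: sum.cong)
    thus ?thesis by (rule exI[of _ "\<lambda>a. if a = c then 0 else \<mu> a"])
  next
    case False
    then obtain y where y: "\<And>a. a \<in> s \<Longrightarrow> poly_eval (l a) y = 0" "poly_eval (l c) y \<noteq> 0" by auto
    define t where "t = poly_eval g y / poly_eval (l c) y"
    have "\<exists>\<mu>. g - const_poly t * l c = (\<Sum>a\<in>s. const_poly (\<mu> a) * l a)"
    proof (rule insert.IH[OF hs])
      show "homogeneous 1 (g - const_poly t * l c)"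
        by (intro homogeneous_diff homogeneous_const_mult insert.prems(2) hc)
      fix x assume x: "\<And>a. a \<in> s \<Longrightarrow> poly_eval (l a) x = 0"
      \<comment> \<open>With this e the vector \<open>x - e * y\<close> is a zero of
        \<open>l c\<close> too, so the assumption on g applies to it.\<close>
      define e where "e = poly_eval (l c) x / poly_eval (l c) y"
      have lin: "poly_eval p (\<lambda>i. x i - e * y i) = poly_eval p x - e * poly_eval p y"
        if "homogeneous 1 p" for p :: "('i, 'k) mpoly"
        by (simp add: poly_eval_lin[OF that] algebra_simps sum_subtractf sum_distrib_left)
      have "poly_eval g (\<lambda>i. x i - e * y i) = 0"
      proof (rule insert.prems(3))
        fix a assume "a \<in> insert c s"
        thus "poly_eval (l a) (\<lambda>i. x i - e * y i) = 0"
          using lin[OF insert.prems(1), of a] x y by (auto simp: e_def)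
      qed
      hence "poly_eval g x = e * poly_eval g y" using lin[OF insert.prems(2)] by simp
      thus "poly_eval (g - const_poly t * l c) x = 0"
        using y(2) by (simp add: poly_eval_simps t_def e_def field_simps)
    qed
    then obtain \<mu> where "g - const_poly t * l c = (\<Sum>a\<in>s. const_poly (\<mu> a) * l a)" by blast
    hence "g = const_poly t * l c + (\<Sum>a\<in>s. const_poly (\<mu> a) * l a)" by (simp add: algebra_simps)
    hence "g = (\<Sum>a\<in>insert c s. const_poly (if a = c then t else \<mu> a) * l a)"
      using insert.hyps by (auto intro!: sum.cong)
    thus ?thesis by (rule exI[of _ "\<lambda>a. if a = c then t else \<mu> a"])
  qed
qed

lemma finite_n_subsets [simp]: "finite (n_subsets n v)"
  by (simp add: n_subsets_def)

lemma card_n_subsets: "card (n_subsets n v) = v choose n"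
  using n_subsets[of "{1..v}" n] by (simp add: n_subsets_def)

lemma n_subsetsD: "s \<in> n_subsets n v \<Longrightarrow> finite s \<and> s \<subseteq> {1..v} \<and> card s = n"
  by (auto simp: n_subsets_def intro: finite_subset)

interpretation im: Modules.module "(*) :: ('i::finite, 'k::field) mpoly \<Rightarrow> _"
  by unfold_locales (auto simp: algebra_simps)

lemma var_mult_eq_0: "var a * f = 0 \<Longrightarrow> f = 0"
proof (rule poly_mapping_eqI)
  fix m assume "var a * f = 0"
  hence "lk (var a * f) (m + unitm a) = 0" by simp
  thus "lk f m = lk 0 m" by (simp add: lookup_var_mult lookup_add)
qed

lemma unitm_eq_iff [simp]: "unitm a = unitm b \<longleftrightarrow> a = b"
  by (metis lookup_single_eq lookup_single_not_eq nat.simps(3))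

section \<open>Points cut out by n of the forms, and products of the remaining forms\<close>

locale star_config =
  fixes l :: "nat \<Rightarrow> ('i::finite, 'k::field) mpoly" and n v :: nat and P :: "nat set \<Rightarrow> 'i \<Rightarrow> 'k"
  assumes dim: "CARD('i) = n + 1" and n_pos: "0 < n" and nv: "n \<le> v"
    and lin: "a \<in> {1..v} \<Longrightarrow> homogeneous 1 (l a)"
    and P_nonzero: "s \<in> n_subsets n v \<Longrightarrow> P s \<noteq> (\<lambda>_. 0)"
    and P_on: "s \<in> n_subsets n v \<Longrightarrow> a \<in> s \<Longrightarrow> poly_eval (l a) (P s) = 0"
    and P_unique: "s \<in> n_subsets n v \<Longrightarrow> (\<And>a. a \<in> s \<Longrightarrow> poly_eval (l a) x = 0) \<Longrightarrow> \<exists>c. x = (\<lambda>i. c * P s i)"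
    and P_off: "s \<in> n_subsets n v \<Longrightarrow> a \<in> {1..v} - s \<Longrightarrow> poly_eval (l a) (P s) \<noteq> 0"
begin

abbreviation X :: "nat set set" where "X \<equiv> n_subsets n v"

text \<open>This is \<open>F\<^sub>s\<close> of the overview; it is defined for sets of any size
  because (n - 1)-subsets occur in the syzygy argument as well.\<close>

definition complement_prod :: "nat set \<Rightarrow> ('i, 'k) mpoly" where
  "complement_prod s = (\<Prod>a\<in>{1..v} - s. l a)"

lemma homogeneous_complement_prod:
  assumes "s \<in> n_subsets m v"
  shows "homogeneous (int v - int m) (complement_prod s)"
proof -
  have "homogeneous (\<Sum>a\<in>{1..v} - s. 1) (complement_prod s)"
    unfolding complement_prod_def by (rule homogeneous_prod) (simp add: lin)
  moreover have "card ({1..v} - s) = v - m" "m \<le> v"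
    using n_subsetsD[OF assms] card_mono[of "{1..v}" s] by (auto simp: card_Diff_subset)
  ultimately show ?thesis by (simp add: of_nat_diff)
qed

lemma poly_eval_complement_prod:
  assumes "s \<in> X" "s' \<in> X"
  shows "poly_eval (complement_prod s) (P s') = 0 \<longleftrightarrow> s \<noteq> s'"
proof
  assume "poly_eval (complement_prod s) (P s') = 0"
  then obtain a where "a \<in> {1..v} - s" "poly_eval (l a) (P s') = 0"
    by (auto simp: complement_prod_def poly_eval_simps)
  thus "s \<noteq> s'" using P_off[OF assms(2)] by blast
next
  assume "s \<noteq> s'"
  hence "\<not> s' \<subseteq> s" using n_subsetsD[OF assms(1)] n_subsetsD[OF assms(2)] card_subset_eq by metis
  then obtain a where "a \<in> s'" "a \<in> {1..v} - s" using n_subsetsD[OF assms(2)] by blast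
  thus "poly_eval (complement_prod s) (P s') = 0"
    using P_on[OF assms(2), of a] by (auto simp: complement_prod_def poly_eval_simps intro!: prod_zero)
qed

lemma poly_eval_sum_complement_prod:
  assumes "Y \<subseteq> X" "s \<in> X"
  shows "poly_eval (\<Sum>b\<in>Y. m b * complement_prod b) (P s) = (if s \<in> Y then poly_eval (m s) (P s) * poly_eval (complement_prod s) (P s) else 0)"
proof -
  have fin: "finite Y" by (rule finite_subset[OF assms(1) finite_n_subsets])
  have "poly_eval (\<Sum>b\<in>Y. m b * complement_prod b) (P s) = (\<Sum>b\<in>Y. if b = s then poly_eval (m b) (P s) * poly_eval (complement_prod b) (P s) else 0)"
    using poly_eval_complement_prod[of _ s] assms by (auto simp: poly_eval_simps intro!: sum.cong)
  thus ?thesis using fin by simp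
qed

lemma interpolation:
  assumes "int v - int n \<le> d"
  shows "\<exists>f. homogeneous d f \<and> (\<forall>s\<in>X. poly_eval f (P s) = u s)"
proof -
  have "\<exists>b. P s b \<noteq> 0" if "s \<in> X" for s using P_nonzero[OF that] by auto
  then obtain c where c: "\<And>s. s \<in> X \<Longrightarrow> P s (c s) \<noteq> 0" by metis
  \<comment> \<open>The surplus degree is filled by a power of a variable that does not vanish at
    the point.\<close>
  define e where "e = nat (d - (int v - int n))"
  define m where "m s = const_poly (u s / (P s (c s) ^ e * poly_eval (complement_prod s) (P s))) * var (c s) ^ e" for s
  have "homogeneous (int e * 1 + (int v - int n)) (m s * complement_prod s)" if "s \<in> X" for s
    unfolding m_def by (intro homogeneous_mult homogeneous_const_mult homogeneous_power homogeneous_var homogeneous_complement_prod that)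
  hence "homogeneous d (m s * complement_prod s)" if "s \<in> X" for s
    using that assms by (simp add: e_def)
  hence "homogeneous d (\<Sum>s\<in>X. m s * complement_prod s)" by (rule homogeneous_sum)
  moreover have "poly_eval (\<Sum>s\<in>X. m s * complement_prod s) (P s) = u s" if "s \<in> X" for s
    using poly_eval_sum_complement_prod[OF subset_refl that, of m] that c[OF that] poly_eval_complement_prod[OF that that]
    by (simp add: m_def poly_eval_simps)
  ultimately show ?thesis by blast
qed

lemma inj_complement_prod: "inj_on complement_prod X"
proof (rule inj_onI, rule ccontr)
  fix s s' assume s: "s \<in> X" "s' \<in> X" and e: "complement_prod s = complement_prod s'" and "s \<noteq> s'"
  thus False using poly_eval_complement_prod[OF s] poly_eval_complement_prod[OF s(2,2)] e by simp
qed

lemma embed_apply_0 [simp]: "embed f 0 = f"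
  by (simp add: embed_def)

lemma inj_embed_complement_prod: "inj_on (\<lambda>s. embed (complement_prod s)) X"
proof (rule inj_onI)
  fix s s' assume s: "s \<in> X" "s' \<in> X" and "embed (complement_prod s) = embed (complement_prod s')"
  hence "complement_prod s = complement_prod s'" by (metis embed_apply_0)
  thus "s = s'" using inj_complement_prod s by (simp add: inj_on_eq_iff)
qed

lemma embed_complement_prod_free_piece: "s \<in> X \<Longrightarrow> embed (complement_prod s) \<in> free_piece [0] (int v - int n)"
  using homogeneous_complement_prod[of s n] by (simp add: free_piece_def embed_def)

lemma embed_complement_prod_independent:
  assumes "Y \<subseteq> X"
  shows "fv.independent ((\<lambda>s. embed (complement_prod s)) ` Y)"
proof (rule fv.independent_if_scalars_zero)
  have inj: "inj_on (\<lambda>s. embed (complement_prod s)) Y" using inj_on_subset[OF inj_embed_complement_prod assms] .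
  show "finite ((\<lambda>s. embed (complement_prod s)) ` Y)" using finite_subset[OF assms] by simp
  fix f :: "(nat \<Rightarrow> ('i, 'k) mpoly) \<Rightarrow> 'k" and y
  assume 0: "(\<Sum>x\<in>(\<lambda>s. embed (complement_prod s)) ` Y. const_scale (f x) x) = 0" and "y \<in> (\<lambda>s. embed (complement_prod s)) ` Y"
  then obtain s where s: "s \<in> Y" "y = embed (complement_prod s)" by blast
  have "(\<Sum>b\<in>Y. const_poly (f (embed (complement_prod b))) * complement_prod b) = (\<Sum>x\<in>(\<lambda>s. embed (complement_prod s)) ` Y. const_scale (f x) x) 0"
    by (simp add: sum.reindex[OF inj] sum_fun_apply const_scale_def)
  hence "poly_eval (\<Sum>b\<in>Y. const_poly (f (embed (complement_prod b))) * complement_prod b) (P s) = 0"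
    unfolding 0 by (simp add: poly_eval_simps)
  moreover have sX: "s \<in> X" using s assms by blast
  ultimately have "poly_eval (const_poly (f (embed (complement_prod s)))) (P s) * poly_eval (complement_prod s) (P s) = 0"
    using poly_eval_sum_complement_prod[OF assms sX, of "\<lambda>b. const_poly (f (embed (complement_prod b)))"] s(1) by simp
  thus "f y = 0"
    using poly_eval_complement_prod[OF sX sX] s(2) by (simp add: poly_eval_peval[of "const_poly _"])
qed

text \<open>In n + 1 variables the forms of degree v - n have dimension \<open>v choose n\<close>,
  the number of n-subsets, so the independent products exhaust that degree; evaluation at the points
  gives the coefficients.\<close>

lemma complement_prod_span:
  assumes f: "homogeneous (int v - int n) f"
  shows "f = (\<Sum>s\<in>X. const_poly (poly_eval f (P s) / poly_eval (complement_prod s) (P s)) * complement_prod s)"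
proof -
  let ?B = "(\<lambda>s. embed (complement_prod s)) ` X" and ?V = "free_piece [0] (int v - int n) :: (nat \<Rightarrow> ('i, 'k) mpoly) set"
  have "int (fv.dim ?V) = int (v choose n)"
    using nv by (simp add: dim_free_piece[OF dim] piece_dim_def of_nat_diff nat_diff_distrib flip: of_nat_diff)
  hence "card ?B = fv.dim ?V"
    by (simp add: card_image[OF inj_embed_complement_prod] card_n_subsets)
  moreover obtain F :: "(nat \<Rightarrow> ('i, 'k) mpoly) set" where F: "finite F" "?V \<subseteq> fv.span F"
    using free_piece_dim_finite by blast
  obtain C where C: "?B \<subseteq> C" "C \<subseteq> ?V" "fv.independent C" "?V \<subseteq> fv.span C"
    using fv.maximal_independent_subset_extend[of ?B ?V] embed_complement_prod_independent[OF subset_refl] embed_complement_prod_free_piece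
    by blast
  have "finite C" using fv.finite_independent_subset[OF C(3) _ F(1)] C(2) F(2) by blast
  moreover have "card C = fv.dim ?V" using C by (intro fv.basis_card_eq_dim)
  ultimately have "?B = C" using C(1) by (intro card_subset_eq) auto
  moreover have "embed f \<in> ?V" using f by (simp add: free_piece_def embed_def)
  ultimately have "embed f \<in> fv.span ?B" using C(4) by blast
  then obtain c where "embed f = (\<Sum>x\<in>?B. const_scale (c x) x)"
    using fv.span_finite[of ?B] by auto
  hence "embed f 0 = (\<Sum>x\<in>?B. const_scale (c x) x) 0" by simp
  hence "f = (\<Sum>s\<in>X. const_poly (c (embed (complement_prod s))) * complement_prod s)"
    by (simp add: sum.reindex[OF inj_embed_complement_prod] sum_fun_apply const_scale_def)
  moreover define c' where "c' s = c (embed (complement_prod s))" for s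
  ultimately have c': "f = (\<Sum>s\<in>X. const_poly (c' s) * complement_prod s)" by simp
  have "poly_eval f (P s) / poly_eval (complement_prod s) (P s) = c' s" if "s \<in> X" for s
    using poly_eval_sum_complement_prod[OF subset_refl that, of "\<lambda>s. const_poly (c' s)"] that poly_eval_complement_prod[OF that that]
    by (subst c') (simp add: poly_eval_simps)
  thus ?thesis using c' by simp
qed

text \<open>Restriction to the line cut out by the forms \<open>l a\<close> with \<open>a \<in> T\<close> kills every product but that of \<open>T\<close>.
  As \<open>k\<close> may be finite, it is done by a substitution into \<open>k[t]\<close> and not by evaluation.\<close>

lemma line_complement_indep:
  assumes nv: "n < v" and 0: "(\<Sum>T\<in>n_subsets (n - 1) v. const_poly (\<mu> T) * complement_prod T) = 0"
    and T: "T \<in> n_subsets (n - 1) v"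
  shows "\<mu> T = 0"
proof -
  have fT: "finite T" "T \<subseteq> {1..v}" "card T = n - 1" using n_subsetsD[OF T] by auto
  have "card ({1..v} - T) = v - (n - 1)" using fT by (simp add: card_Diff_subset)
  \<comment> \<open>Two further hyperplanes cut the line of T in two different points, which
    parametrise it; \<open>n < v\<close> provides them.\<close>
  hence "card ({1..v} - T) \<ge> 2" using nv n_pos by simp
  then obtain Q where "Q \<subseteq> {1..v} - T" "card Q = 2"
    by (rule obtain_subset_with_card_n) (rule that)
  then obtain a a' where a: "a \<in> {1..v} - T" "a' \<in> {1..v} - T" "a \<noteq> a'"
    unfolding card_2_iff by auto
  have s: "insert a T \<in> X" "insert a' T \<in> X" using a fT n_pos by (auto simp: n_subsets_def)
  define h :: "'k \<Rightarrow> 'k poly" where "h c = [:c:]" for c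
  interpret h: coeff_hom h
    by unfold_locales (auto simp: h_def)
  \<comment> \<open>The line through the two points; a linear form restricts to the polynomial whose
    two coefficients are its values there.\<close>
  define w where "w i = [:P (insert a T) i, P (insert a' T) i:]" for i
  have hl: "peval h w (l c) = [:poly_eval (l c) (P (insert a T)), poly_eval (l c) (P (insert a' T)):]"
    if "c \<in> {1..v}" for c
  proof -
    have "peval h w (l c) = (\<Sum>b\<in>UNIV. [:lk (l c) (unitm b) * P (insert a T) b, lk (l c) (unitm b) * P (insert a' T) b:])"
      by (simp add: peval_lin[OF h.coeff_hom_axioms lin[OF that]] h_def w_def mult.commute)
    also have "\<dots> = [:(\<Sum>b\<in>UNIV. lk (l c) (unitm b) * P (insert a T) b), (\<Sum>b\<in>UNIV. lk (l c) (unitm b) * P (insert a' T) b):]"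
    proof -
      have "(\<Sum>b\<in>B. [:f b, g b:]) = [:\<Sum>b\<in>B. f b, \<Sum>b\<in>B. g b:]" for f g :: "'i \<Rightarrow> 'k" and B
        by (induction B rule: infinite_finite_induct) simp_all
      thus ?thesis .
    qed
    finally show ?thesis by (simp add: poly_eval_lin[OF lin[OF that]])
  qed
  have other: "peval h w (complement_prod T') = 0" if T': "T' \<in> n_subsets (n - 1) v" "T' \<noteq> T" for T'
  proof -
    have "\<not> T \<subseteq> T'"
      using n_subsetsD[OF T'(1)] fT T'(2) card_subset_eq[of T' T] by auto
    then obtain c where c: "c \<in> T" "c \<in> {1..v} - T'" using fT by blast
    hence "peval h w (l c) = 0" using hl[of c] P_on[OF s(1), of c] P_on[OF s(2), of c] by auto
    thus ?thesis using c by (auto simp: complement_prod_def h.peval_prod intro!: prod_zero)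
  qed
  have "peval h w (l c) \<noteq> 0" if c: "c \<in> {1..v} - T" for c
  proof (cases "c = a")
    case True
    hence "poly_eval (l c) (P (insert a' T)) \<noteq> 0" using a c by (intro P_off[OF s(2)]) auto
    thus ?thesis using hl[of c] c by auto
  next
    case False
    hence "poly_eval (l c) (P (insert a T)) \<noteq> 0" using a c by (intro P_off[OF s(1)]) auto
    thus ?thesis using hl[of c] c by auto
  qed
  hence self: "peval h w (complement_prod T) \<noteq> 0" by (auto simp: complement_prod_def h.peval_prod)
  have "0 = peval h w (\<Sum>T\<in>n_subsets (n - 1) v. const_poly (\<mu> T) * complement_prod T)" unfolding 0 by simp
  also have "\<dots> = (\<Sum>T'\<in>n_subsets (n - 1) v. if T' = T then h (\<mu> T) * peval h w (complement_prod T) else 0)"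
    unfolding h.peval_sum h.peval_mult h.peval_const
    using other by (intro sum.cong refl) auto
  also have "\<dots> = h (\<mu> T) * peval h w (complement_prod T)" using T by simp
  finally show ?thesis using self by (simp add: h_def)
qed

end

section \<open>Linear syzygies between the products for the blocks, and the initial degree\<close>

locale steiner_config = star_config l n v P
  for l :: "nat \<Rightarrow> ('i::finite, 'k::field) mpoly" and n v P +
  fixes B :: "nat set set"
  assumes B_sub: "B \<subseteq> n_subsets n v"
    and B_unique: "b \<in> B \<Longrightarrow> b' \<in> B \<Longrightarrow> T \<in> n_subsets (n - 1) v \<Longrightarrow> T \<subseteq> b \<Longrightarrow> T \<subseteq> b' \<Longrightarrow> b = b'"
begin

lemma finite_B [simp]: "finite B"
  by (rule finite_subset[OF B_sub finite_n_subsets])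

text \<open>Since \<open>m b\<close> vanishes at \<open>P b\<close>, it is a combination of the forms \<open>l a\<close> with \<open>a \<in> b\<close>, which turns
  the relation into one between the products \<open>complement_prod (b - {a})\<close>. These are pairwise distinct because
  two blocks share no \<open>(n - 1)\<close>-subset.\<close>

lemma no_linear_syzygies:
  assumes m: "\<And>b. b \<in> B \<Longrightarrow> homogeneous 1 (m b)" and 0: "(\<Sum>b\<in>B. m b * complement_prod b) = 0" and b: "b \<in> B"
  shows "m b = 0"
proof (cases "n = v")
  \<comment> \<open>The whole set is the only n-subset, its product is empty and equals 1, and the
    relation reads \<open>m b = 0\<close>.\<close>
  case True
  have all: "s = {1..v}" if "s \<in> X" for s
    using n_subsetsD[OF that] True card_subset_eq[of "{1..v}" s] by auto
  hence "B = {{1..v}}" "b = {1..v}" using B_sub b by blast+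
  thus ?thesis using 0 by (simp add: complement_prod_def)
next
  case False
  hence nv': "n < v" using nv by simp
  have "\<exists>\<mu>. m b = (\<Sum>a\<in>b. const_poly (\<mu> a) * l a)" if b: "b \<in> B" for b
  proof (rule linear_forms_annihilator)
    have bX: "b \<in> X" using b B_sub by blast
    show "finite b" using n_subsetsD[OF bX] by blast
    show "homogeneous 1 (l a)" if "a \<in> b" for a using that n_subsetsD[OF bX] lin by blast
    show "homogeneous 1 (m b)" by (rule m[OF b])
    fix x assume "\<And>a. a \<in> b \<Longrightarrow> poly_eval (l a) x = 0"
    then obtain c where x: "x = (\<lambda>i. c * P b i)" using P_unique[OF bX] by blast
    \<comment> \<open>At \<open>P b\<close> the products for all other blocks vanish and that for b
      does not, so the relation forces \<open>m b\<close> to vanish there.\<close>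
    have "poly_eval (\<Sum>b\<in>B. m b * complement_prod b) (P b) = 0" unfolding 0 by (simp add: poly_eval_simps)
    hence "poly_eval (m b) (P b) = 0"
      using poly_eval_sum_complement_prod[OF B_sub bX, of m] b poly_eval_complement_prod[OF bX bX] by simp
    thus "poly_eval (m b) x = 0" unfolding x using poly_eval_scale[OF m[OF b]] by simp
  qed
  then obtain \<mu> where \<mu>: "\<And>b. b \<in> B \<Longrightarrow> m b = (\<Sum>a\<in>b. const_poly (\<mu> b a) * l a)" by metis
  let ?S = "SIGMA b:B. b" and ?g = "\<lambda>(b, a). b - {a}"
  have fin: "finite b" if "b \<in> B" for b using that B_sub n_subsetsD by blast
  have gT: "?g x \<in> n_subsets (n - 1) v" if "x \<in> ?S" for x
    using that B_sub n_subsetsD[of "fst x" n v] by (auto simp: n_subsets_def)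
  have inj: "inj_on ?g ?S"
  proof (rule inj_onI)
    fix x y assume xy: "x \<in> ?S" "y \<in> ?S" "?g x = ?g y"
    obtain b a b' a' where e: "x = (b, a)" "y = (b', a')" by fastforce
    have "b = b'" using B_unique[of b b' "b - {a}"] xy gT[OF xy(1)] by (auto simp: e)
    thus "x = y" using xy by (auto simp: e)
  qed
  \<comment> \<open>Transports the coefficients from pairs of a block and one of its elements to (n
    - 1)-subsets; injectivity makes this well defined, and subsets that do not arise get 0.\<close>
  define \<nu> where "\<nu> T = (if T \<in> ?g ` ?S then case_prod \<mu> (the_inv_into ?S ?g T) else 0)" for T
  have \<nu>: "\<nu> (?g x) = case_prod \<mu> x" if "x \<in> ?S" for x
    using that the_inv_into_f_f[OF inj that] by (simp add: \<nu>_def)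
  have "(\<Sum>T\<in>n_subsets (n - 1) v. const_poly (\<nu> T) * complement_prod T) = (\<Sum>T\<in>?g ` ?S. const_poly (\<nu> T) * complement_prod T)"
    using gT by (intro sum.mono_neutral_right) (auto simp: \<nu>_def)
  also have "\<dots> = (\<Sum>x\<in>?S. const_poly (case_prod \<mu> x) * complement_prod (?g x))"
    using \<nu> by (simp add: sum.reindex[OF inj])
  also have "\<dots> = (\<Sum>b\<in>B. \<Sum>a\<in>b. const_poly (\<mu> b a) * complement_prod (b - {a}))"
    using fin by (subst sum.Sigma) (auto intro!: sum.cong)
  also have "\<dots> = (\<Sum>b\<in>B. m b * complement_prod b)"
  proof (intro sum.cong refl)
    fix b assume b: "b \<in> B"
    have c: "complement_prod (b - {a}) = l a * complement_prod b" if "a \<in> b" for a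
    proof -
      have "{1..v} - (b - {a}) = insert a ({1..v} - b)" "a \<notin> {1..v} - b"
        using that b B_sub n_subsetsD by blast+
      thus ?thesis by (simp add: complement_prod_def)
    qed
    have "(\<Sum>a\<in>b. const_poly (\<mu> b a) * complement_prod (b - {a})) = (\<Sum>a\<in>b. const_poly (\<mu> b a) * l a * complement_prod b)"
      by (intro sum.cong refl) (simp only: c mult.assoc)
    also have "\<dots> = m b * complement_prod b" by (simp only: \<mu>[OF b] sum_distrib_right)
    finally show "(\<Sum>a\<in>b. const_poly (\<mu> b a) * complement_prod (b - {a})) = m b * complement_prod b" .
  qed
  finally have z: "(\<Sum>T\<in>n_subsets (n - 1) v. const_poly (\<nu> T) * complement_prod T) = 0" using 0 by simp
  have "\<mu> b a = 0" if "a \<in> b" for a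
    using line_complement_indep[OF nv' z gT, of "(b, a)"] \<nu>[of "(b, a)"] that b by simp
  thus ?thesis using \<mu>[OF b] by simp
qed

lemma complement_prod_span_B:
  assumes f: "homogeneous (int v - int n) f" "\<And>s. s \<in> X - B \<Longrightarrow> poly_eval f (P s) = 0"
  shows "f = (\<Sum>b\<in>B. const_poly (poly_eval f (P b) / poly_eval (complement_prod b) (P b)) * complement_prod b)"
proof -
  have "(\<Sum>s\<in>X. const_poly (poly_eval f (P s) / poly_eval (complement_prod s) (P s)) * complement_prod s)
    = (\<Sum>b\<in>B. const_poly (poly_eval f (P b) / poly_eval (complement_prod b) (P b)) * complement_prod b)"
    using B_sub f(2) by (intro sum.mono_neutral_right) auto
  thus ?thesis using complement_prod_span[OF f(1)] by simp
qed

text \<open>In degree \<open>v - n - 1\<close> each \<open>x\<^sub>a f\<close> is a combination of the products for the blocks, and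
  \<open>x\<^sub>c (x\<^sub>a f) = x\<^sub>a (x\<^sub>c f)\<close> is a linear syzygy between them.\<close>

lemma vanishing_degree_zero:
  assumes "homogeneous (int v - int n - 1 - int k) f" "\<And>s. s \<in> X - B \<Longrightarrow> poly_eval f (P s) = 0"
  shows "f = 0"
  using assms
proof (induction k arbitrary: f)
  case 0
  define \<gamma> where "\<gamma> b = poly_eval f (P b) / poly_eval (complement_prod b) (P b)" for b
  have vf: "var a * f = (\<Sum>b\<in>B. const_poly (P b a * \<gamma> b) * complement_prod b)" for a
  proof -
    have "var a * f = (\<Sum>b\<in>B. const_poly (poly_eval (var a * f) (P b) / poly_eval (complement_prod b) (P b)) * complement_prod b)"
    proof (rule complement_prod_span_B)
      show "homogeneous (int v - int n) (var a * f)"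
        using homogeneous_mult[OF homogeneous_var 0(1), of a] by simp
    qed (simp add: poly_eval_simps 0(2)[unfolded poly_eval_peval])
    thus ?thesis by (simp add: poly_eval_simps \<gamma>_def)
  qed
  have z: "P b a * \<gamma> b = 0" if b: "b \<in> B" for b a
  proof -
    \<comment> \<open>A second variable \<open>a'\<close> exists as \<open>0 < n\<close>; its
      coefficient in the syzygy below is \<open>P b a * \<gamma> b\<close>.\<close>
    have "2 \<le> CARD('i)" using dim n_pos by simp
    then obtain Q :: "'i set" where "card Q = 2"
    by (rule obtain_subset_with_card_n) (rule that)
    then obtain a' where a': "a' \<noteq> a" unfolding card_2_iff by metis
    let ?m = "\<lambda>b. const_poly (P b a * \<gamma> b) * var a' - const_poly (P b a' * \<gamma> b) * var a"
    have "(\<Sum>b\<in>B. ?m b * complement_prod b) = var a' * (\<Sum>b\<in>B. const_poly (P b a * \<gamma> b) * complement_prod b)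
        - var a * (\<Sum>b\<in>B. const_poly (P b a' * \<gamma> b) * complement_prod b)"
      unfolding sum_distrib_left sum_subtractf[symmetric]
      by (intro sum.cong refl) (simp only: left_diff_distrib, simp only: mult_ac)
    also have "\<dots> = 0" unfolding vf[symmetric] by (simp add: mult.left_commute)
    finally have "?m b = 0"
      by (intro no_linear_syzygies[of ?m] b homogeneous_diff homogeneous_const_mult homogeneous_var)
    hence "lk (?m b) (unitm a') = 0" by simp
    thus ?thesis using a' by (simp add: lookup_minus var_def lookup_single when_def)
  qed
  obtain a :: 'i where True by blast
  have "var a * f = 0" unfolding vf by (intro sum.neutral ballI) (simp only: z const_poly_0 mult_zero_left)
  thus ?case by (rule var_mult_eq_0)
next
  \<comment> \<open>Multiplication by a variable is injective and moves f one degree closer to the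
    case already done.\<close>
  case (Suc k)
  obtain a :: 'i where True by blast
  have "var a * f = 0"
  proof (rule Suc.IH)
    show "homogeneous (int v - int n - 1 - int k) (var a * f)"
      using homogeneous_mult[OF homogeneous_var Suc.prems(1), of a] by (simp add: algebra_simps)
  qed (use Suc.prems(2) in \<open>simp add: poly_eval_simps\<close>)
  thus ?case by (rule var_mult_eq_0)
qed

end

subsection \<open>Matrix resolutions and graded pieces\<close>

text \<open>Turns the vectors in the definition of a resolution into functions extended by 0, the
  form in which free modules are handled above.\<close>

definition vec_fun :: "nat \<Rightarrow> 'r vec \<Rightarrow> nat \<Rightarrow> 'r::comm_ring_1" where
  "vec_fun k w = (\<lambda>q. if q < k then w $ q else 0)"

definition supp_below :: "nat \<Rightarrow> (nat \<Rightarrow> 'r::zero) set" where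
  "supp_below k = {u. \<forall>q\<ge>k. u q = 0}"

lemma vec_fun_image: "vec_fun k ` (carrier_vec k :: 'r::comm_ring_1 vec set) = supp_below k"
proof
  show "(supp_below k :: (nat \<Rightarrow> 'r) set) \<subseteq> vec_fun k ` carrier_vec k"
  proof
    fix u :: "nat \<Rightarrow> 'r" assume "u \<in> supp_below k"
    hence "u = vec_fun k (vec k u)" by (auto simp: supp_below_def vec_fun_def fun_eq_iff)
    thus "u \<in> vec_fun k ` carrier_vec k" by (rule image_eqI) simp
  qed
qed (auto simp: supp_below_def vec_fun_def)

lemma inj_vec_fun: "inj_on (vec_fun k) (carrier_vec k)"
proof (rule inj_onI)
  fix x y :: "'a vec" assume xy: "x \<in> carrier_vec k" "y \<in> carrier_vec k" "vec_fun k x = vec_fun k y"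
  show "x = y"
  proof (rule eq_vecI)
    fix i assume "i < dim_vec y"
    thus "x $ i = y $ i" using fun_cong[OF xy(3), of i] xy(2) by (simp add: vec_fun_def)
  qed (use xy in auto)
qed

lemma vec_fun_mult:
  assumes "D \<in> carrier_mat m k" "w \<in> carrier_vec k"
  shows "vec_fun m (D *\<^sub>v w) = mat_app (\<lambda>p q. D $$ (p, q)) m k (vec_fun k w)"
  using assms by (auto simp: vec_fun_def mat_app_def scalar_prod_def atLeast0LessThan fun_eq_iff intro!: sum.cong)

lemma mat_app_supp_below: "mat_app A m k u \<in> supp_below m"
  by (simp add: mat_app_def supp_below_def)

lemma vec_fun_image_mult:
  assumes "D \<in> carrier_mat m k"
  shows "vec_fun m ` {D *\<^sub>v w | w. w \<in> carrier_vec k} = mat_app (\<lambda>p q. D $$ (p, q)) m k ` supp_below k"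
proof -
  have "vec_fun m ` {D *\<^sub>v w | w. w \<in> carrier_vec k} = (\<lambda>w. vec_fun m (D *\<^sub>v w)) ` carrier_vec k" by auto
  also have "\<dots> = (\<lambda>w. mat_app (\<lambda>p q. D $$ (p, q)) m k (vec_fun k w)) ` carrier_vec k"
    using vec_fun_mult[OF assms] by (intro image_cong) auto
  finally show ?thesis by (simp add: image_image flip: vec_fun_image)
qed

lemma vec_fun_image_kernel:
  assumes "D \<in> carrier_mat m k"
  shows "vec_fun k ` {u \<in> carrier_vec k. D *\<^sub>v u = 0\<^sub>v m} = {u \<in> supp_below k. mat_app (\<lambda>p q. D $$ (p, q)) m k u = 0}"
proof -
  have z: "vec_fun m (0\<^sub>v m) = 0" by (auto simp: vec_fun_def)
  have "D *\<^sub>v w = 0\<^sub>v m \<longleftrightarrow> mat_app (\<lambda>p q. D $$ (p, q)) m k (vec_fun k w) = 0" if "w \<in> carrier_vec k" for w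
  proof -
    have "D *\<^sub>v w = 0\<^sub>v m \<longleftrightarrow> vec_fun m (D *\<^sub>v w) = vec_fun m (0\<^sub>v m)"
      using inj_on_eq_iff[OF inj_vec_fun, of "D *\<^sub>v w" m "0\<^sub>v m"] assms that by auto
    thus ?thesis unfolding vec_fun_mult[OF assms that] z .
  qed
  thus ?thesis unfolding vec_fun_image[symmetric] by blast
qed

lemma exact_iff:
  assumes "D \<in> carrier_mat m k" "D' \<in> carrier_mat k k'"
  shows "{D' *\<^sub>v w | w. w \<in> carrier_vec k'} = {u \<in> carrier_vec k. D *\<^sub>v u = 0\<^sub>v m} \<longleftrightarrow>
    mat_app (\<lambda>p q. D' $$ (p, q)) k k' ` supp_below k' = {u \<in> supp_below k. mat_app (\<lambda>p q. D $$ (p, q)) m k u = 0}"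
proof -
  have "{D' *\<^sub>v w | w. w \<in> carrier_vec k'} \<subseteq> carrier_vec k" using assms by auto
  moreover have "{u \<in> carrier_vec k. D *\<^sub>v u = 0\<^sub>v m} \<subseteq> carrier_vec k" by auto
  ultimately show ?thesis
    unfolding vec_fun_image_mult[OF assms(2), symmetric] vec_fun_image_kernel[OF assms(1), symmetric]
    by (rule inj_on_image_eq_iff[OF inj_vec_fun, symmetric])
qed

lemma augmentation_iff:
  assumes "D \<in> carrier_mat 1 k"
  shows "{(D *\<^sub>v w) $ 0 | w. w \<in> carrier_vec k} = I \<longleftrightarrow>
    mat_app (\<lambda>p q. D $$ (p, q)) 1 k ` supp_below k = {u \<in> supp_below 1. u 0 \<in> I}"
proof -
  let ?S = "mat_app (\<lambda>p q. D $$ (p, q)) 1 k ` supp_below k"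
  have "{(D *\<^sub>v w) $ 0 | w. w \<in> carrier_vec k} = (\<lambda>u. u 0) ` vec_fun 1 ` {D *\<^sub>v w | w. w \<in> carrier_vec k}"
    by (auto simp: vec_fun_def image_iff) blast+
  hence e: "{(D *\<^sub>v w) $ 0 | w. w \<in> carrier_vec k} = (\<lambda>u. u 0) ` ?S"
    by (simp only: vec_fun_image_mult[OF assms])
  have sub: "?S \<subseteq> supp_below 1" using mat_app_supp_below by blast
  have eq: "u = u'" if "u \<in> supp_below 1" "u' \<in> supp_below 1" "u 0 = u' 0" for u u' :: "nat \<Rightarrow> 'a"
  proof
    fix q show "u q = u' q" using that by (cases "q = 0") (auto simp: supp_below_def)
  qed
  show ?thesis
  proof
    assume I: "{(D *\<^sub>v w) $ 0 | w. w \<in> carrier_vec k} = I"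
    show "?S = {u \<in> supp_below 1. u 0 \<in> I}"
    proof
      show "?S \<subseteq> {u \<in> supp_below 1. u 0 \<in> I}" using sub I e by blast
      show "{u \<in> supp_below 1. u 0 \<in> I} \<subseteq> ?S"
      proof
        fix u assume "u \<in> {u \<in> supp_below 1. u 0 \<in> I}"
        then obtain u' where "u' \<in> ?S" "u 0 = u' 0" "u \<in> supp_below 1" using I e by auto
        thus "u \<in> ?S" using eq[of u u'] sub by auto
      qed
    qed
  next
    assume S: "?S = {u \<in> supp_below 1. u 0 \<in> I}"
    have "(\<lambda>q. if q = 0 then f else 0) \<in> ?S" if "f \<in> I" for f
      unfolding S using that by (simp add: supp_below_def)
    from imageI[OF this, of _ "\<lambda>u. u 0"] have "f \<in> (\<lambda>u. u 0) ` ?S" if "f \<in> I" for f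
      using that by simp
    thus "{(D *\<^sub>v w) $ 0 | w. w \<in> carrier_vec k} = I" unfolding e using S by blast
  qed
qed

text \<open>The definition of a resolution speaks of whole modules, covers speak of graded pieces.
  For a map of degree 0 and a graded submodule M the two agree, since elements and their preimages
  can be cut into components.\<close>

lemma graded_image_iff:
  assumes hm: "graded_mat a a' A" and gs: "graded_sub a K"
    and M: "\<And>u. u \<in> M \<longleftrightarrow> u \<in> supp_below (length a) \<and> (\<forall>d. vec_part a d u \<in> K d)"
  shows "mat_app A (length a) (length a') ` supp_below (length a') = M \<longleftrightarrow>
    (\<forall>d. K d = mat_app A (length a) (length a') ` free_piece a' d)"
proof -
  let ?mat_app = "mat_app A (length a) (length a')"
  have Kh: "K d \<subseteq> free_piece a d" for d using gs by (simp add: graded_sub_def)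
  have sub: "free_piece a' d \<subseteq> supp_below (length a')" for d by (auto simp: free_piece_def supp_below_def)
  have KM: "u \<in> K d \<longleftrightarrow> u \<in> M \<and> u \<in> free_piece a d" for u d
  proof
    assume u: "u \<in> K d"
    hence uh: "u \<in> free_piece a d" using Kh by blast
    have "vec_part a e u \<in> K e" for e
      using u graded_sub_0[OF gs] by (auto simp: vec_part_free_piece_eq[OF uh] simp del: zero_fun_apply)
    thus "u \<in> M \<and> u \<in> free_piece a d" using uh M by (auto simp: free_piece_def supp_below_def)
  next
    assume u: "u \<in> M \<and> u \<in> free_piece a d"
    hence "vec_part a d u \<in> K d" using M by blast
    thus "u \<in> K d" using u vec_part_free_piece_eq[of u a d d] by simp
  qed
  show ?thesis
  proof
    assume S: "?mat_app ` supp_below (length a') = M"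
    show "\<forall>d. K d = ?mat_app ` free_piece a' d"
    proof (intro allI equalityI subsetI)
      fix d y assume "y \<in> K d"
      hence y: "y \<in> M" "y \<in> free_piece a d" by (auto simp: KM)
      have "y \<in> ?mat_app ` supp_below (length a')" unfolding S by (rule y(1))
      then obtain w where "y = ?mat_app w" by (rule imageE)
      hence "y = ?mat_app (vec_part a' d w)" using mat_app_vec_part[OF hm] vec_part_free_piece_eq[OF y(2), of d] by simp
      thus "y \<in> ?mat_app ` free_piece a' d" using vec_part_free_piece by blast
    next
      fix d y assume "y \<in> ?mat_app ` free_piece a' d"
      then obtain w where w: "y = ?mat_app w" "w \<in> free_piece a' d" by (rule imageE)
      have "y \<in> M" unfolding S[symmetric] w(1) using w(2) sub by blast
      thus "y \<in> K d" using mat_app_free_piece[OF hm w(2)] w(1) by (simp add: KM)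
    qed
  next
    assume K: "\<forall>d. K d = ?mat_app ` free_piece a' d"
    show "?mat_app ` supp_below (length a') = M"
    proof (intro equalityI subsetI)
      fix y assume "y \<in> ?mat_app ` supp_below (length a')"
      then obtain w where w: "y = ?mat_app w" by (rule imageE)
      have "vec_part a d y \<in> K d" for d
        unfolding K[rule_format] w mat_app_vec_part[OF hm, symmetric] using vec_part_free_piece by blast
      thus "y \<in> M" using M mat_app_supp_below w by blast
    next
      fix y assume y: "y \<in> M"
      have "\<forall>d. \<exists>w. w \<in> free_piece a' d \<and> ?mat_app w = vec_part a d y"
      proof
        fix d
        have "vec_part a d y \<in> ?mat_app ` free_piece a' d" using y M K by blast
        thus "\<exists>w. w \<in> free_piece a' d \<and> ?mat_app w = vec_part a d y" by (auto simp only: image_iff)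
      qed
      from choice[OF this] obtain w where w: "\<And>d. w d \<in> free_piece a' d" "\<And>d. ?mat_app (w d) = vec_part a d y" by blast
      have "\<And>q. length a \<le> q \<Longrightarrow> y q = 0" using y M by (auto simp: supp_below_def)
      then obtain E where E: "finite E" "y = (\<Sum>d\<in>E. vec_part a d y)" by (rule sum_vec_part)
      have "y = ?mat_app (\<Sum>d\<in>E. w d)" unfolding mat_app_sum w(2) by (rule E(2))
      moreover have "(\<Sum>d\<in>E. w d) \<in> supp_below (length a')"
        using w(1) sub by (fastforce simp: supp_below_def sum_fun_apply intro!: sum.neutral)
      ultimately show "y \<in> ?mat_app ` supp_below (length a')" by blast
    qed
  qed
qed

lemma graded_kernel_iff:
  assumes hm: "graded_mat a a' A"
  shows "u \<in> {u \<in> supp_below (length a'). mat_app A (length a) (length a') u = 0} \<longleftrightarrow>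
    u \<in> supp_below (length a') \<and> (\<forall>d. vec_part a' d u \<in> {u \<in> free_piece a' d. mat_app A (length a) (length a') u = 0})"
proof -
  let ?y = "mat_app A (length a) (length a') u"
  have v: "mat_app A (length a) (length a') (vec_part a' d u) = vec_part a d ?y" for d by (rule mat_app_vec_part[OF hm])
  have "?y = 0 \<longleftrightarrow> (\<forall>d. vec_part a d ?y = 0)"
  proof
    assume "?y = 0"
    thus "\<forall>d. vec_part a d ?y = 0" by (auto simp: vec_part_def)
  next
    assume z: "\<forall>d. vec_part a d ?y = 0"
    have "\<And>q. length a \<le> q \<Longrightarrow> ?y q = 0" by (simp add: mat_app_def)
    then obtain E where "finite E" "?y = (\<Sum>d\<in>E. vec_part a d ?y)" by (rule sum_vec_part)
    thus "?y = 0" using z by (simp only: sum.neutral_const)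
  qed
  thus ?thesis using vec_part_free_piece[of a' _ u] by (simp only: mem_Collect_eq v) blast
qed

text \<open>The constant term is the value at the origin.\<close>

lemma lookup_mult_0: "lk (p * q) 0 = lk p 0 * lk (q :: ('i::finite, 'k::field) mpoly) 0"
proof -
  have e: "poly_eval p (\<lambda>_. 0) = lk p 0" for p :: "('i, 'k) mpoly"
  proof -
    have "(\<Prod>i\<in>UNIV. (0::'k) ^ lk m i) = (if m = 0 then 1 else 0)" for m :: "'i \<Rightarrow>\<^sub>0 nat"
    proof (cases "m = 0")
      case False
      then obtain i where "lk m i \<noteq> 0" by (metis lookup_zero poly_mapping_eqI)
      hence "\<exists>i. (0::'k) ^ lk m i = 0" by (metis neq0_conv zero_power)
      thus ?thesis using False by (auto intro: prod_zero)
    qed simp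
    hence "poly_eval p (\<lambda>_. 0) = (\<Sum>m\<in>Poly_Mapping.keys p. if m = 0 then lk p m else 0)"
      unfolding poly_eval_def by (intro sum.cong) auto
    thus ?thesis by (simp add: in_keys_iff)
  qed
  show ?thesis unfolding e[symmetric] by (simp add: poly_eval_simps)
qed

lemma mat_app_unit_vec:
  assumes "p < m" "q < k"
  shows "mat_app A m k (\<lambda>q'. if q' = q then 1 else 0) p = A p q"
  using assms by (simp add: mat_app_def if_distrib cong: if_cong)

text \<open>The entries of the matrix are the coordinates of the images of the basis vectors, and
  constant terms are multiplicative.\<close>

lemma minimal_iff:
  fixes A :: "nat \<Rightarrow> nat \<Rightarrow> ('i::finite, 'k::field) mpoly"
  assumes hm: "graded_mat a a' A" and K: "\<And>d. K d = mat_app A (length a) (length a') ` free_piece a' d"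
  shows "(\<forall>p<length a. \<forall>q<length a'. lk (A p q) 0 = 0) \<longleftrightarrow> (\<forall>d. \<forall>u\<in>K d. \<forall>p. lk (u p) 0 = 0)"
proof
  assume "\<forall>p<length a. \<forall>q<length a'. lk (A p q) 0 = 0"
  thus "\<forall>d. \<forall>u\<in>K d. \<forall>p. lk (u p) 0 = 0"
    by (auto simp: K mat_app_def lookup_sum lookup_mult_0)
next
  assume R: "\<forall>d. \<forall>u\<in>K d. \<forall>p. lk (u p) 0 = 0"
  show "\<forall>p<length a. \<forall>q<length a'. lk (A p q) 0 = 0"
  proof (intro allI impI)
    fix p q assume pq: "p < length a" "q < length a'"
    have "mat_app A (length a) (length a') (\<lambda>q'. if q' = q then 1 else 0) \<in> K (a' ! q)"
      unfolding K by (intro imageI unit_vec_free_piece pq(2))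
    from R[rule_format, OF this, of p] show "lk (A p q) 0 = 0"
      by (simp add: mat_app_unit_vec[OF pq])
  qed
qed

text \<open>The ideal counts as syzygy module 0, so the module with index i is covered by
  \<open>G (Suc i)\<close>; this is the shift between resolving R/I and resolving I.\<close>

fun syzygy_pieces :: "('i::finite, 'k::field) mpoly set \<Rightarrow> (nat \<Rightarrow> int list) \<Rightarrow>
    (nat \<Rightarrow> nat \<Rightarrow> nat \<Rightarrow> ('i, 'k) mpoly) \<Rightarrow> nat \<Rightarrow> int \<Rightarrow> (nat \<Rightarrow> ('i, 'k) mpoly) set" where
  "syzygy_pieces I G A 0 d = {u \<in> free_piece [0] d. u 0 \<in> I}"
| "syzygy_pieces I G A (Suc i) d =
    {u \<in> free_piece (G (Suc i)) d. mat_app (A i) (length (G i)) (length (G (Suc i))) u = 0}"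

lemma minimal_resolution_iff:
  fixes I :: "('i::finite, 'k::field) mpoly set"
  assumes gs: "graded_sub [0] (\<lambda>d. {u \<in> free_piece [0] d. u 0 \<in> I})"
    and I: "\<And>f. f \<in> I \<longleftrightarrow> (\<forall>d. hom_part d f \<in> I)"
  shows "minimal_graded_free_resolution I G D \<longleftrightarrow> G 0 = [0] \<and>
    (\<forall>i. D i \<in> carrier_mat (length (G i)) (length (G (Suc i)))) \<and>
    cover_resolution G (\<lambda>i p q. D i $$ (p, q)) (syzygy_pieces I G (\<lambda>i p q. D i $$ (p, q)))"
proof -
  let ?A = "\<lambda>i p q. D i $$ (p, q)" and ?l = "\<lambda>i. length (G i)"
  let ?K = "syzygy_pieces I G ?A"
  have K0: "?K 0 = (\<lambda>d. {u \<in> free_piece [0] d. u 0 \<in> I})" by (rule ext) simp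
  have nat_split: "(\<forall>i. Q i) \<longleftrightarrow> Q 0 \<and> (\<forall>i. Q (Suc i))" for Q :: "nat \<Rightarrow> bool"
    by (metis nat.exhaust)
  show ?thesis
  \<comment> \<open>The translations below presuppose graded matrices of the right sizes; without
    these both sides fail.\<close>
  proof (cases "G 0 = [0] \<and> (\<forall>i. D i \<in> carrier_mat (?l i) (?l (Suc i))) \<and> (\<forall>i. graded_mat (G i) (G (Suc i)) (?A i))")
    case False
    thus ?thesis
      unfolding minimal_graded_free_resolution_def graded_free_resolution_def cover_resolution_def min_cover_def graded_mat_def
      by meson
  next
    case True
    hence G0: "G 0 = [0]" and D: "\<And>i. D i \<in> carrier_mat (?l i) (?l (Suc i))"
      and hm: "\<And>i. graded_mat (G i) (G (Suc i)) (?A i)" by auto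
    have D0: "D 0 \<in> carrier_mat 1 (?l 1)" using D[of 0] G0 by simp
    have "u \<in> {u \<in> supp_below 1. u 0 \<in> I} \<longleftrightarrow> u \<in> supp_below (length [0::int]) \<and> (\<forall>d. vec_part [0] d u \<in> ?K 0 d)" for u
    proof -
      have "u 0 \<in> I \<longleftrightarrow> (\<forall>d. vec_part [0] d u \<in> ?K 0 d)"
        by (subst I) (simp add: vec_part_free_piece, simp add: vec_part_def)
      thus ?thesis by simp
    qed
    hence gi: "mat_app (?A 0) (length [0::int]) (?l 1) ` supp_below (?l 1) = {u \<in> supp_below 1. u 0 \<in> I} \<longleftrightarrow>
      (\<forall>d. ?K 0 d = mat_app (?A 0) (length [0::int]) (?l 1) ` free_piece (G 1) d)"
      by (intro graded_image_iff) (use hm[of 0] gs G0 in \<open>simp_all only: K0 One_nat_def\<close>)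
    have img0: "{(D 0 *\<^sub>v w) $ 0 | w. w \<in> carrier_vec (?l 1)} = I \<longleftrightarrow>
      (\<forall>d. ?K 0 d = mat_app (?A 0) (?l 0) (?l 1) ` free_piece (G 1) d)"
      unfolding augmentation_iff[OF D0] using gi by (simp only: G0 list.size One_nat_def add_0)
    have img: "{D (Suc i) *\<^sub>v w | w. w \<in> carrier_vec (?l (Suc (Suc i)))} =
        {u \<in> carrier_vec (?l (Suc i)). D i *\<^sub>v u = 0\<^sub>v (?l i)} \<longleftrightarrow>
      (\<forall>d. ?K (Suc i) d = mat_app (?A (Suc i)) (?l (Suc i)) (?l (Suc (Suc i))) ` free_piece (G (Suc (Suc i))) d)" for i
      unfolding exact_iff[OF D[of i] D[of "Suc i"]]
      by (rule graded_image_iff[OF hm]) (simp_all only: syzygy_pieces.simps graded_sub_syz graded_kernel_iff[OF hm])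
    have res: "graded_free_resolution I G D \<longleftrightarrow> (\<forall>i d. ?K i d = mat_app (?A i) (?l i) (?l (Suc i)) ` free_piece (G (Suc i)) d)"
      (is "_ \<longleftrightarrow> ?E")
    proof -
      have "graded_free_resolution I G D \<longleftrightarrow> {(D 0 *\<^sub>v w) $ 0 | w. w \<in> carrier_vec (?l 1)} = I \<and>
        (\<forall>i. {D (Suc i) *\<^sub>v w | w. w \<in> carrier_vec (?l (Suc (Suc i)))} =
        {u \<in> carrier_vec (?l (Suc i)). D i *\<^sub>v u = 0\<^sub>v (?l i)})"
        using True unfolding graded_free_resolution_def graded_mat_def by simp
      also have "\<dots> \<longleftrightarrow> ?E"
        unfolding img0 img unfolding One_nat_def
        by (rule nat_split[of "\<lambda>i. \<forall>d. ?K i d = mat_app (?A i) (?l i) (?l (Suc i)) ` free_piece (G (Suc i)) d", symmetric])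
      finally show ?thesis .
    qed
    have mini: "(\<forall>p<?l (Suc i). \<forall>q<?l (Suc (Suc i)). lk (D (Suc i) $$ (p, q)) 0 = 0) \<longleftrightarrow>
      (\<forall>d. \<forall>u\<in>?K (Suc i) d. \<forall>p. lk (u p) 0 = 0)" if ?E for i
      by (rule minimal_iff[OF hm that[THEN spec, THEN spec]])
    have "minimal_graded_free_resolution I G D \<longleftrightarrow> ?E \<and> (\<forall>i d. \<forall>u\<in>?K (Suc i) d. \<forall>p. lk (u p) 0 = 0)"
      unfolding minimal_graded_free_resolution_def res
    proof (rule conj_cong[OF refl])
      assume ?E
      show "(\<forall>i. \<forall>p<?l (Suc i). \<forall>q<?l (Suc (Suc i)). lk (D (Suc i) $$ (p, q)) 0 = 0) \<longleftrightarrow>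
        (\<forall>i d. \<forall>u\<in>?K (Suc i) d. \<forall>p. lk (u p) 0 = 0)"
        unfolding mini[OF \<open>?E\<close>] ..
    qed
    also have "\<dots> \<longleftrightarrow> cover_resolution G ?A ?K"
    proof -
      have "\<forall>i. graded_mat (G i) (G (Suc i)) (?A i)" using hm by (rule allI)
      moreover have "\<forall>i d. ?K (Suc i) d = {u \<in> free_piece (G (Suc i)) d. mat_app (?A i) (?l i) (?l (Suc i)) u = 0}"
        by simp
      ultimately show ?thesis
        unfolding cover_resolution_def min_cover_def all_conj_distrib
        by - (rule iffI; elim conjE; intro conjI; assumption)
    qed
    finally have "minimal_graded_free_resolution I G D \<longleftrightarrow> cover_resolution G ?A ?K" .
    moreover have "\<forall>i. D i \<in> carrier_mat (?l i) (?l (Suc i))" using D by (rule allI)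
    ultimately show ?thesis using G0 by (simp only: simp_thms)
  qed
qed

lemma minimal_resolution_exists:
  fixes I :: "('i::finite, 'k::field) mpoly set"
  assumes gs: "graded_sub [0] (\<lambda>d. {u \<in> free_piece [0] d. u 0 \<in> I})"
    and I: "\<And>f. f \<in> I \<longleftrightarrow> (\<forall>d. hom_part d f \<in> I)"
    and van: "\<And>p j. r + 2 + int p \<le> j \<Longrightarrow> koszul_vanishes (\<lambda>d. {u \<in> free_piece [0] d. u 0 \<in> I}) p j"
  shows "\<exists>G D. minimal_graded_free_resolution I G D"
proof -
  let ?K0 = "\<lambda>d. {u \<in> free_piece [0] d. u 0 \<in> I}"
  have low: "?K0 d \<subseteq> {0}" if "d < 0" for d
  proof
    fix u assume "u \<in> ?K0 d"
    hence "homogeneous d (u 0)" "\<And>q. q \<noteq> 0 \<Longrightarrow> u q = 0" by (auto simp: free_piece_def)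
    hence "u q = 0" for q using homogeneous_neg[OF _ that] by (cases "q = 0") auto
    thus "u \<in> {0}" by auto
  qed
  obtain a A K where a: "a 0 = [0]" "K 0 = ?K0" "cover_resolution a A K"
    by (rule cover_resolution_exists[OF gs low van])
  let ?D = "\<lambda>i. mat (length (a i)) (length (a (Suc i))) (\<lambda>(p, q). A i p q)"
  let ?A = "\<lambda>i p q. ?D i $$ (p, q)"
  have appA: "mat_app (?A i) (length (a i)) (length (a (Suc i))) = mat_app (A i) (length (a i)) (length (a (Suc i)))" for i
    by (intro ext) (simp add: mat_app_def)
  have hmA: "graded_mat (a i) (a (Suc i)) (?A i) \<longleftrightarrow> graded_mat (a i) (a (Suc i)) (A i)" for i
    by (simp add: graded_mat_def)
  have K: "K i = syzygy_pieces I a ?A i" for i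
  proof (cases i)
    case 0
    thus ?thesis using a by auto
  next
    case (Suc j)
    have "min_cover (a j) (a (Suc j)) (A j) (K j) (K (Suc j))" using a(3) by (simp add: cover_resolution_def)
    thus ?thesis unfolding Suc min_cover_def by (intro ext) (simp only: syzygy_pieces.simps appA)
  qed
  have "cover_resolution a ?A K" using a(3) unfolding cover_resolution_def min_cover_def appA hmA .
  moreover have "K = syzygy_pieces I a ?A" by (rule ext) (rule K)
  ultimately have "cover_resolution a ?A (syzygy_pieces I a ?A)" by (simp only:)
  hence "minimal_graded_free_resolution I a ?D"
    unfolding minimal_resolution_iff[OF gs I] using a(1) by simp
  thus ?thesis by blast
qed

subsection \<open>Iterated differences\<close>

text \<open>Differences look backwards only, so a formula for the Hilbert function valid up to
  degree j suffices at j.\<close>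

lemma backward_diff_cong:
  assumes "\<And>d. d \<le> j \<Longrightarrow> g d = g' d"
  shows "(backward_diff ^^ k) g j = (backward_diff ^^ k) g' j"
  using assms
proof (induction k arbitrary: j)
  case (Suc k)
  show ?case using Suc.IH[of j] Suc.IH[of "j - 1"] Suc.prems by (simp add: backward_diff_def)
qed simp

lemma backward_diff_diff:
  "(backward_diff ^^ k) (\<lambda>d. f d - g d) j = (backward_diff ^^ k) f j - (backward_diff ^^ k) g j"
  by (induction k arbitrary: j) (simp_all add: backward_diff_def)

lemma backward_diff_0: "(backward_diff ^^ k) (\<lambda>d. 0) j = 0"
  by (induction k arbitrary: j) (simp_all add: backward_diff_def)

lemma backward_diff_add:
  "(backward_diff ^^ k) (\<lambda>d. f d + g d) j = (backward_diff ^^ k) f j + (backward_diff ^^ k) g j"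
  by (induction k arbitrary: j) (simp_all add: backward_diff_def)

lemma backward_diff_mult:
  "(backward_diff ^^ k) (\<lambda>d. c * f d) j = c * (backward_diff ^^ k) f j"
  by (induction k arbitrary: j) (simp_all add: backward_diff_def algebra_simps)

lemma backward_diff_sum:
  "(backward_diff ^^ k) (\<lambda>d. \<Sum>x\<in>S. f x d) j = (\<Sum>x\<in>S. (backward_diff ^^ k) (f x) j)"
  by (induction S rule: infinite_finite_induct) (simp_all add: backward_diff_0 backward_diff_add)

lemma backward_diff_sum_list:
  "(backward_diff ^^ k) (\<lambda>d. \<Sum>x\<leftarrow>xs. f x d) j = (\<Sum>x\<leftarrow>xs. (backward_diff ^^ k) (f x) j)"
  by (induction xs) (simp_all add: backward_diff_0 backward_diff_add)

lemma backward_diff_shift: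
  "(backward_diff ^^ k) (\<lambda>d. f (d - b)) j = (backward_diff ^^ k) f (j - b)"
  by (induction k arbitrary: j) (simp_all add: backward_diff_def algebra_simps)

text \<open>The Hilbert series of R is the inverse of the (n + 1)-st power of 1 - t; by Pascal's
  rule each difference removes one variable.\<close>

lemma backward_diff_piece_dim: "(backward_diff ^^ Suc n) (piece_dim n) j = (if j = 0 then 1 else 0)"
proof (induction n)
  case 0
  show ?case by (auto simp: backward_diff_def piece_dim_def)
next
  case (Suc n)
  have "backward_diff (piece_dim (Suc n)) = piece_dim n"
  proof
    fix e
    consider "e < 0" | "e = 0" | m where "e = int (Suc m)"
      by (metis linorder_cases nonneg_int_cases less_imp_le not0_implies_Suc of_nat_0 order_less_irrefl)
    thus "backward_diff (piece_dim (Suc n)) e = piece_dim n e"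
    proof cases
      case 3
      hence "nat e = Suc m" "nat (e - 1) = m" by simp_all
      thus ?thesis using 3 by (simp add: backward_diff_def piece_dim_def)
    qed (auto simp: backward_diff_def piece_dim_def)
  qed
  thus ?case using Suc.IH by (simp only: funpow_Suc_right[of "Suc n"] o_apply)
qed

lemma sum_list_indicator: "(\<Sum>b\<leftarrow>xs. if j - b = 0 then 1 else 0) = int (count_list xs (j :: int))"
  by (induction xs) auto

subsection \<open>The ideal of a configuration\<close>

interpretation cp: coeff_hom "const_poly :: 'k \<Rightarrow> ('i::finite, 'k::field) mpoly"
  by unfold_locales (simp_all add: const_poly_add const_poly_mult)

lemma ideal_gen_span: "ideal_gen S = im.span S"
  by (simp add: ideal_gen_def)

lemma hom_part_ideal:
  assumes f: "f \<in> ideal_gen (l ` s)" and lin: "\<And>a. a \<in> s \<Longrightarrow> homogeneous 1 (l a)"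
  shows "hom_part d f \<in> ideal_gen (l ` s)"
  using f unfolding ideal_gen_span
proof (induction rule: im.span_induct_alt)
  case base
  show ?case by (simp add: im.span_zero)
next
  case (step c x y)
  then obtain a where a: "a \<in> s" "x = l a" by blast
  have "hom_part d (c * x) = hom_part (d - 1) c * x"
    using hom_part_mult[OF lin[OF a(1)], of d c] a(2) by (simp add: mult.commute)
  moreover have "hom_part (d - 1) c * x \<in> im.span (l ` s)"
    using step(1) by (intro im.span_scale im.span_base)
  ultimately show ?case using step(2) by (simp add: hom_part_add im.span_add)
qed

context star_config
begin

text \<open>Modulo the forms of s every variable is a multiple of a single one that is nonzero at
  the point, so f is congruent to its value at a representative of the point times a power of that
  variable. This works over any field.\<close>

lemma mem_point_ideal:
  assumes s: "s \<in> X" and f: "homogeneous d f"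
  shows "f \<in> ideal_gen (l ` s) \<longleftrightarrow> poly_eval f (P s) = 0"
proof
  have "im.subspace {f. poly_eval f (P s) = 0}"
    by (rule im.subspaceI) (auto simp: poly_eval_simps)
  hence "im.span (l ` s) \<subseteq> {f. poly_eval f (P s) = 0}"
    using P_on[OF s] by (intro im.span_minimal) auto
  thus "f \<in> ideal_gen (l ` s) \<Longrightarrow> poly_eval f (P s) = 0" unfolding ideal_gen_span by blast
next
  assume f0: "poly_eval f (P s) = 0"
  obtain c where c: "P s c \<noteq> 0" using P_nonzero[OF s] by auto
  \<comment> \<open>The representative of the point whose coordinate c is 1.\<close>
  define q where "q i = inverse (P s c) * P s i" for i
  let ?J = "im.span (l ` s)"
  have fs: "finite s" and ls: "\<And>a. a \<in> s \<Longrightarrow> homogeneous 1 (l a)" using n_subsetsD[OF s] lin by auto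
  have vJ: "var i - const_poly (q i) * var c \<in> ?J" for i
  proof -
    have "\<exists>\<mu>. var i - const_poly (q i) * var c = (\<Sum>a\<in>s. const_poly (\<mu> a) * l a)"
    proof (rule linear_forms_annihilator[OF fs ls])
      fix x assume "\<And>a. a \<in> s \<Longrightarrow> poly_eval (l a) x = 0"
      then obtain t where "x = (\<lambda>i. t * P s i)" using P_unique[OF s] by blast
      thus "poly_eval (var i - const_poly (q i) * var c) x = 0"
        using c by (simp add: poly_eval_simps q_def)
    qed (auto intro!: homogeneous_diff homogeneous_const_mult)
    then obtain \<mu> where "var i - const_poly (q i) * var c = (\<Sum>a\<in>s. const_poly (\<mu> a) * l a)" by blast
    also have "\<dots> \<in> ?J" by (intro im.span_sum im.span_scale im.span_base) auto
    finally show ?thesis .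
  qed
  let ?\<psi> = "peval const_poly (\<lambda>i. const_poly (q i) * var c) :: ('i, 'k) mpoly \<Rightarrow> ('i, 'k) mpoly"
  have "g - ?\<psi> g \<in> ?J" for g
  proof (induction g rule: mpoly_induct)
    case (add g h)
    have e: "g + h - ?\<psi> (g + h) = (g - ?\<psi> g) + (h - ?\<psi> h)" by (simp add: cp.peval_add)
    show ?case unfolding e by (rule im.span_add[OF add])
  next
    case (mult g h)
    have e: "g * h - ?\<psi> (g * h) = g * (h - ?\<psi> h) + ?\<psi> h * (g - ?\<psi> g)"
      by (simp add: cp.peval_mult algebra_simps)
    show ?case unfolding e by (rule im.span_add[OF im.span_scale[OF mult(2)] im.span_scale[OF mult(1)]])
  qed (simp_all add: vJ im.span_zero)
  moreover have "?\<psi> f = 0"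
  proof -
    have "?\<psi> f = (\<Sum>m\<in>Poly_Mapping.keys f. const_poly (lk f m * (\<Prod>i\<in>UNIV. q i ^ lk m i)) * var c ^ nat d)"
      unfolding peval_def
    proof (intro sum.cong refl)
      fix m assume m: "m \<in> Poly_Mapping.keys f"
      have "(\<Prod>i\<in>UNIV. (const_poly (q i) * var c) ^ lk m i) = const_poly (\<Prod>i\<in>UNIV. q i ^ lk m i) * var c ^ nat d"
        unfolding homogeneous_power_prod[OF f m] const_poly_prod const_poly_power ..
      thus "const_poly (lk f m) * (\<Prod>i\<in>UNIV. (const_poly (q i) * var c) ^ lk m i)
          = const_poly (lk f m * (\<Prod>i\<in>UNIV. q i ^ lk m i)) * var c ^ nat d"
        by (simp only: const_poly_mult mult.assoc)
    qed
    also have "\<dots> = const_poly (poly_eval f q) * var c ^ nat d"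
      by (simp add: poly_eval_def const_poly_sum sum_distrib_right)
    also have "poly_eval f q = 0"
      using poly_eval_scale[OF f, of "inverse (P s c)" "P s"] f0 by (simp add: q_def[abs_def])
    finally show ?thesis by simp
  qed
  ultimately show "f \<in> ideal_gen (l ` s)" unfolding ideal_gen_span by (metis diff_zero)
qed

lemma mem_config_ideal:
  assumes "C \<subseteq> X" "homogeneous d f"
  shows "f \<in> config_ideal l C \<longleftrightarrow> (\<forall>s\<in>C. poly_eval f (P s) = 0)"
  using mem_point_ideal[OF _ assms(2)] assms(1) unfolding config_ideal_def by blast

lemma subspace_config_ideal: "im.subspace (config_ideal l C)"
  unfolding config_ideal_def ideal_gen_span by (intro im.subspace_Int im.subspace_span)

lemma config_ideal_graded:
  assumes "C \<subseteq> X"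
  shows "f \<in> config_ideal l C \<longleftrightarrow> (\<forall>d. hom_part d f \<in> config_ideal l C)"
proof
  have "hom_part d f \<in> ideal_gen (l ` s)" if "f \<in> ideal_gen (l ` s)" "s \<in> C" for d s
    by (rule hom_part_ideal[OF that(1)]) (use that(2) assms n_subsetsD lin in blast)
  thus "f \<in> config_ideal l C \<Longrightarrow> \<forall>d. hom_part d f \<in> config_ideal l C"
    unfolding config_ideal_def by blast
next
  assume "\<forall>d. hom_part d f \<in> config_ideal l C"
  hence "(\<Sum>d\<in>(\<lambda>m. int (mdeg m)) ` Poly_Mapping.keys f. hom_part d f) \<in> config_ideal l C"
    by (intro im.subspace_sum[OF subspace_config_ideal]) auto
  moreover have "(\<Sum>d\<in>(\<lambda>m. int (mdeg m)) ` Poly_Mapping.keys f. hom_part d f) = f"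
    by (rule sum_hom_part) auto
  ultimately show "f \<in> config_ideal l C" by simp
qed

lemma pv_subspace_config_ideal: "pv.subspace (config_ideal l C)"
  using subspace_config_ideal[of C] by (auto simp: im.subspace_def pv.subspace_def)

lemma graded_sub_config_ideal: "graded_sub [0] (\<lambda>d. {u \<in> free_piece [0] d. u 0 \<in> config_ideal l C})"
proof -
  have "poly_scale r u \<in> free_piece [0] (e + d)" if "u \<in> free_piece [0] d" "homogeneous e r" for r u e d
    using that free_piece_mult[of e r u "[0]" d] by (simp add: poly_scale_def)
  thus ?thesis
    using subspace_config_ideal[of C] free_piece_add
    unfolding graded_sub_def im.subspace_def by (auto simp: poly_scale_def simp del: plus_fun_def)
qed

lemma config_piece_eq:
  assumes "C \<subseteq> X"
  shows "{u \<in> free_piece [0] d. u 0 \<in> config_ideal l C} = {u \<in> free_piece [0] d. \<forall>s\<in>C. poly_eval (u 0) (P s) = 0}"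
proof -
  have "homogeneous d (u 0)" if "u \<in> free_piece [0] d" for u :: "nat \<Rightarrow> ('i, 'k) mpoly"
    using free_piece_homogeneous[OF that, of 0] by simp
  thus ?thesis using mem_config_ideal[OF assms] by blast
qed

lemma config_ideal_koszul_vanishes:
  assumes "C \<subseteq> X" "int v - int n + 2 + int p \<le> j"
  shows "koszul_vanishes (\<lambda>d. {u \<in> free_piece [0] d. u 0 \<in> config_ideal l C}) p j"
proof (rule koszul_vanishes_points[of C P "int v - int n"])
  show "\<exists>f. homogeneous d f \<and> (\<forall>s\<in>C. poly_eval f (P s) = u s)" if "int v - int n \<le> d" for d u
    using interpolation[OF that, of u] assms(1) by blast
qed (use assms P_nonzero nv in \<open>auto simp: config_piece_eq[OF assms(1)]\<close>)

end

section \<open>Degrees and counts in an arbitrary minimal resolution\<close>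

context steiner_config
begin

abbreviation "I \<equiv> config_ideal l (X - B)"

lemma initial_degree:
  assumes "d < int v - int n"
  shows "{u \<in> free_piece [0] d. u 0 \<in> I} \<subseteq> {0}"
proof
  fix u assume "u \<in> {u \<in> free_piece [0] d. u 0 \<in> I}"
  hence u: "u \<in> free_piece [0] d" "\<forall>s\<in>X - B. poly_eval (u 0) (P s) = 0"
    unfolding config_piece_eq[OF Diff_subset] by auto
  have d: "int v - int n - 1 - int (nat (int v - int n - 1 - d)) = d" using assms by simp
  have "u 0 = 0"
  proof (rule vanishing_degree_zero)
    show "homogeneous (int v - int n - 1 - int (nat (int v - int n - 1 - d))) (u 0)"
      unfolding d using free_piece_homogeneous[OF u(1), of 0] by simp
  qed (use u(2) in blast)
  hence "u q = 0" for q using free_piece_outside[OF u(1), of q] by (cases "q = 0") auto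
  thus "u \<in> {0}" by auto
qed

lemma dim_initial_piece: "fv.dim {u \<in> free_piece [0] (int v - int n). u 0 \<in> I} = card B"
proof -
  let ?U = "{u \<in> free_piece [0] (int v - int n). u 0 \<in> I}" and ?b = "\<lambda>s. embed (complement_prod s)"
  have "?b ` B \<subseteq> ?U"
  proof (intro subsetI, elim imageE)
    fix y b assume b: "b \<in> B" "y = embed (complement_prod b)"
    hence "poly_eval (complement_prod b) (P s) = 0" if "s \<in> X - B" for s
      using poly_eval_complement_prod[of b s] B_sub that by blast
    thus "y \<in> ?U"
      unfolding config_piece_eq[OF Diff_subset] using b B_sub embed_complement_prod_free_piece[of b] by auto
  qed
  moreover have "?U \<subseteq> fv.span (?b ` B)"
  proof
    fix u assume "u \<in> ?U"
    hence u: "u \<in> free_piece [0] (int v - int n)" "\<forall>s\<in>X - B. poly_eval (u 0) (P s) = 0"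
      unfolding config_piece_eq[OF Diff_subset] by auto
    define c where "c b = poly_eval (u 0) (P b) / poly_eval (complement_prod b) (P b)" for b
    have "u 0 = (\<Sum>b\<in>B. const_poly (c b) * complement_prod b)"
      unfolding c_def by (rule complement_prod_span_B) (use u free_piece_homogeneous[OF u(1), of 0] in auto)
    hence "u q = (\<Sum>b\<in>B. const_scale (c b) (?b b)) q" for q
      using free_piece_outside[OF u(1), of q] by (cases "q = 0") (auto simp: sum_fun_apply const_scale_def embed_def)
    hence "u = (\<Sum>b\<in>B. const_scale (c b) (?b b))" by (rule ext)
    also have "\<dots> \<in> fv.span (?b ` B)" by (intro fv.span_sum fv.span_scale fv.span_base imageI)
    finally show "u \<in> fv.span (?b ` B)" .
  qed
  ultimately have "card (?b ` B) = fv.dim ?U"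
    by (intro fv.basis_card_eq_dim embed_complement_prod_independent B_sub)
  thus ?thesis using card_image[OF inj_on_subset[OF inj_embed_complement_prod B_sub]] by simp
qed

text \<open>In degree v - n the generators of an arbitrary minimal cover are combinations of the
  products for the blocks. A linear syzygy becomes one between these products, hence trivial;
  reading it off variable by variable gives constant relations between the generators, which
  minimality excludes.\<close>

lemma no_linear_strand:
  assumes mc: "min_cover [0] a' A (\<lambda>d. {u \<in> free_piece [0] d. u 0 \<in> I}) K'"
    and a': "\<And>x. x \<in> set a' \<Longrightarrow> int v - int n \<le> x"
  shows "K' (int v - int n + 1) \<subseteq> {0}"
proof
  let ?r = "int v - int n" and ?k = "length a'" and ?K0 = "\<lambda>d. {u \<in> free_piece [0] d. u 0 \<in> I}"
  let ?mat_app = "mat_app A (length [0::int]) ?k"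
  fix u assume uK: "u \<in> K' (?r + 1)"
  have hm: "graded_mat [0] a' A" and K0: "\<And>d. ?K0 d = ?mat_app ` free_piece a' d"
    and K': "\<And>d. K' d = {u \<in> free_piece a' d. ?mat_app u = 0}"
    and mn: "\<And>d u q. u \<in> K' d \<Longrightarrow> lk (u q) 0 = 0"
    using mc by (auto simp: min_cover_def)
  have u: "u \<in> free_piece a' (?r + 1)" "?mat_app u = 0" using uK K' by auto
  have u0: "lk (u q) 0 = 0" for q using mn[OF uK] .
  let ?Q = "{q. q < ?k \<and> a' ! q = ?r}"
  \<comment> \<open>Generators of degree \<open>?r + 1\<close> would enter with constant
    coefficients, excluded by minimality; those of higher degree cannot enter.\<close>
  have out: "u q = 0" if "q \<notin> ?Q" for q
  proof (cases "q < ?k")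
    case True
    hence "a' ! q \<noteq> ?r" "?r \<le> a' ! q" using that a' by auto
    moreover have h: "homogeneous (?r + 1 - a' ! q) (u q)" by (rule free_piece_homogeneous[OF u(1) True])
    ultimately consider "?r + 1 - a' ! q < 0" | "?r + 1 - a' ! q = 0" by linarith
    thus ?thesis
    proof cases
      case 1 thus ?thesis using h homogeneous_neg by blast
    next
      case 2 thus ?thesis using h homogeneous_deg_0[of "u q"] u0[of q] by simp
    qed
  qed (use free_piece_outside[OF u(1)] in auto)
  have lin: "homogeneous 1 (u q)" if "q \<in> ?Q" for q
    using free_piece_homogeneous[OF u(1), of q] that by simp
  have "\<exists>c. A 0 q = (\<Sum>b\<in>B. const_poly (c b) * complement_prod b)" if q: "q \<in> ?Q" for q
  proof -
    let ?e = "\<lambda>q'. if q' = q then 1 else 0"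
    have "?mat_app ?e \<in> ?K0 ?r"
      unfolding K0 using unit_vec_free_piece[of q a'] q by (intro imageI) auto
    moreover have "?mat_app ?e 0 = A 0 q" by (rule mat_app_unit_vec) (use q in auto)
    ultimately have "homogeneous ?r (A 0 q)" "A 0 q \<in> I"
      using free_piece_homogeneous[of "?mat_app ?e" "[0]" ?r 0] by auto
    hence h: "homogeneous ?r (A 0 q)" and z: "\<forall>s\<in>X - B. poly_eval (A 0 q) (P s) = 0"
      using mem_config_ideal[OF Diff_subset] by auto
    show ?thesis by (rule exI) (rule complement_prod_span_B[OF h z[THEN bspec]])
  qed
  hence "\<forall>q\<in>?Q. \<exists>c. A 0 q = (\<Sum>b\<in>B. const_poly (c b) * complement_prod b)" by (rule ballI)
  from bchoice[OF this] obtain c where c: "\<forall>q\<in>?Q. A 0 q = (\<Sum>b\<in>B. const_poly (c q b) * complement_prod b)"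
    by (rule exE)
  have app0: "?mat_app w 0 = (\<Sum>b\<in>B. (\<Sum>q\<in>?Q. const_poly (c q b) * w q) * complement_prod b)"
    if "\<And>q. q \<notin> ?Q \<Longrightarrow> w q = 0" for w
  proof -
    have "?mat_app w 0 = (\<Sum>q<?k. A 0 q * w q)" by (simp add: mat_app_def)
    also have "\<dots> = (\<Sum>q\<in>?Q. A 0 q * w q)"
    proof (intro sum.mono_neutral_right ballI)
      fix q assume "q \<in> {..<?k} - ?Q"
      hence "w q = 0" by (intro that) blast
      thus "A 0 q * w q = 0" by simp
    qed auto
    also have "\<dots> = (\<Sum>q\<in>?Q. \<Sum>b\<in>B. const_poly (c q b) * w q * complement_prod b)"
    proof (intro sum.cong refl)
      fix q assume q: "q \<in> ?Q"
      show "A 0 q * w q = (\<Sum>b\<in>B. const_poly (c q b) * w q * complement_prod b)"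
        unfolding c[THEN bspec, OF q] sum_distrib_right by (intro sum.cong refl) (simp only: mult_ac)
    qed
    also have "\<dots> = (\<Sum>b\<in>B. \<Sum>q\<in>?Q. const_poly (c q b) * w q * complement_prod b)" by (rule sum.swap)
    finally show ?thesis by (simp add: sum_distrib_right)
  qed
  have rel: "(\<Sum>q\<in>?Q. const_poly (c q b) * u q) = 0" if b: "b \<in> B" for b
  proof (rule no_linear_syzygies[OF _ _ b])
    show "homogeneous 1 (\<Sum>q\<in>?Q. const_poly (c q b) * u q)" for b
      using lin by (intro homogeneous_sum homogeneous_const_mult) auto
    show "(\<Sum>b\<in>B. (\<Sum>q\<in>?Q. const_poly (c q b) * u q) * complement_prod b) = 0"
    proof -
      have "?mat_app u 0 = (\<Sum>b\<in>B. (\<Sum>q\<in>?Q. const_poly (c q b) * u q) * complement_prod b)"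
        by (rule app0) (rule out)
      thus ?thesis by (simp only: u(2) zero_fun_apply)
    qed
  qed
  have "lk (u q) (unitm x) = 0" if q: "q \<in> ?Q" for q x
  proof -
    \<comment> \<open>The coefficients of one variable in u form a relation of degree
      \<open>?r\<close> with constant entries.\<close>
    define w :: "nat \<Rightarrow> ('i, 'k) mpoly" where "w q = (if q \<in> ?Q then const_poly (lk (u q) (unitm x)) else 0)" for q
    have "w \<in> free_piece a' ?r" by (auto simp: w_def free_piece_def)
    moreover have "?mat_app w = 0"
    proof
      fix p
      have "(\<Sum>q\<in>?Q. const_poly (c q b) * w q) = 0" if b: "b \<in> B" for b
      proof -
        have "(\<Sum>q\<in>?Q. const_poly (c q b) * w q) = const_poly (lk (\<Sum>q\<in>?Q. const_poly (c q b) * u q) (unitm x))"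
          by (simp add: w_def lookup_sum const_poly_sum const_poly_mult)
        thus ?thesis using rel[OF b] by simp
      qed
      moreover have "?mat_app w 0 = (\<Sum>b\<in>B. (\<Sum>q\<in>?Q. const_poly (c q b) * w q) * complement_prod b)"
        by (rule app0) (simp only: w_def if_False)
      ultimately have "?mat_app w 0 = 0" by simp
      thus "?mat_app w p = 0 p" by (cases "p = 0") (auto simp: mat_app_def)
    qed
    ultimately have "w \<in> K' ?r" by (simp add: K')
    from mn[OF this, of q] show ?thesis using q by (simp add: w_def const_poly_def)
  qed
  hence "u q = 0" if "q \<in> ?Q" for q
    using homogeneous_lin[OF lin[OF that]] that by simp
  hence "u q = 0" for q using out by blast
  thus "u \<in> {0}" by auto
qed

text \<open>Holds for every minimal resolution, with a right side independent of it; this makes the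
  description in \<open>graded_betti\<close> unique.\<close>

lemma betti_count:
  assumes res: "minimal_graded_free_resolution I G D"
  shows "int (count_list (G (Suc i)) j) =
    (if i = 0 \<and> j = int v - int n then int (card B)
     else if j = int v - int n + 1 + int i then (- 1) ^ (i + 1) * (backward_diff ^^ n) (h_fun I) j
     else 0)"
proof -
  let ?r = "int v - int n"
  define A where "A i p q = D i $$ (p, q)" for i p q
  define K where "K = syzygy_pieces I G A"
  have G0: "G 0 = [0]" and cover_resolution: "cover_resolution G A K"
    using res unfolding minimal_resolution_iff[OF graded_sub_config_ideal config_ideal_graded[OF Diff_subset]]
    by (auto simp: K_def A_def[abs_def])
  have mc: "min_cover (G i) (G (Suc i)) (A i) (K i) (K (Suc i))" for i
    using cover_resolution by (simp add: cover_resolution_def)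
  have K0: "K 0 = (\<lambda>d. {u \<in> free_piece [0] d. u 0 \<in> I})" by (auto simp: K_def)
  have van0: "koszul_vanishes (K 0) p j" if "?r + 2 + int p \<le> j" for p j
    unfolding K0 by (rule config_ideal_koszul_vanishes[OF Diff_subset that])
  have upper: "x \<le> ?r + 1 + int i" if "x \<in> set (G (Suc i))" for i x
  proof (rule ccontr)
    assume "\<not> x \<le> ?r + 1 + int i"
    hence "koszul_vanishes (K i) 0 x" by (intro cover_resolution_koszul_vanishes[OF cover_resolution van0]) auto
    thus False using cover_degree_vanish[OF mc] that by blast
  qed
  have lower1: "?r \<le> x" if "x \<in> set (G 1)" for x
  proof (rule ccontr)
    assume "\<not> ?r \<le> x"
    hence "K 0 x \<subseteq> {0}" unfolding K0 by (intro initial_degree) simp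
    thus False using cover_degree_zero[OF mc[of 0]] that by simp
  qed
  \<comment> \<open>The induction starts from the absence of linear syzygies; each step gains a
    degree from \<open>cover_syz_zero\<close>.\<close>
  have low: "K (Suc i) d \<subseteq> {0}" if "d \<le> ?r + 1 + int i" for i d
    using that
  proof (induction i arbitrary: d)
    case 0
    show ?case
    proof (cases "d = ?r + 1")
      case True
      have "min_cover [0] (G 1) (A 0) (\<lambda>d. {u \<in> free_piece [0] d. u 0 \<in> I}) (K 1)"
        using mc[of 0] unfolding G0 K0 by simp
      from no_linear_strand[OF this lower1] show ?thesis unfolding True by (simp only: One_nat_def)
    next
      case False
      show ?thesis
        by (rule cover_syz_zero[OF mc]) (use lower1 False 0 in fastforce)
    qed
  next
    case (Suc i)
    show ?case
    proof (rule cover_syz_zero[OF mc])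
      fix b assume b: "b \<in> set (G (Suc (Suc i)))"
      show "d \<le> b"
      proof (rule ccontr)
        assume "\<not> d \<le> b"
        hence "K (Suc i) b \<subseteq> {0}" using Suc.prems by (intro Suc.IH) auto
        thus False using cover_degree_zero[OF mc] b by blast
      qed
    qed
  qed
  have deg: "x = ?r + 1 + int (Suc i)" if x: "x \<in> set (G (Suc (Suc i)))" for i x
  proof -
    have "\<not> x \<le> ?r + 1 + int i" using cover_degree_zero[OF mc low] x by blast
    thus ?thesis using upper[OF x] by simp
  qed
  have dim0: "fv.dim (S :: (nat \<Rightarrow> ('i, 'k) mpoly) set) = 0" if "S \<subseteq> {0}" for S
    using fv.dim_le_card[of S "{}"] that by simp
  show ?thesis
  proof (cases "i = 0 \<and> j = ?r")
    case True
    have "(\<Sum>b\<leftarrow>G 1. piece_dim n (?r - b)) = (\<Sum>b\<leftarrow>G 1. if ?r - b = 0 then 1 else 0)"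
      using lower1 by (intro arg_cong[of _ _ sum_list] map_cong refl) (fastforce simp: piece_dim_def)
    hence "int (fv.dim (free_piece (G 1) ?r :: (nat \<Rightarrow> ('i, 'k) mpoly) set)) = int (count_list (G 1) ?r)"
      unfolding dim_free_piece[OF dim] sum_list_indicator .
    moreover have "fv.dim (free_piece (G 1) ?r :: (nat \<Rightarrow> ('i, 'k) mpoly) set) = card B"
      using min_cover_dim[OF mc[of 0], of ?r] dim0[OF low[of ?r 0]] dim_initial_piece
      by (simp add: K0)
    ultimately show ?thesis using True by simp
  next
    case F: False
    show ?thesis
    proof (cases "j = ?r + 1 + int i")
      case False
      have "j \<notin> set (G (Suc i))"
        using F False deg[of j] upper[of j i] lower1[of j] by (cases i) fastforce+
      thus ?thesis unfolding if_not_P[OF F] if_not_P[OF False] by simp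
    next
      case True
      \<comment> \<open>\<open>K m\<close> vanishes up to degree \<open>?r + 2 + i\<close>, hence in
        all degrees up to j, and the truncated Euler sum has no remainder there.\<close>
      define m where "m = Suc (Suc i)"
      have H: "int (hilbert_fun I d) = piece_dim n d - (\<Sum>i'<m. (- 1) ^ i' * (\<Sum>b\<leftarrow>G (Suc i'). piece_dim n (d - b)))"
        if "d \<le> j" for d
      proof -
        have "d \<le> ?r + 1 + int (Suc i)" using that True by simp
        hence "fv.dim (K m d) = 0" unfolding m_def by (intro dim0 low)
        hence "int (fv.dim (K 0 d)) = (\<Sum>i'<m. (- 1) ^ i' * (\<Sum>b\<leftarrow>G (Suc i'). piece_dim n (d - b)))"
          using cover_resolution_euler[OF cover_resolution, of d m] by (simp add: dim_free_piece[OF dim])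
        moreover have "int (hilbert_fun I d) + int (fv.dim (K 0 d)) = piece_dim n d"
          using hilbert_fun_dim[OF pv_subspace_config_ideal[of "X - B"], of d] dim_free_piece[OF dim, of "[0]" d]
          by (simp add: K0 flip: of_nat_add)
        ultimately show ?thesis by simp
      qed
      have "(backward_diff ^^ n) (h_fun I) j = (backward_diff ^^ Suc n) (\<lambda>d. int (hilbert_fun I d)) j"
        by (simp only: h_fun_def funpow_Suc_right o_apply)
      also have "\<dots> = (backward_diff ^^ Suc n) (\<lambda>d. piece_dim n d - (\<Sum>i'<m. (- 1) ^ i' * (\<Sum>b\<leftarrow>G (Suc i'). piece_dim n (d - b)))) j"
        by (rule backward_diff_cong) (rule H)
      also have "\<dots> = (if j = 0 then 1 else 0) - (\<Sum>i'<m. (- 1) ^ i' * int (count_list (G (Suc i')) j))"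
        unfolding backward_diff_diff backward_diff_sum backward_diff_mult backward_diff_sum_list
          backward_diff_shift[of _ "piece_dim n"] backward_diff_piece_dim sum_list_indicator ..
      also have "(\<Sum>i'<m. (- 1) ^ i' * int (count_list (G (Suc i')) j))
        = (\<Sum>i'<m. if i' = i then (- 1) ^ i * int (count_list (G (Suc i)) j) else 0)"
      \<comment> \<open>In the sum the degree j occurs in \<open>G (Suc i)\<close> only, so nothing
        cancels; R itself contributes nothing because j is positive.\<close>
      proof (intro sum.cong refl)
        fix i'
        have "j \<notin> set (G (Suc i'))" if "i' \<noteq> i"
          using that deg[of j] upper[of j i'] True by (cases i') fastforce+
        thus "(- 1) ^ i' * int (count_list (G (Suc i')) j) = (if i' = i then (- 1) ^ i * int (count_list (G (Suc i)) j) else 0)"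
          by simp
      qed
      also have "\<dots> = (- 1) ^ i * int (count_list (G (Suc i)) j)" by (simp add: m_def)
      finally have "(backward_diff ^^ n) (h_fun I) j = - ((- 1) ^ i * int (count_list (G (Suc i)) j))"
        using True nv by simp
      thus ?thesis using F True by (simp flip: power_add mult_2 mult.assoc)
    qed
  qed
qed

lemma graded_betti_config:
  "int (graded_betti I i j) =
    (if i = 0 \<and> j = int v - int n then int (card B)
     else if j = int v - int n + 1 + int i then (- 1) ^ (i + 1) * (backward_diff ^^ n) (h_fun I) j
     else 0)"
proof -
  obtain G D where res: "minimal_graded_free_resolution I G D"
    using minimal_resolution_exists[OF graded_sub_config_ideal config_ideal_graded[OF Diff_subset]
        config_ideal_koszul_vanishes[OF Diff_subset]] by blast
  have "graded_betti I i j = count_list (G (Suc i)) j"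
    unfolding graded_betti_def
  proof (rule the_equality)
    fix b assume "\<exists>G D. minimal_graded_free_resolution I G D \<and> b = count_list (G (Suc i)) j"
    then obtain G' D' where "minimal_graded_free_resolution I G' D'" "b = count_list (G' (Suc i)) j" by blast
    hence "int b = int (count_list (G (Suc i)) j)"
      using betti_count[OF res, of i j] betti_count[of G' D' i j] by simp
    thus "b = count_list (G (Suc i)) j" by simp
  qed (use res in blast)
  thus ?thesis using betti_count[OF res] by simp
qed

end

section \<open>Representatives of points in projective space\<close>

lemma proj_spaceE:
  assumes "Q \<in> proj_space"
  obtains x where "x \<noteq> (\<lambda>_. 0)" "Q = {y. \<exists>c. c \<noteq> 0 \<and> y = (\<lambda>i. c * x i)}"
  using assms unfolding proj_space_def by (auto elim!: quotientE)

lemma proj_spaceI: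
  assumes "x \<noteq> (\<lambda>_. 0)"
  shows "{y. \<exists>c. c \<noteq> 0 \<and> y = (\<lambda>i. c * x i)} \<in> proj_space"
proof -
  have e: "{y. \<exists>c. c \<noteq> 0 \<and> y = (\<lambda>i. c * x i)} =
      {(x, y). x \<noteq> (\<lambda>_. 0) \<and> (\<exists>c. c \<noteq> 0 \<and> y = (\<lambda>i. c * x i))} `` {x}"
    using assms by auto
  show ?thesis unfolding proj_space_def e by (rule quotientI) (use assms in simp)
qed

lemma mem_hyperplane:
  assumes "linear_form p" "x \<noteq> (\<lambda>_. 0)"
  shows "{y. \<exists>c. c \<noteq> 0 \<and> y = (\<lambda>i. c * x i)} \<in> hyperplane p \<longleftrightarrow> poly_eval p x = 0"
proof -
  have "poly_eval p (\<lambda>i. c * x i) = c * poly_eval p x" for c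
    using poly_eval_scale[of 1 p c x] assms(1) by (simp add: linear_form_def)
  thus ?thesis using proj_spaceI[OF assms(2)] unfolding hyperplane_def
    by (auto intro: exI[of _ 1] zero_neq_one[symmetric])
qed

text \<open>The two parts of \<open>meet_properly\<close> become statements about representing
  vectors: one-point intersections give \<open>P_unique\<close>, and the empty intersections of n +
  1 hyperplanes give \<open>P_off\<close>.\<close>

lemma meet_properly_points:
  fixes l :: "nat \<Rightarrow> ('i::finite, 'k::field) mpoly"
  assumes dim: "CARD('i) = n + 1" and n: "0 < n" "n \<le> v"
    and l: "\<forall>a\<in>{1..v}. linear_form (l a)" and mp: "meet_properly n v l"
  obtains P where "star_config l n v P"
proof -
  let ?cl = "\<lambda>x :: 'i \<Rightarrow> 'k. {y. \<exists>c. c \<noteq> 0 \<and> y = (\<lambda>i. c * x i)}"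
  have "\<exists>x. x \<noteq> (\<lambda>_. 0) \<and> (\<Inter>a\<in>s. hyperplane (l a)) = {?cl x}" if s: "s \<in> n_subsets n v" for s
  proof -
    obtain Q where Q: "(\<Inter>a\<in>s. hyperplane (l a)) = {Q}" using mp s unfolding meet_properly_def by blast
    \<comment> \<open>An intersection over the empty set would be everything; with
      \<open>0 < n\<close> the point Q lies in \<open>proj_space\<close>.\<close>
    have "s \<noteq> {}" using n_subsetsD[OF s] n by auto
    then obtain a where "a \<in> s" by blast
    hence "Q \<in> hyperplane (l a)" using Q by blast
    hence "Q \<in> proj_space" by (simp add: hyperplane_def)
    then obtain x where "x \<noteq> (\<lambda>_. 0)" "Q = ?cl x" by (rule proj_spaceE)
    thus ?thesis using Q by blast
  qed
  hence "\<forall>s\<in>n_subsets n v. \<exists>x. x \<noteq> (\<lambda>_. 0) \<and> (\<Inter>a\<in>s. hyperplane (l a)) = {?cl x}" by (rule ballI)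
  from bchoice[OF this] obtain P where
    "\<forall>s\<in>n_subsets n v. P s \<noteq> (\<lambda>_. 0) \<and> (\<Inter>a\<in>s. hyperplane (l a)) = {?cl (P s)}"
    by (rule exE)
  note P = this[THEN bspec, THEN conjunct1] this[THEN bspec, THEN conjunct2]
  have lf: "linear_form (l a)" if "s \<in> n_subsets n v" "a \<in> s" for s a
    using n_subsetsD[OF that(1)] that(2) l by blast
  have "star_config l n v P"
  proof
    fix s a assume s: "s \<in> n_subsets n v"
    show "poly_eval (l a) (P s) = 0" if "a \<in> s"
      using P(2)[OF s] that mem_hyperplane[OF lf[OF s that] P(1)[OF s]] by blast
    show "poly_eval (l a) (P s) \<noteq> 0" if a: "a \<in> {1..v} - s"
    proof
      assume 0: "poly_eval (l a) (P s) = 0"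
      have "insert a s \<in> n_subsets (n + 1) v" using n_subsetsD[OF s] a by (auto simp: n_subsets_def)
      hence "(\<Inter>b\<in>insert a s. hyperplane (l b)) = {}" using mp unfolding meet_properly_def by blast
      moreover have "?cl (P s) \<in> hyperplane (l a)" using 0 mem_hyperplane[OF _ P(1)[OF s]] l a by blast
      ultimately show False using P(2)[OF s] by auto
    qed
  next
    fix s x assume s: "s \<in> n_subsets n v" and x: "\<And>a. a \<in> s \<Longrightarrow> poly_eval (l a) x = 0"
    show "\<exists>c. x = (\<lambda>i. c * P s i)"
    proof (cases "x = (\<lambda>_. 0)")
      case True
      thus ?thesis by (intro exI[of _ 0]) simp
    next
      case False
      have "?cl x \<in> (\<Inter>a\<in>s. hyperplane (l a))"
        using x mem_hyperplane[OF lf[OF s] False] by blast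
      hence e: "?cl x = ?cl (P s)" unfolding P(2)[OF s] by (rule singletonD)
      have "x \<in> ?cl x" by (auto intro: exI[of _ 1])
      thus ?thesis unfolding e by blast
    qed
  qed (use assms P in \<open>auto simp: linear_form_def\<close>)
  thus thesis by (rule that)
qed

text \<open>The sign is \<open>(- 1) ^ (i + 1)\<close>, where the English statement has (-1)^i: in
  the numerator of the Hilbert series of R/I the term R is positive and the generators of I are
  negative. For n = 2, v = 4 the ideal is a complete intersection of two conics, the second
  difference of h at 4 is 1, and so is the Betti number at i = 1, j = 4.\<close>

theorem corollary4p6:
  fixes l :: "nat \<Rightarrow> ('i::finite, 'k::field) mpoly"
    and t n v :: nat and B :: "nat set set" and i :: nat and j :: int
  assumes "CARD('i) = n + 1"
    and "steiner_system t n v B" and "t < n" and "n \<le> v"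
    and "\<forall>a\<in>{1..v}. linear_form (l a)"
    and "inj_on (\<lambda>a. hyperplane (l a)) {1..v}"
    and "meet_properly n v l"
    and "t = n - 1"
  shows "int (graded_betti (config_ideal l (n_subsets n v - B)) i j) =
    (if i = 0 \<and> j = int v - int n then int (card B)
     else if j = int v - int n + 1 + int i
       then (- 1) ^ (i + 1) * (backward_diff ^^ n) (h_fun (config_ideal l (n_subsets n v - B))) j
     else 0)"
proof -
  obtain P where "star_config l n v P"
    using meet_properly_points[of n v l] assms by auto
  then interpret star_config l n v P .
  interpret steiner_config l n v P B
    by unfold_locales (use assms(2,8) in \<open>unfold steiner_system_def, blast+\<close>)
  show ?thesis by (rule graded_betti_config)
qed

end
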